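(* Let $G=(V,E)$ be a simple, connected, non-bipartite graph with edge ideal $I_G$. Then $$\mathrm{astab}(I_G)=\max_{\{U\subset V\,\mid\,\mathcal D^*(U)\neq\emptyset\}}\Big\{\min\{1+\nu^*(G_W)\mid W\in\mathcal D^*(U)\}\Big\}$$ and $$\mathrm{dstab}(I_G)=\min\{1+\nu^*(G_W)\mid W\in\mathcal D^*(V)\}.$$
   Context: Graphs are finite and simple. Write $V=\{P_1,\dots,P_d\}$ and $R=K[x_1,\dots,x_d]$ with $K$ a field. The edge ideal of $G$ is $I_G=(x_ix_j : P_iP_j\in E)\subset R$. For $U\subset V$, $\mathfrak m^{\mathbf 1_U}$ is the prime ideal generated by the $x_i$ with $P_i\in U$, and $G_U$ is the subgraph of $G$ induced on $U$. $\mathrm{Ass}(J)$ is the set of associated primes of $R/J$. $\mathrm{astab}(I_G)$ is the smallest $k\ge1$ such that $\mathrm{Ass}(I_G^k)=\mathrm{Ass}(I_G^{k+i})$ for all $i\ge 1$; $\mathrm{dstab}(I_G)$ is the smallest $k$ such that $\mathfrak m^{\mathbf 1_V}=(x_1,\dots,x_d)\in\mathrm{Ass}(I_G^k)$. For $S\subset V$, $N(S)$ is the set of vertices adjacent to at least one vertex of $S$ (so $N(\emptyset)=\emptyset$). Dominant* sets. Let $U\subset V$ and $Z=V\setminus U$. If $Z$ is not an independent set, put $\mathcal D^*(U)=\emptyset$. If $Z$ is independent, a set $W\subset V\setminus(Z\cup N(Z))$ is $U$-dominant if $V=N(W)\cup N(Z)\cup Z$; it is $U$-dominant* if it is $U$-dominant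 and every connected component of $G_W$ contains an odd cycle (the set $W=\emptyset$ is allowed, and is $U$-dominant* exactly when $V=N(Z)\cup Z$). $\mathcal D^*(U)$ is the set of all $U$-dominant* sets $W\subset U$. Ears. Given a graph $H'$, adding an ear to $H'$ means taking two vertices $a,b$ of $H'$ and adding a path from $a$ to $b$ all of whose vertices other than $a,b$ are new; $a=b$ is allowed (closed ear, i.e. a cycle through $a$). An ear is odd (even) if it has an odd (even) number of edges. A generalized ear decomposition of a connected graph $H$ is a sequence $F_0,F_1,\dots,F_s$ with union $H$ such that $F_0$ is a cycle (counted as an odd or even ear according to its length) or a bridge of $H$, and for $i\ge 1$ each $F_i$ is either an ear added to $F_0\cup\dots\cup F_{i-1}$ or a bridge of $H$ with exactly one endpoint in $F_0\cup\dots\cup F_{i-1}$. Bridges are not counted as ears when counting even ears. $\varphi(H)$ is the minimum number of even ears in a generalized ear decomposition of $H$; $\psi(H)$ is the number of bridges of $H$. For a disconnected graph, $\varphi$ and $\psi$ are the sums over the connected components. For $\emptyset\ne W\in\mathcal D^*(U)$ put $\nu^*(G_W)=\frac12\big(\mathrm{card}(W)+\varphi(G_W)+\psi(G_W)-t_W\big)$, where $t_W$ is the number of connected components of $G_W$; for $W=\emptyset$ put $\nu^*(G_W)=0$. *)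

theory Defs
  imports
    Complex_Main
    "HOL-Library.Poly_Mapping"
    "HOL-Algebra.QuotRing"
    "HOL-Algebra.Ideal_Product"
begin

section \<open>Finite simple graphs\<close>

text \<open>Edges are two-element sets of vertices.\<close>

datatype 'v graph = Graph (verts: "'v set") (edges: "'v set set")

definition simple_graph :: "'v graph \<Rightarrow> bool" where
  "simple_graph G \<longleftrightarrow>
     finite (verts G) \<and> (\<forall>e\<in>edges G. e \<subseteq> verts G \<and> card e = 2)"

definition subgraph :: "'v graph \<Rightarrow> 'v graph \<Rightarrow> bool" where
  "subgraph H G \<longleftrightarrow> verts H \<subseteq> verts G \<and> edges H \<subseteq> edges G"

definition induced :: "'v graph \<Rightarrow> 'v set \<Rightarrow> 'v graph" where
  "induced G W = Graph W {e \<in> edges G. e \<subseteq> W}"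

definition graph_Union :: "'v graph set \<Rightarrow> 'v graph" where
  "graph_Union Fs = Graph (\<Union>F\<in>Fs. verts F) (\<Union>F\<in>Fs. edges F)"

definition nbhd :: "'v graph \<Rightarrow> 'v set \<Rightarrow> 'v set" where
  "nbhd G S = {v \<in> verts G. \<exists>u\<in>S. {u, v} \<in> edges G}"

definition independent_set :: "'v graph \<Rightarrow> 'v set \<Rightarrow> bool" where
  "independent_set G Z \<longleftrightarrow> (\<forall>u\<in>Z. \<forall>v\<in>Z. {u, v} \<notin> edges G)"

definition bipartite :: "'v graph \<Rightarrow> bool" where
  "bipartite G \<longleftrightarrow>
     (\<exists>A B. A \<union> B = verts G \<and> A \<inter> B = {} \<and> independent_set G A \<and> independent_set G B)"

definition reachable :: "'v graph \<Rightarrow> ('v \<times> 'v) set" where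
  "reachable G =
     {(u, v). u \<in> verts G \<and> v \<in> verts G \<and> (u, v) \<in> {(a, b). {a, b} \<in> edges G}\<^sup>*}"

definition connected_graph :: "'v graph \<Rightarrow> bool" where
  "connected_graph G \<longleftrightarrow>
     verts G \<noteq> {} \<and> (\<forall>u\<in>verts G. \<forall>v\<in>verts G. (u, v) \<in> reachable G)"

definition components :: "'v graph \<Rightarrow> 'v graph set" where
  "components G = induced G ` (verts G // reachable G)"

text \<open>The graph traced out by a list of successive vertices; for the paths and cycles
  below it has one edge less than the list has entries.\<close>

definition walk_graph :: "'v list \<Rightarrow> 'v graph" where
  "walk_graph p = Graph (set p) {{p ! i, p ! Suc i} | i. Suc i < length p}"

definition open_path :: "'v list \<Rightarrow> bool" where
  "open_path p \<longleftrightarrow> length p \<ge> 2 \<and> distinct p"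

text \<open>A cycle repeats its first vertex at the end; being a cycle of a simple graph, it has at
  least three edges.\<close>

definition closed_path :: "'v list \<Rightarrow> bool" where
  "closed_path p \<longleftrightarrow> length p \<ge> 4 \<and> hd p = last p \<and> distinct (butlast p)"

definition cycle_graph :: "'v graph \<Rightarrow> bool" where
  "cycle_graph C \<longleftrightarrow> (\<exists>p. closed_path p \<and> C = walk_graph p)"

definition has_odd_cycle :: "'v graph \<Rightarrow> bool" where
  "has_odd_cycle G \<longleftrightarrow> (\<exists>C. cycle_graph C \<and> subgraph C G \<and> odd (card (edges C)))"

definition bridges :: "'v graph \<Rightarrow> 'v set set" where
  "bridges H = {e \<in> edges H.
     card (components (Graph (verts H) (edges H - {e}))) > card (components H)}"

section \<open>Generalized ear decompositions\<close>

text \<open>The ear consists of its path alone (including both end vertices), and its edges have to be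
  new; the latter matters only for paths of length one, which have no inner vertices.\<close>

definition ear :: "'v graph \<Rightarrow> 'v graph \<Rightarrow> bool" where
  "ear H' F \<longleftrightarrow>
     (\<exists>p. (open_path p \<or> closed_path p) \<and> F = walk_graph p \<and>
          hd p \<in> verts H' \<and> last p \<in> verts H' \<and>
          (set p - {hd p, last p}) \<inter> verts H' = {} \<and>
          edges F \<inter> edges H' = {})"

definition bridge_of :: "'v graph \<Rightarrow> 'v graph \<Rightarrow> bool" where
  "bridge_of H F \<longleftrightarrow> (\<exists>e\<in>bridges H. F = Graph e {e})"

definition gen_ear_decomposition :: "'v graph \<Rightarrow> 'v graph list \<Rightarrow> bool" where
  "gen_ear_decomposition H Fs \<longleftrightarrow>
     Fs \<noteq> [] \<and> graph_Union (set Fs) = H \<and>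
     (cycle_graph (Fs ! 0) \<or> bridge_of H (Fs ! 0)) \<and>
     (\<forall>i. 1 \<le> i \<and> i < length Fs \<longrightarrow>
        (let H' = graph_Union (set (take i Fs)) in
           ear H' (Fs ! i) \<or>
           (bridge_of H (Fs ! i) \<and> card (verts (Fs ! i) \<inter> verts H') = 1)))"

definition even_ears :: "'v graph \<Rightarrow> 'v graph list \<Rightarrow> nat" where
  "even_ears H Fs =
     card {i. i < length Fs \<and> \<not> bridge_of H (Fs ! i) \<and> even (card (edges (Fs ! i)))}"

definition phi_connected :: "'v graph \<Rightarrow> nat" where
  "phi_connected H = (LEAST n. \<exists>Fs. gen_ear_decomposition H Fs \<and> even_ears H Fs = n)"

definition phi :: "'v graph \<Rightarrow> nat" where
  "phi H = (\<Sum>C\<in>components H. phi_connected C)"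

definition psi :: "'v graph \<Rightarrow> nat" where
  "psi H = (\<Sum>C\<in>components H. card (bridges C))"

definition nu_star :: "'v graph \<Rightarrow> real" where
  "nu_star H =
     (if verts H = {} then 0
      else (real (card (verts H)) + real (phi H) + real (psi H) - real (card (components H))) / 2)"

section \<open>Dominant* sets\<close>

definition dominant :: "'v graph \<Rightarrow> 'v set \<Rightarrow> 'v set \<Rightarrow> bool" where
  "dominant G U W \<longleftrightarrow>
     (let Z = verts G - U in
        W \<subseteq> verts G - (Z \<union> nbhd G Z) \<and> verts G = nbhd G W \<union> nbhd G Z \<union> Z)"

definition dominant_star :: "'v graph \<Rightarrow> 'v set \<Rightarrow> 'v set \<Rightarrow> bool" where
  "dominant_star G U W \<longleftrightarrow>
     dominant G U W \<and> (\<forall>C\<in>components (induced G W). has_odd_cycle C)"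

definition Dstar :: "'v graph \<Rightarrow> 'v set \<Rightarrow> 'v set set" where
  "Dstar G U =
     (if independent_set G (verts G - U) then {W. W \<subseteq> U \<and> dominant_star G U W} else {})"

section \<open>Edge ideals and associated primes\<close>

text \<open>Polynomials are finitely supported maps from exponent vectors to coefficients.
  The ring \<open>K[x\<^sub>v | v \<in> V]\<close> consists of those involving only variables indexed by \<open>V\<close>.\<close>

type_synonym ('v, 'k) mpoly = "('v \<Rightarrow>\<^sub>0 nat) \<Rightarrow>\<^sub>0 'k"

definition mpoly_ring :: "'v set \<Rightarrow> ('v, 'k::field) mpoly ring" where
  "mpoly_ring V =
     \<lparr>carrier = {p. \<forall>m\<in>Poly_Mapping.keys p. Poly_Mapping.keys m \<subseteq> V},
      mult = (*), one = 1, zero = 0, add = (+)\<rparr>"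

definition var :: "'v \<Rightarrow> ('v, 'k::field) mpoly" where
  "var v = Poly_Mapping.single (Poly_Mapping.single v 1) 1"

definition edge_ideal :: "'v graph \<Rightarrow> ('v, 'k::field) mpoly set" where
  "edge_ideal G = genideal (mpoly_ring (verts G)) {var u * var v | u v. {u, v} \<in> edges G}"

definition max_ideal :: "'v set \<Rightarrow> ('v, 'k::field) mpoly set" where
  "max_ideal V = genideal (mpoly_ring V) (var ` V)"

text \<open>The associated primes of the module \<open>R/J\<close>, that is, the prime ideals of \<open>R\<close> that are
  annihilators of an element of \<open>R/J\<close>; \<open>a \<in> R\<close> acts as multiplication by its class.\<close>

definition Ass :: "('a, 'b) ring_scheme \<Rightarrow> 'a set \<Rightarrow> 'a set set" where
  "Ass R J =
     {P. primeideal P R \<and>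
         (\<exists>m\<in>carrier (R Quot J).
            P = {a \<in> carrier R. (J +>\<^bsub>R\<^esub> a) \<otimes>\<^bsub>R Quot J\<^esub> m = \<zero>\<^bsub>R Quot J\<^esub>})}"

abbreviation ideal_power :: "('a, 'b) ring_scheme \<Rightarrow> 'a set \<Rightarrow> nat \<Rightarrow> 'a set" where
  "ideal_power R I k \<equiv> I [^]\<^bsub>ideals_set R\<^esub> k"

definition astab :: "('a, 'b) ring_scheme \<Rightarrow> 'a set \<Rightarrow> nat" where
  "astab R I =
     (LEAST k. 1 \<le> k \<and> (\<forall>i\<ge>1. Ass R (ideal_power R I k) = Ass R (ideal_power R I (k + i))))"

definition dstab :: "'v set \<Rightarrow> ('v, 'k::field) mpoly set \<Rightarrow> nat" where
  "dstab V I = (LEAST k. max_ideal V \<in> Ass (mpoly_ring V) (ideal_power (mpoly_ring V) I k))"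

end

theory Submission
  imports Defs "HOL-Library.Multiset"
begin

text \<open>
  A monomial \<open>x\<^sup>a\<close> lies in \<open>I\<^sup>k\<close> iff \<open>k\<close> edges, counted with multiplicity, fit into \<open>a\<close>. Since the
  powers of \<open>I\<close> are monomial ideals, the associated primes of \<open>I\<^sup>k\<close> are generated by those sets \<open>U\<close>
  of variables for which some \<open>x\<^sup>a\<close> is multiplied into \<open>I\<^sup>k\<close> exactly by the monomials involving \<open>U\<close>.
  The vertices outside \<open>U\<close> are then independent and absorb their neighbours; on the rest,
  minimality of \<open>a\<close> and Gallai's lemma show that \<open>a\<close> is supported on a dominating set \<open>W\<close> and that
  replacing each vertex \<open>v\<close> by \<open>a v\<close> copies makes every component of \<open>G\<^sub>W\<close> factor-critical.

  For connected \<open>H\<close> with an odd cycle, the least total weight of such a critical \<open>a\<close> is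
  \<open>card (verts H) + phi + psi\<close>. Alternating trails (Lovasz) turn a critical weight into a sequence
  of ears and pendant edges; conversely every even ear or pendant edge costs one extra copy of a
  vertex, provided the sequence starts with an odd cycle. Both this and the requirement that
  pendant edges be bridges are achieved by one rerooting lemma: a sequence of ears can be
  restarted, at no extra cost, from a path between any two vertices.
\<close>

section \<open>Paths, connectivity and ear sequences\<close>

text \<open>The constants come from counting copies. A critical weight has odd total on each
  component of G_W, and a maximum packing leaves exactly one copy over in each; with t components
  the total is 2n + t and n edges fit inside W. One more copy of any neighbour of W makes n + 1
  edges fit, so the prime appears at the power n + 1. Minimising the total to
  \<open>card W + phi + psi\<close> turns n into \<open>nu_star\<close>. Adding a parallel copy of
  an edge keeps a weight critical and raises n by one, so a prime once present stays: astab is the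
  largest of the first occurrences, dstab the first occurrence for U = V. The obstacle is that
  \<open>phi\<close> and \<open>psi\<close> refer to bridges of the finished graph, while a weight
  only sees a graph being built, in which a pendant edge may later end up on a cycle. A single cost
  for even ears and pendant edges makes the two sides comparable, but parities must then survive
  every rearrangement of the sequence; this dictates the charge for root paths with an even number
  of vertices.\<close>

fun path_edges :: "'v list \<Rightarrow> 'v set set" where
  "path_edges (x # y # zs) = insert {x, y} (path_edges (y # zs))"
| "path_edges _ = {}"

lemma path_edges_append:
  "path_edges (xs @ y # zs) = path_edges (xs @ [y]) \<union> path_edges (y # zs)"
  by (induction xs rule: path_edges.induct) auto

lemma path_edges_rev: "path_edges (rev p) = path_edges p"
proof (induction p rule: path_edges.induct)
  case (1 x y zs)
  have "path_edges (rev (x # y # zs)) = path_edges (rev zs @ y # [x])" by simp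
  also have "\<dots> = path_edges (rev zs @ [y]) \<union> path_edges [y, x]"
    by (rule path_edges_append)
  also have "\<dots> = insert {x, y} (path_edges (rev (y # zs)))" by auto
  finally show ?case using 1 by simp
qed auto

lemma path_edges_rev_Cons: "path_edges (p # rev ys @ [s]) = path_edges (s # ys @ [p])"
  using path_edges_rev[of "s # ys @ [p]"] by simp

lemma path_edges_subset: "e \<in> path_edges p \<Longrightarrow> e \<subseteq> set p"
  by (induction p rule: path_edges.induct) auto

lemma finite_path_edges [simp]: "finite (path_edges p)"
  by (induction p rule: path_edges.induct) auto

lemma card_path_edges_le: "card (path_edges p) \<le> length p - 1"
proof (induction p rule: path_edges.induct)
  case (1 x y zs)
  then show ?case
    using card_insert_le_m1[of "Suc (length zs)" "path_edges (y # zs)" "{x,y}"] by simp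
qed auto

lemma card_path_edges: "distinct p \<Longrightarrow> card (path_edges p) = length p - 1"
proof (induction p rule: path_edges.induct)
  case (1 x y zs)
  have "{x, y} \<notin> path_edges (y # zs)"
    using 1(2) path_edges_subset[of "{x,y}" "y # zs"] by auto
  then show ?case using 1 by simp
qed auto

lemma path_edges_last:
  "e \<in> path_edges (xs @ [x]) \<Longrightarrow> x \<notin> set xs \<Longrightarrow> x \<in> e \<Longrightarrow> e = {last xs, x}"
  by (induction xs rule: path_edges.induct) auto

lemma card_path_edges_closed:
  assumes "distinct (x # xs)" "length xs \<ge> 2"
  shows "card (path_edges (x # xs @ [x])) = length xs + 1"
proof -
  obtain y ys where xs: "xs = y # ys" "ys \<noteq> []" using assms(2)
    by (cases xs; cases "tl xs") auto
  have "{x, y} \<notin> path_edges (xs @ [x])"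
  proof
    assume "{x, y} \<in> path_edges (xs @ [x])"
    then have "{x, y} = {last xs, x}" using path_edges_last[of _ xs x] assms by auto
    moreover have "last xs \<noteq> y" using xs assms(1) by (auto simp: last_ConsR)
    moreover have "x \<noteq> y" using xs assms by auto
    ultimately show False by (auto simp: doubleton_eq_iff)
  qed
  moreover have "card (path_edges (xs @ [x])) = length xs"
    using card_path_edges[of "xs @ [x]"] assms(1) by simp
  ultimately show ?thesis using xs by simp
qed

section \<open>Connectivity by a set of edges\<close>

definition conn :: "'v set set \<Rightarrow> ('v \<times> 'v) set" where
  "conn K = {(a, b). {a, b} \<in> K}\<^sup>*"

lemma conn_refl [simp]: "(a, a) \<in> conn K" by (simp add: conn_def)

lemma conn_sym: "(a, b) \<in> conn K \<Longrightarrow> (b, a) \<in> conn K"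
  using sym_rtrancl[of "{(a, b). {a, b} \<in> K}"]
  by (auto simp: conn_def sym_def insert_commute)

lemma conn_trans: "(a, b) \<in> conn K \<Longrightarrow> (b, c) \<in> conn K \<Longrightarrow> (a, c) \<in> conn K"
  by (auto simp: conn_def)

lemma conn_edge: "{a, b} \<in> K \<Longrightarrow> (a, b) \<in> conn K"
  by (auto simp: conn_def)

lemma conn_mono: "(a, b) \<in> conn K \<Longrightarrow> K \<subseteq> L \<Longrightarrow> (a, b) \<in> conn L"
  unfolding conn_def by (rule rtrancl_mono[THEN subsetD, of "{(a, b). {a, b} \<in> K}"]) auto

lemma conn_induct [consumes 1, case_names refl step]:
  assumes "(a, b) \<in> conn K" "P a"
    and "\<And>y z. (a, y) \<in> conn K \<Longrightarrow> {y, z} \<in> K \<Longrightarrow> P y \<Longrightarrow> P z"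
  shows "P b"
  using assms(1) unfolding conn_def
  by (induction rule: rtrancl_induct) (use assms(2,3) in \<open>auto simp: conn_def\<close>)

text \<open>A walk is mapped to a walk as soon as every edge goes to a connected pair. Used with
  maps that contract newly added vertices, and with the identity when a deleted edge has a
  detour.\<close>

lemma conn_map:
  assumes "(a, b) \<in> conn K" "\<And>x y. {x, y} \<in> K \<Longrightarrow> (f x, f y) \<in> conn L"
  shows "(f a, f b) \<in> conn L"
  using assms(1)
proof (induction rule: conn_induct)
  case (step y z)
  then show ?case using assms(2) conn_trans by metis
qed simp

lemma conn_path: "p \<noteq> [] \<Longrightarrow> (hd p, last p) \<in> conn (path_edges p)"
proof (induction p rule: path_edges.induct)
  case (1 x y zs)
  have "(y, last (y # zs)) \<in> conn (path_edges (x # y # zs))"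
    using 1 by (auto intro: conn_mono)
  moreover have "(x, y) \<in> conn (path_edges (x # y # zs))" by (auto intro: conn_edge)
  ultimately show ?case using conn_trans by fastforce
qed auto

lemma conn_path_mem:
  assumes "x \<in> set p" shows "(hd p, x) \<in> conn (path_edges p)"
proof -
  obtain ys zs where p: "p = ys @ x # zs" using assms split_list by fastforce
  have "(hd (ys @ [x]), x) \<in> conn (path_edges (ys @ [x]))"
    using conn_path[of "ys @ [x]"] by simp
  then show ?thesis
    using path_edges_append[of ys x zs] p by (cases ys) (auto intro: conn_mono)
qed

text \<open>\<open>xs\<close> lists the inner vertices only, so the ear has
  \<open>length xs + 1\<close> edges and is even exactly if \<open>length xs\<close> is odd. Without
  inner vertices it is a chord, which has to be new; a closed ear needs two inner vertices to be a
  cycle of length at least three.\<close>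

definition is_ear :: "'v set set \<Rightarrow> 'v set \<Rightarrow> 'v \<Rightarrow> 'v list \<Rightarrow> 'v \<Rightarrow> bool" where
  "is_ear K S s xs t \<longleftrightarrow> s \<in> S \<and> t \<in> S \<and> distinct xs \<and> set xs \<inter> S = {} \<and>
     (xs = [] \<longrightarrow> s \<noteq> t \<and> {s, t} \<notin> K) \<and> (s = t \<longrightarrow> length xs \<ge> 2)"

text \<open>The pendant edges drawn from \<open>B\<close> relax the bridges of a generalized ear decomposition:
  they need not be bridges of the final graph. The cost \<open>c\<close> counts even ears and pendant edges.\<close>

inductive ears :: "'v set set \<Rightarrow> 'v set set \<Rightarrow> 'v set \<Rightarrow> 'v set set \<Rightarrow> 'v set \<Rightarrow> nat \<Rightarrow> bool"
  for B K0 S0 where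
  base: "ears B K0 S0 K0 S0 0"
| ear: "ears B K0 S0 K S c \<Longrightarrow> is_ear K S s xs t \<Longrightarrow>
    ears B K0 S0 (K \<union> path_edges (s # xs @ [t])) (S \<union> set xs) (c + of_bool (odd (length xs)))"
| pend: "ears B K0 S0 K S c \<Longrightarrow> u \<in> S \<Longrightarrow> v \<notin> S \<Longrightarrow> {u, v} \<in> B \<Longrightarrow>
    ears B K0 S0 (insert {u, v} K) (insert v S) (Suc c)"

lemma ears_mono: "ears B K0 S0 K S c \<Longrightarrow> K0 \<subseteq> K \<and> S0 \<subseteq> S"
  by (induction rule: ears.induct) auto

lemma ears_Pow: "ears B K0 S0 K S c \<Longrightarrow> K0 \<subseteq> Pow S0 \<Longrightarrow> K \<subseteq> Pow S"
proof (induction rule: ears.induct)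
  case (ear K S c s xs t)
  then have "path_edges (s # xs @ [t]) \<subseteq> Pow (S \<union> set xs)"
    using path_edges_subset[of _ "s # xs @ [t]"] unfolding is_ear_def by fastforce
  then show ?case using ear by auto
qed auto

lemma ears_finite: "ears B K0 S0 K S c \<Longrightarrow> finite S0 \<Longrightarrow> finite S"
  by (induction rule: ears.induct) auto

lemma ears_trans:
  assumes "ears B K0 S0 K1 S1 c1" "ears B K1 S1 K2 S2 c2"
  shows "ears B K0 S0 K2 S2 (c1 + c2)"
  using assms(2)
proof (induction rule: ears.induct)
  case base
  then show ?case using assms(1) by simp
next
  case (ear K S c s xs t)
  then show ?case using ears.ear[of B K0 S0 K S "c1 + c" s xs t] by (simp add: add.assoc)
next
  case (pend K S c u v)
  then show ?case using ears.pend[of B K0 S0 K S "c1 + c" u v] by simp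
qed

text \<open>Pieces disjoint from a whole sequence may be put in before it instead of after it, since
  ears and pendant edges only have to avoid collisions. A pendant edge has its new end outside
  \<open>S0\<close>, hence the condition on \<open>B'\<close> concerns only edges not inside
  \<open>S0\<close>.\<close>

lemma ears_shift:
  assumes "ears B K0 S0 K S c" "S \<inter> Y = {}" "K \<inter> X = {}"
    and "\<And>e. e \<in> B \<Longrightarrow> e \<in> K \<Longrightarrow> \<not> e \<subseteq> S0 \<Longrightarrow> e \<in> B'"
  shows "ears B' (K0 \<union> X) (S0 \<union> Y) (K \<union> X) (S \<union> Y) c"
  using assms
proof (induction rule: ears.induct)
  case base
  then show ?case by (simp add: ears.base)
next
  case (ear K S c s xs t)
  have "ears B' (K0 \<union> X) (S0 \<union> Y) (K \<union> X) (S \<union> Y) c" using ear by auto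
  moreover have "is_ear (K \<union> X) (S \<union> Y) s xs t"
    using ear.hyps(2) ear.prems unfolding is_ear_def by auto
  ultimately show ?case
    using ears.ear[of B' "K0 \<union> X" "S0 \<union> Y" "K \<union> X" "S \<union> Y" c s xs t]
    by (simp add: Un_ac)
next
  case (pend K S c u v)
  have "ears B' (K0 \<union> X) (S0 \<union> Y) (K \<union> X) (S \<union> Y) c" using pend by auto
  moreover have "{u, v} \<in> B'"
    using pend.prems(3)[of "{u, v}"] pend.hyps ears_mono[OF pend.hyps(1)] by auto
  ultimately show ?case
    using ears.pend[of B' "K0 \<union> X" "S0 \<union> Y" "K \<union> X" "S \<union> Y" c u v] pend by simp
qed

text \<open>An odd path is charged like the even cycle it would form together with a further edge.\<close>

definition rooted ::
  "'v set set \<Rightarrow> 'v set set \<Rightarrow> 'v set \<Rightarrow> nat \<Rightarrow> 'v \<Rightarrow> 'v \<Rightarrow> bool" where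
  "rooted B K S c p q \<longleftrightarrow> (\<exists>P m. P \<noteq> [] \<and> hd P = p \<and> last P = q \<and> distinct P \<and>
     ears B (path_edges P) (set P) K S m \<and> m + of_bool (even (length P)) \<le> c)"

lemma rootedI:
  "P \<noteq> [] \<Longrightarrow> hd P = p \<Longrightarrow> last P = q \<Longrightarrow> distinct P \<Longrightarrow>
    ears B (path_edges P) (set P) K S m \<Longrightarrow> m + of_bool (even (length P)) \<le> c \<Longrightarrow>
    rooted B K S c p q"
  unfolding rooted_def by blast

lemma rooted_sym: "rooted B K S c p q \<Longrightarrow> rooted B K S c q p"
  unfolding rooted_def
proof (elim exE conjE)
  fix P m assume "P \<noteq> []" "hd P = p" "last P = q" "distinct P"
     "ears B (path_edges P) (set P) K S m" "m + of_bool (even (length P)) \<le> c"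
  then show "\<exists>P m. P \<noteq> [] \<and> hd P = q \<and> last P = p \<and> distinct P \<and>
     ears B (path_edges P) (set P) K S m \<and> m + of_bool (even (length P)) \<le> c"
    by (intro exI[of _ "rev P"] exI[of _ m]) (auto simp: hd_rev last_rev path_edges_rev)
qed

section \<open>Rerooting an ear sequence\<close>

lemma path_edges_Int_Pow:
  assumes "K \<subseteq> Pow S" "xs \<noteq> []" "set xs \<inter> S = {}"
  shows "K \<inter> path_edges (s # xs @ [t]) = {}"
proof -
  have "e \<inter> set xs \<noteq> {}" if "e \<in> path_edges (s # xs @ [t])" for e
    using that assms(2)
  proof (induction xs arbitrary: s)
    case (Cons x xs)
    then show ?case by (cases xs) auto
  qed simp
  then show ?thesis using assms by blast
qed

lemma path_edges_split3:
  "path_edges (s # (ys @ p # zs) @ [t]) = path_edges (s # ys @ [p]) \<union> path_edges (p # zs @ [t])"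
  using path_edges_append[of "s # ys" p "zs @ [t]"] by simp

lemma is_ear_rev: "is_ear K S s xs t \<Longrightarrow> is_ear K S t (rev xs) s"
  by (auto simp: is_ear_def insert_commute)

text \<open>The new ear is cut at \<open>p\<close>. Its part back to \<open>s\<close>, followed by
  \<open>P\<close>, becomes the root path from \<open>p\<close> to \<open>q\<close>; the sequence
  that grew from \<open>P\<close> is replayed by \<open>ears_shift\<close>, and the part from
  \<open>p\<close> to \<open>t\<close> is attached last as an ear of its own.\<close>

lemma reroot_one:
  assumes e: "is_ear K S s (ys @ p # zs) t" and K: "K \<subseteq> Pow S"
    and P: "P \<noteq> []" "hd P = s" "last P = q" "distinct P" "ears B (path_edges P) (set P) K S m"
    and c: "m + of_bool (odd (length zs)) + of_bool (odd (length ys + length P)) \<le> c"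
  shows "rooted B (K \<union> path_edges (s # (ys @ p # zs) @ [t])) (S \<union> set (ys @ p # zs)) c p q"
proof -
  obtain P1 where P1: "P = s # P1" using P by (cases P) auto
  have PS: "set P \<subseteq> S" using ears_mono[OF P(5)] by auto
  let ?X = "path_edges (s # ys @ [p])" and ?Y = "set (ys @ [p])"
  have pe: "path_edges (p # rev ys @ P) = path_edges P \<union> ?X"
    using path_edges_append[of "p # rev ys" s P1] path_edges_rev_Cons[of p ys s] P1 by auto
  have "K \<inter> ?X = {}"
    using path_edges_Int_Pow[OF K, of "ys @ [p]" "s" p] e
    using path_edges_append[of "s # ys" p "[p]"] by (auto simp: is_ear_def)
  then have 1: "ears B (path_edges (p # rev ys @ P)) (set (p # rev ys @ P)) (K \<union> ?X) (S \<union> ?Y) m"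
    using ears_shift[OF P(5), of ?Y ?X B] e pe by (auto simp: is_ear_def Un_ac)
  have "is_ear (K \<union> ?X) (S \<union> ?Y) p zs t"
  proof -
    have "{p, t} \<notin> ?X" if "zs = []"
    proof
      assume "{p, t} \<in> ?X"
      moreover have "p \<notin> set (s # ys)" using e by (auto simp: is_ear_def)
      ultimately have "{p, t} = {last (s # ys), p}"
        using path_edges_last[of "{p,t}" "s # ys" p] by simp
      moreover have "p \<noteq> t" using e by (auto simp: is_ear_def)
      ultimately have "t = last (s # ys)" by (auto simp: doubleton_eq_iff)
      then show False using e that last_in_set[of ys]
        by (cases "ys = []") (auto simp: is_ear_def disjoint_iff)
    qed
    then show ?thesis using e K by (auto simp: is_ear_def)
  qed
  from ears.ear[OF 1 this] have 2: "ears B (path_edges (p # rev ys @ P)) (set (p # rev ys @ P))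
     (K \<union> path_edges (s # (ys @ p # zs) @ [t])) (S \<union> set (ys @ p # zs)) (m + of_bool (odd (length zs)))"
    unfolding path_edges_split3 by (simp add: Un_ac)
  show ?thesis by (rule rootedI[OF _ _ _ _ 2]) (use P PS e c in \<open>auto simp: is_ear_def\<close>)
qed

lemma reroot_mixed:
  assumes e: "is_ear K S s xs t" and K: "K \<subseteq> Pow S" and p: "p \<in> set xs"
    and r: "rooted B K S c s q" "rooted B K S c t q"
  shows "rooted B (K \<union> path_edges (s # xs @ [t])) (S \<union> set xs) (c + of_bool (odd (length xs))) p q"
proof -
  obtain ys zs where xs: "xs = ys @ p # zs" using p split_list by fastforce
  show ?thesis
  \<comment> \<open>Leaving through \<open>s\<close> can be too expensive only if \<open>ys\<close>
    is even and \<open>zs\<close> odd: the whole ear is then odd and free, but the remainder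
    \<open>zs\<close> is an even ear. Leaving through \<open>t\<close> exchanges the roles of
    \<open>ys\<close> and \<open>zs\<close>.\<close>
  proof (cases "even (length ys) \<and> odd (length zs)")
    case False
    obtain P m where P: "P \<noteq> []" "hd P = s" "last P = q" "distinct P"
      "ears B (path_edges P) (set P) K S m" "m + of_bool (even (length P)) \<le> c"
      using r(1) unfolding rooted_def by auto
    have "m + of_bool (odd (length zs)) + of_bool (odd (length ys + length P))
        \<le> c + of_bool (odd (length xs))"
      using P(6) False unfolding xs
      by (cases "even (length ys)"; cases "even (length zs)"; cases "even (length P)") auto
    from reroot_one[OF e[unfolded xs] K P(1-5) this] show ?thesis by (simp add: xs)
  next
    case True
    obtain P m where P: "P \<noteq> []" "hd P = t" "last P = q" "distinct P"
      "ears B (path_edges P) (set P) K S m" "m + of_bool (even (length P)) \<le> c"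
      using r(2) unfolding rooted_def by auto
    have e': "is_ear K S t (rev zs @ p # rev ys) s" using is_ear_rev[OF e] by (simp add: xs)
    have "m + of_bool (odd (length (rev ys))) + of_bool (odd (length (rev zs) + length P))
        \<le> c + of_bool (odd (length xs))"
      using P(6) True unfolding xs by (cases "even (length P)") auto
    from reroot_one[OF e' K P(1-5) this]
    have "rooted B (K \<union> path_edges (rev (s # xs @ [t]))) (S \<union> set xs)
       (c + of_bool (odd (length xs))) p q" by (simp add: xs Un_ac)
    then show ?thesis unfolding path_edges_rev by simp
  qed
qed

text \<open>The ear and a path \<open>P\<close> between its ends contain two routes from
  \<open>p\<close> to \<open>q\<close>: the stretch \<open>zs\<close> of the ear and the detour
  through \<open>P\<close>. Either may be the root path with the other as an ear on it; parity
  decides which is affordable.\<close>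

lemma reroot_two:
  assumes e: "is_ear K S s xs t" and K: "K \<subseteq> Pow S" and xs: "xs = ys @ p # zs @ q # ws"
    and r: "rooted B K S c s t"
  shows "rooted B (K \<union> path_edges (s # xs @ [t])) (S \<union> set xs) (c + of_bool (odd (length xs))) p q"
proof -
  obtain P m where P: "P \<noteq> []" "hd P = s" "last P = t" "distinct P"
      "ears B (path_edges P) (set P) K S m" "m + of_bool (even (length P)) \<le> c"
    using r unfolding rooted_def by auto
  have PS: "set P \<subseteq> S" using ears_mono[OF P(5)] by auto
  obtain P1 where P1: "P = s # P1" using P by (cases P) auto
  obtain P2 where P2: "P = P2 @ [t]" using P by (metis append_butlast_last_id)
  have P12: "s # P1 @ z = P2 @ t # z" for z using P1 P2 by (metis append.assoc append_Cons append_Nil)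
  let ?X1 = "path_edges (s # ys @ [p])" and ?X2 = "path_edges (p # zs @ [q])"
  let ?X3 = "path_edges (q # ws @ [t])"
  have X: "path_edges (s # xs @ [t]) = ?X1 \<union> ?X2 \<union> ?X3"
    using path_edges_append[of "s # ys" p "zs @ q # ws @ [t]"]
      path_edges_append[of "p # zs" q "ws @ [t]"] xs by auto
  have KX: "K \<inter> (?X1 \<union> ?X2 \<union> ?X3) = {}"
    using path_edges_Int_Pow[OF K, of xs s t] e X xs by (auto simp: is_ear_def)
  have long: "path_edges (p # (rev ys @ P @ rev ws) @ [q]) = path_edges P \<union> (?X1 \<union> ?X3)"
  proof -
    have "path_edges (p # (rev ys @ P @ rev ws) @ [q])
       = path_edges (p # rev ys @ [s]) \<union> path_edges (s # P1 @ rev ws @ [q])"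
      using path_edges_append[of "p # rev ys" s "P1 @ rev ws @ [q]"] P1 by simp
    also have "path_edges (s # P1 @ rev ws @ [q]) = path_edges P \<union> path_edges (t # rev ws @ [q])"
      using path_edges_append[of "P2" t "rev ws @ [q]"] unfolding P12 P2 .
    finally show ?thesis using path_edges_rev_Cons[of p ys s] path_edges_rev_Cons[of t ws q]
      by (simp add: Un_ac)
  qed
  show ?thesis
  \<comment> \<open>If all three hold, the stretch \<open>zs\<close> would be charged as a root path
    with an even number of vertices and the detour as an even ear. With the detour as root both
    charges vanish.\<close>
  proof (cases "even (length zs) \<and> even (length ys + length ws) \<and> odd (length P)")
    case False
    let ?Q = "p # zs @ [q]"
    have "is_ear (path_edges ?Q) (set ?Q) p (rev ys @ P @ rev ws) q"
      using e P PS xs by (auto simp: is_ear_def)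
    from ears.ear[OF ears.base[of B "path_edges ?Q" "set ?Q"] this]
    have 1: "ears B (path_edges ?Q) (set ?Q) (path_edges P \<union> path_edges (s # xs @ [t])) (set P \<union> set xs)
      (0 + of_bool (odd (length (rev ys @ P @ rev ws))))"
      unfolding long X using xs by (simp add: Un_ac insert_commute)
    have 2: "ears B (path_edges P \<union> path_edges (s # xs @ [t])) (set P \<union> set xs)
        (K \<union> path_edges (s # xs @ [t])) (S \<union> set xs) m"
      by (rule ears_shift[OF P(5)]) (use e KX X in \<open>auto simp: is_ear_def\<close>)
    have "0 + of_bool (odd (length (rev ys @ P @ rev ws))) + m + of_bool (even (length ?Q))
        \<le> c + of_bool (odd (length xs))"
      using False P(6) unfolding xs by (auto simp: of_bool_def split: if_splits)
    moreover have "distinct ?Q" using e xs by (auto simp: is_ear_def)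
    ultimately show ?thesis by (intro rootedI[OF _ _ _ _ ears_trans[OF 1 2]]) auto
  next
    case True
    let ?Q = "p # (rev ys @ P @ rev ws) @ [q]"
    let ?Y = "set ys \<union> {p, q} \<union> set ws"
    have 1: "ears B (path_edges ?Q) (set ?Q) (K \<union> (?X1 \<union> ?X3)) (S \<union> ?Y) m"
      using ears_shift[OF P(5), of ?Y "?X1 \<union> ?X3" B] e KX unfolding long
      by (auto simp: is_ear_def Un_ac xs insert_commute)
    have "is_ear (K \<union> (?X1 \<union> ?X3)) (S \<union> ?Y) p zs q"
    proof -
      have "{p, q} \<notin> ?X1 \<union> ?X3"
        using path_edges_subset[of "{p,q}" "s # ys @ [p]"] path_edges_subset[of "{p,q}" "q # ws @ [t]"]
          e xs by (auto simp: is_ear_def)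
      then show ?thesis using e K xs by (auto simp: is_ear_def)
    qed
    note E = ears.ear[OF 1 this]
    have "K \<union> (?X1 \<union> ?X3) \<union> ?X2 = K \<union> path_edges (s # xs @ [t])" unfolding X by auto
    moreover have "S \<union> ?Y \<union> set zs = S \<union> set xs" using xs by auto
    ultimately have 2: "ears B (path_edges ?Q) (set ?Q) (K \<union> path_edges (s # xs @ [t])) (S \<union> set xs)
       (m + of_bool (odd (length zs)))"
      using E by simp
    have "m + of_bool (odd (length zs)) + of_bool (even (length ?Q)) \<le> c + of_bool (odd (length xs))"
      using True P(6) unfolding xs by (auto simp: of_bool_def split: if_splits)
    moreover have "distinct ?Q" using e xs P PS by (auto simp: is_ear_def)
    ultimately show ?thesis by (intro rootedI[OF _ _ _ _ 2]) auto
  qed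
qed

text \<open>The ear and \<open>P\<close> form a cycle through \<open>p\<close>, attached as a closed
  ear to the root path \<open>[p]\<close>, whose odd length is free of charge.\<close>

lemma reroot_same:
  assumes e: "is_ear K S s xs t" and K: "K \<subseteq> Pow S" and p: "p \<in> set xs"
    and r: "rooted B K S c s t"
  shows "rooted B (K \<union> path_edges (s # xs @ [t])) (S \<union> set xs) (c + of_bool (odd (length xs))) p p"
proof -
  obtain ys zs where xs: "xs = ys @ p # zs" using p split_list by fastforce
  obtain P m where P: "P \<noteq> []" "hd P = s" "last P = t" "distinct P"
      "ears B (path_edges P) (set P) K S m" "m + of_bool (even (length P)) \<le> c"
    using r unfolding rooted_def by auto
  have PS: "set P \<subseteq> S" using ears_mono[OF P(5)] by auto
  obtain P1 where P1: "P = s # P1" using P by (cases P) auto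
  obtain P2 where P2: "P = P2 @ [t]" using P by (metis append_butlast_last_id)
  have P12: "s # P1 @ z = P2 @ t # z" for z using P1 P2 by (metis append.assoc append_Cons append_Nil)
  have long: "path_edges (p # (rev ys @ P @ rev zs) @ [p]) = path_edges P \<union> path_edges (s # xs @ [t])"
  proof -
    have "path_edges (p # (rev ys @ P @ rev zs) @ [p])
       = path_edges (p # rev ys @ [s]) \<union> path_edges (s # P1 @ rev zs @ [p])"
      using path_edges_append[of "p # rev ys" s "P1 @ rev zs @ [p]"] P1 by simp
    also have "path_edges (s # P1 @ rev zs @ [p]) = path_edges P \<union> path_edges (t # rev zs @ [p])"
      using path_edges_append[of "P2" t "rev zs @ [p]"] unfolding P12 P2 .
    finally show ?thesis using path_edges_rev_Cons[of p ys s] path_edges_rev_Cons[of t zs p]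
      path_edges_split3[of s ys p zs t] xs by (simp add: Un_ac)
  qed
  have "2 \<le> length (rev ys @ P @ rev zs)"
  proof (cases "ys = [] \<and> zs = []")
    case True
    then have "s \<noteq> t" using e xs by (auto simp: is_ear_def)
    then show ?thesis using P by (cases P; cases "tl P") auto
  next
    case False
    then show ?thesis using P(1) by (cases P; cases ys; cases zs) auto
  qed
  then have "is_ear {} {p} p (rev ys @ P @ rev zs) p"
    using e P PS xs by (auto simp: is_ear_def)
  from ears.ear[OF ears.base[of B "{}" "{p}"] this]
  have 1: "ears B {} {p} (path_edges P \<union> path_edges (s # xs @ [t])) (set P \<union> set xs)
      (0 + of_bool (odd (length (rev ys @ P @ rev zs))))"
    unfolding long using xs by (simp add: Un_ac insert_commute)
  have 2: "ears B (path_edges P \<union> path_edges (s # xs @ [t])) (set P \<union> set xs)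
        (K \<union> path_edges (s # xs @ [t])) (S \<union> set xs) m"
    by (rule ears_shift[OF P(5)])
      (use e path_edges_Int_Pow[OF K _, of xs s t] xs in \<open>auto simp: is_ear_def\<close>)
  have "0 + of_bool (odd (length (rev ys @ P @ rev zs))) + m + of_bool (even (length [p]))
      \<le> c + of_bool (odd (length xs))"
    using P(6) unfolding xs by (auto simp: of_bool_def split: if_splits)
  then show ?thesis using ears_trans[OF 1 2] by (intro rootedI[of "[p]"]) auto
qed

text \<open>Induction on the last piece. If neither \<open>p\<close> nor \<open>q\<close> is new it
  stays last; otherwise at least part of it moves to the start. Both vertices vary in the induction,
  because the older sequence is rerooted between an end of the last piece and \<open>q\<close>, or
  between both ends.\<close>

theorem ears_reroot:
  assumes "ears B {} {r} K S c" "p \<in> S" "q \<in> S"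
  shows "rooted B K S c p q"
  using assms
proof (induction arbitrary: p q rule: ears.induct)
  case base
  then show ?case unfolding rooted_def
    by (intro exI[of _ "[r]"] exI[of _ 0]) (auto intro: ears.base)
next
  case (ear K S c s xs t)
  note e = ear.hyps(2)
  have K: "K \<subseteq> Pow S" using ears_Pow[OF ear.hyps(1)] by simp
  have st: "s \<in> S" "t \<in> S" using e by (auto simp: is_ear_def)
  consider "p \<in> S" "q \<in> S" | "p \<in> set xs" "q \<in> S" | "p \<in> S" "q \<in> set xs"
    | "p \<in> set xs" "q \<in> set xs" "p \<noteq> q" | "p \<in> set xs" "p = q"
    using ear.prems by auto
  then show ?case
  proof cases
    case 1
    then obtain P m where P: "P \<noteq> []" "hd P = p" "last P = q" "distinct P"
      "ears B (path_edges P) (set P) K S m" "m + of_bool (even (length P)) \<le> c"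
      using ear.IH unfolding rooted_def by metis
    from ears.ear[OF P(5) e] P show ?thesis unfolding rooted_def
      by (intro exI[of _ P] exI[of _ "m + of_bool (odd (length xs))"]) auto
  next
    case 2
    show ?thesis by (rule reroot_mixed[OF e K 2(1) ear.IH[OF st(1) 2(2)] ear.IH[OF st(2) 2(2)]])
  next
    case 3
    show ?thesis
      by (rule rooted_sym, rule reroot_mixed[OF e K 3(2) ear.IH[OF st(1) 3(1)] ear.IH[OF st(2) 3(1)]])
  next
    case 4
    obtain ys zs where xs: "xs = ys @ p # zs" using 4 split_list by fastforce
    consider "q \<in> set ys" | "q \<in> set zs" using 4 xs by auto
    then show ?thesis
    proof cases
      case 1
      then obtain us vs where "ys = us @ q # vs" using split_list by fastforce
      then have "xs = us @ q # vs @ p # zs" using xs by simp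
      from reroot_two[OF e K this ear.IH[OF st]] show ?thesis by (rule rooted_sym)
    next
      case 2
      then obtain us vs where "zs = us @ q # vs" using split_list by fastforce
      then have "xs = ys @ p # us @ q # vs" using xs by simp
      from reroot_two[OF e K this ear.IH[OF st]] show ?thesis .
    qed
  next
    case 5
    then show ?thesis using reroot_same[OF e K _ ear.IH[OF st]] by auto
  qed
next
  case (pend K S c u v)
  have K: "K \<subseteq> Pow S" using ears_Pow[OF pend.hyps(1)] by simp
  \<comment> \<open>The pendant edge prolongs the root path by one vertex. If this makes the number
    of vertices even, the unit formerly paid for the pendant edge covers the charge.\<close>
  have one: "rooted B (insert {u, v} K) (insert v S) (Suc c) v q" if q: "q \<in> S" for q
  proof -
    obtain P m where P: "P \<noteq> []" "hd P = u" "last P = q" "distinct P"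
      "ears B (path_edges P) (set P) K S m" "m + of_bool (even (length P)) \<le> c"
      using pend.IH[OF \<open>u \<in> S\<close> q] unfolding rooted_def by auto
    have PS: "set P \<subseteq> S" using ears_mono[OF P(5)] by auto
    have "path_edges (v # P) = path_edges P \<union> {{u, v}}" using P by (cases P) auto
    moreover have "ears B (path_edges P \<union> {{u, v}}) (set P \<union> {v}) (K \<union> {{u, v}}) (S \<union> {v}) m"
      by (rule ears_shift[OF P(5)]) (use pend K in auto)
    ultimately have "ears B (path_edges (v # P)) (set (v # P)) (insert {u, v} K) (insert v S) m"
      by simp
    then show ?thesis unfolding rooted_def using P PS pend
      by (intro exI[of _ "v # P"] exI[of _ m]) auto
  qed
  consider "p \<in> S" "q \<in> S" | "p = v" "q \<in> S" | "p \<in> S" "q = v" | "p = v" "q = v"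
    using pend.prems by auto
  then show ?case
  proof cases
    case 1
    then obtain P m where P: "P \<noteq> []" "hd P = p" "last P = q" "distinct P"
      "ears B (path_edges P) (set P) K S m" "m + of_bool (even (length P)) \<le> c"
      using pend.IH unfolding rooted_def by metis
    from ears.pend[OF P(5) pend.hyps(2-)] P show ?thesis unfolding rooted_def
      by (intro exI[of _ P] exI[of _ "Suc m"]) auto
  next
    case 2 then show ?thesis using one by auto
  next
    case 3 then show ?thesis using one rooted_sym by metis
  next
    case 4
    obtain P m where P: "P \<noteq> []" "hd P = u" "last P = u" "distinct P"
      "ears B (path_edges P) (set P) K S m" "m + of_bool (even (length P)) \<le> c"
      using pend.IH[OF \<open>u \<in> S\<close> \<open>u \<in> S\<close>] unfolding rooted_def by auto
    have P1: "P = [u]" using P by (cases P) (auto split: if_splits dest: last_in_set)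
    have 1: "ears B {} {v} (insert {v, u} {}) (insert u {v}) (Suc 0)"
      by (rule ears.pend[OF ears.base]) (use pend in \<open>auto simp: insert_commute\<close>)
    have "ears B (path_edges P \<union> {{u, v}}) (set P \<union> {v}) (K \<union> {{u, v}}) (S \<union> {v}) m"
      by (rule ears_shift[OF P(5)]) (use pend K in auto)
    then have "ears B (insert {v, u} {}) (insert u {v}) (insert {u, v} K) (insert v S) m"
      using P1 by (simp add: insert_commute)
    from ears_trans[OF 1 this] have "ears B {} {v} (insert {u, v} K) (insert v S) (Suc 0 + m)" .
    then show ?thesis unfolding rooted_def using P 4
      by (intro exI[of _ "[v]"] exI[of _ "Suc m"]) auto
  qed
qed

section \<open>Bridges\<close>

text \<open>Separation of the ends replaces the count of components, so that an edge set suffices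
  while a graph is being built; \<open>bridges_eq\<close> identifies the two notions for connected
  simple graphs.\<close>

definition bridge_edges :: "'v set set \<Rightarrow> 'v set set" where
  "bridge_edges K = {e \<in> K. \<exists>u v. e = {u, v} \<and> (u, v) \<notin> conn (K - {e})}"

lemma bridge_edges_mono:
  "e \<in> bridge_edges L \<Longrightarrow> e \<in> K \<Longrightarrow> K \<subseteq> L \<Longrightarrow> e \<in> bridge_edges K"
  unfolding bridge_edges_def using conn_mono[of _ _ "K - {e}" "L - {e}"] by blast

lemma conn_in: "(a, b) \<in> conn K \<Longrightarrow> a \<in> S \<Longrightarrow> K \<subseteq> Pow S \<Longrightarrow> b \<in> S"
  by (induction rule: conn_induct) auto

lemma bridge_edges_pend:
  assumes K: "K \<subseteq> Pow S" and uv: "u \<in> S" "v \<notin> S"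
  shows "bridge_edges K \<subseteq> bridge_edges (insert {u, v} K)"
    and "{u, v} \<in> bridge_edges (insert {u, v} K)"
proof
  fix e assume e: "e \<in> bridge_edges K"
  then obtain a b where ab: "e = {a, b}" "(a, b) \<notin> conn (K - {e})" "e \<in> K"
    by (auto simp: bridge_edges_def)
  \<comment> \<open>Contracting the pendant edge turns walks of the larger graph into walks of the
    smaller one.\<close>
  let ?f = "\<lambda>x. if x = v then u else x"
  have "(a, b) \<notin> conn (insert {u, v} K - {e})"
  proof
    assume "(a, b) \<in> conn (insert {u, v} K - {e})"
    then have "(?f a, ?f b) \<in> conn (K - {e})"
    proof (rule conn_map)
      fix x y assume xy: "{x, y} \<in> insert {u, v} K - {e}"
      show "(?f x, ?f y) \<in> conn (K - {e})"
      proof (cases "{x, y} = {u, v}")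
        case True
        then show ?thesis by (auto simp: doubleton_eq_iff)
      next
        case False
        then have "{x, y} \<in> K - {e}" using xy by auto
        moreover from this have "x \<noteq> v" "y \<noteq> v" using K uv by auto
        ultimately show ?thesis by (auto intro: conn_edge)
      qed
    qed
    moreover have "a \<noteq> v" "b \<noteq> v" using ab K uv by auto
    ultimately show False using ab by simp
  qed
  then show "e \<in> bridge_edges (insert {u, v} K)" using ab unfolding bridge_edges_def by blast
next
  have "(u, v) \<notin> conn (insert {u, v} K - {{u, v}})"
    using conn_in[of u v "insert {u, v} K - {{u, v}}" S] K uv by auto
  then show "{u, v} \<in> bridge_edges (insert {u, v} K)" unfolding bridge_edges_def by blast
qed

text \<open>Contract the inner vertices of the ear to \<open>s\<close>. The ear collapses to the
  pair \<open>s\<close>, \<open>t\<close>, which is connected without \<open>e\<close> by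
  assumption, so a walk avoiding \<open>e\<close> in the larger graph yields one in
  \<open>K\<close>.\<close>

lemma bridge_edges_ear:
  assumes K: "K \<subseteq> Pow S" and ear: "is_ear K S s xs t" and st: "(s, t) \<in> conn (K - {e})"
    and e: "e \<in> bridge_edges K"
  shows "e \<in> bridge_edges (K \<union> path_edges (s # xs @ [t]))"
proof -
  let ?L = "K \<union> path_edges (s # xs @ [t])"
  obtain a b where ab: "e = {a, b}" "(a, b) \<notin> conn (K - {e})" "e \<in> K"
    using e by (auto simp: bridge_edges_def)
  let ?f = "\<lambda>x. if x \<in> set xs then s else x"
  have "(a, b) \<notin> conn (?L - {e})"
  proof
    assume "(a, b) \<in> conn (?L - {e})"
    then have "(?f a, ?f b) \<in> conn (K - {e})"
    proof (rule conn_map)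
      fix x y assume xy: "{x, y} \<in> ?L - {e}"
      show "(?f x, ?f y) \<in> conn (K - {e})"
      proof (cases "{x, y} \<in> K")
        case True
        then have "x \<in> S" "y \<in> S" using K by auto
        then show ?thesis using True xy ear by (auto simp: is_ear_def intro: conn_edge)
      next
        case False
        then have "{x, y} \<subseteq> set (s # xs @ [t])"
          using xy path_edges_subset[of "{x, y}" "s # xs @ [t]"] by auto
        then have "?f x \<in> {s, t}" "?f y \<in> {s, t}" by auto
        then show ?thesis using st conn_sym[OF st] by auto
      qed
    qed
    moreover have "a \<notin> set xs" "b \<notin> set xs" using ab K ear by (auto simp: is_ear_def)
    ultimately show False using ab by auto
  qed
  then show ?thesis using ab unfolding bridge_edges_def by blast
qed

lemma card_ear: "is_ear K S s xs t \<Longrightarrow> card (path_edges (s # xs @ [t])) = Suc (length xs)"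
  using card_path_edges_closed[of s xs] card_path_edges[of "s # xs @ [t]"]
  by (cases "s = t") (auto simp: is_ear_def)

lemma is_ear_disjoint:
  "is_ear K S s xs t \<Longrightarrow> K \<subseteq> Pow S \<Longrightarrow> K \<inter> path_edges (s # xs @ [t]) = {}"
  using path_edges_Int_Pow[of K S xs s t] by (cases "xs = []") (auto simp: is_ear_def)

lemma path_edges_split:
  "e \<in> path_edges p \<Longrightarrow> \<exists>ys x y zs. p = ys @ x # y # zs \<and> e = {x, y}"
proof (induction p rule: path_edges.induct)
  case (1 x y zs)
  show ?case
  proof (cases "e = {x, y}")
    case True
    then show ?thesis by (intro exI[of _ "[]"]) auto
  next
    case False
    then obtain ys a b zs' where "y # zs = ys @ a # b # zs'" "e = {a, b}" using 1 by auto
    then show ?thesis by (intro exI[of _ "x # ys"]) auto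
  qed
qed auto

lemma ear_not_bridge:
  assumes ear: "is_ear K S s xs t" and K: "K \<subseteq> Pow S" and st: "(s, t) \<in> conn K"
    and e: "e \<in> path_edges (s # xs @ [t])"
  shows "e \<notin> bridge_edges (K \<union> path_edges (s # xs @ [t]))"
proof -
  let ?Q = "s # xs @ [t]"
  let ?L = "K \<union> path_edges ?Q - {e}"
  obtain ys x y zs where Q: "?Q = ys @ x # y # zs" and exy: "e = {x, y}"
    using path_edges_split[OF e] by auto
  have pe: "path_edges ?Q = insert e (path_edges (ys @ [x]) \<union> path_edges (y # zs))"
    using path_edges_append[of ys x "y # zs"] Q exy by simp
  \<comment> \<open>The ear has \<open>length xs + 1\<close> distinct edges; a second occurrence of
    \<open>e\<close> would leave too few.\<close>
  have "e \<notin> path_edges (ys @ [x]) \<union> path_edges (y # zs)"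
  proof
    assume "e \<in> path_edges (ys @ [x]) \<union> path_edges (y # zs)"
    then have "card (path_edges ?Q) \<le> card (path_edges (ys @ [x])) + card (path_edges (y # zs))"
      unfolding pe by (simp add: insert_absorb card_Un_le)
    also have "\<dots> \<le> length ys + length zs"
      using card_path_edges_le[of "ys @ [x]"] card_path_edges_le[of "y # zs"] by simp
    also have "\<dots> < Suc (length xs)" using arg_cong[OF Q, of length] by simp
    finally show False using card_ear[OF ear] by simp
  qed
  moreover have "e \<notin> K" using is_ear_disjoint[OF ear K] e by auto
  ultimately have sub: "path_edges (ys @ [x]) \<subseteq> ?L" "path_edges (y # zs) \<subseteq> ?L" "K \<subseteq> ?L"
    using pe by auto
  have "hd (ys @ [x]) = s" using Q by (cases ys) auto
  then have "(s, x) \<in> conn ?L" using conn_path[of "ys @ [x]"] conn_mono sub(1) by force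
  moreover have "last (y # zs) = t" using arg_cong[OF Q, of last] by (simp split: if_splits)
  then have "(y, t) \<in> conn ?L" using conn_path[of "y # zs"] conn_mono sub(2) by force
  moreover have "(s, t) \<in> conn ?L" by (rule conn_mono[OF st sub(3)])
  ultimately have "(x, y) \<in> conn ?L" using conn_sym conn_trans by metis
  then have "(y, x) \<in> conn ?L" by (rule conn_sym)
  with \<open>(x, y) \<in> conn ?L\<close> show ?thesis unfolding bridge_edges_def exy
    by (auto simp: doubleton_eq_iff)
qed

lemma ears_conn: "ears B {} {r} K S c \<Longrightarrow> v \<in> S \<Longrightarrow> (r, v) \<in> conn K"
proof (induction arbitrary: v rule: ears.induct)
  case (ear K S c s xs t)
  let ?L = "K \<union> path_edges (s # xs @ [t])"
  show ?case
  proof (cases "v \<in> S")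
    case True
    then show ?thesis using ear.IH conn_mono[of r v K ?L] by auto
  next
    case False
    have "(r, s) \<in> conn ?L"
      using ear.IH[of s] ear.hyps(2) conn_mono[of r s K ?L] by (auto simp: is_ear_def)
    moreover have "(s, v) \<in> conn ?L"
      using conn_path_mem[of v "s # xs @ [t]"] False ear.prems
        conn_mono[of s v "path_edges (s # xs @ [t])" ?L] by auto
    ultimately show ?thesis by (rule conn_trans)
  qed
next
  case (pend K S c u v w)
  have "(r, u) \<in> conn (insert {u, v} K)" by (rule conn_mono[OF pend.IH[OF pend.hyps(2)]]) auto
  moreover have "(u, v) \<in> conn (insert {u, v} K)" by (auto intro: conn_edge)
  ultimately have "(r, v) \<in> conn (insert {u, v} K)" by (rule conn_trans)
  then show ?case using pend.IH[of w] pend.prems conn_mono[of r w K "insert {u, v} K"] by auto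
qed simp

lemma ears_conn2: "ears B {} {r} K S c \<Longrightarrow> u \<in> S \<Longrightarrow> v \<in> S \<Longrightarrow> (u, v) \<in> conn K"
  using ears_conn conn_sym conn_trans by metis

text \<open>Going along \<open>P\<close> from \<open>s\<close> to \<open>t\<close> and back through
  the ear gives a cycle. All of its vertices except \<open>s\<close> are inner ones, hence the
  \<open>- 1\<close>.\<close>

lemma close_ear:
  assumes ear: "is_ear K S s xs t" and PS: "set P \<subseteq> S" "path_edges P \<subseteq> K"
    and P: "P \<noteq> []" "hd P = s" "last P = t" "distinct P"
  shows "is_ear {} {s} s (tl P @ rev xs) s"
    and "path_edges (s # (tl P @ rev xs) @ [s]) = path_edges P \<union> path_edges (s # xs @ [t])"
    and "insert s (set (tl P @ rev xs)) = set P \<union> set xs"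
    and "length (tl P @ rev xs) = length P + length xs - 1"
proof -
  obtain P1 where P1: "P = s # P1" using P by (cases P) auto
  obtain P2 where P2: "P = P2 @ [t]" using P by (metis append_butlast_last_id)
  have "2 \<le> length (P1 @ rev xs)"
  proof (cases "xs = []")
    case True
    then have "s \<noteq> t" "{s, t} \<notin> path_edges P" using ear PS by (auto simp: is_ear_def)
    then show ?thesis using P True unfolding P1 by (cases P1; cases "tl P1") auto
  next
    case False
    then show ?thesis using ear P unfolding P1 by (cases P1; cases xs) (auto simp: is_ear_def)
  qed
  then show "is_ear {} {s} s (tl P @ rev xs) s"
    using ear PS P unfolding P1 by (auto simp: is_ear_def)
  have eq: "s # (tl P @ rev xs) @ [s] = P2 @ t # rev xs @ [s]" using P1 P2
    by (metis append.assoc append_Cons append_Nil list.sel(3))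
  show "path_edges (s # (tl P @ rev xs) @ [s]) = path_edges P \<union> path_edges (s # xs @ [t])"
    unfolding eq using path_edges_append[of P2 t "rev xs @ [s]"] P2 path_edges_rev_Cons[of t xs s] by simp
qed (use P in \<open>cases P; auto\<close>)+

text \<open>An ear can destroy bridges, and pendant edges that lose this status have to disappear.
  The older sequence is rerooted at a path \<open>P\<close> between the ends of the ear:
  \<open>P\<close> and the ear form the first cycle, and every bridge not on \<open>P\<close> stays
  one because \<open>P\<close> connects \<open>s\<close> and \<open>t\<close> without it. If the
  cycle is even, either the charge for the root path or that for the ear pays for it.\<close>

lemma ears_bridge_edges:
  assumes "ears B {} {r} K S c"
  shows "\<exists>r' c'. c' \<le> c \<and> ears (bridge_edges K) {} {r'} K S c'"
  using assms
proof (induction rule: ears.induct)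
  case base
  then show ?case by (auto intro: ears.base)
next
  case (ear K S c s xs t)
  let ?Q = "s # xs @ [t]"
  note e = ear.hyps(2)
  have K: "K \<subseteq> Pow S" using ears_Pow[OF ear.hyps(1)] by simp
  obtain r' c' where r': "c' \<le> c" "ears (bridge_edges K) {} {r'} K S c'" using ear.IH by auto
  obtain P m where P: "P \<noteq> []" "hd P = s" "last P = t" "distinct P"
      "ears (bridge_edges K) (path_edges P) (set P) K S m" "m + of_bool (even (length P)) \<le> c'"
    using ears_reroot[OF r'(2), of s t] e unfolding is_ear_def rooted_def by auto
  have PS: "set P \<subseteq> S" "path_edges P \<subseteq> K" using ears_mono[OF P(5)] by auto
  note cl = close_ear[OF e PS P(1-4)]
  let ?B = "bridge_edges (K \<union> path_edges ?Q)"
  have "ears ?B {} {s} (path_edges P \<union> path_edges ?Q) (set P \<union> set xs)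
     (of_bool (odd (length P + length xs - 1)))"
  proof -
    have "{s} \<union> set (tl P @ rev xs) = set P \<union> set xs" using cl(3) by auto
    with ears.ear[OF ears.base[of ?B] cl(1)] show ?thesis
      unfolding cl(2) cl(4) by simp
  qed
  moreover have "ears ?B (path_edges P \<union> path_edges ?Q) (set P \<union> set xs)
      (K \<union> path_edges ?Q) (S \<union> set xs) m"
  proof (rule ears_shift[OF P(5)])
    show "S \<inter> set xs = {}" using e by (auto simp: is_ear_def)
    show "K \<inter> path_edges ?Q = {}" by (rule is_ear_disjoint[OF e K])
    fix f assume f: "f \<in> bridge_edges K" "\<not> f \<subseteq> set P"
    then have "f \<notin> path_edges P" using path_edges_subset by blast
    then have "(s, t) \<in> conn (K - {f})"
      using conn_path[OF P(1)] P(2,3) PS(2) conn_mono[of s t "path_edges P" "K - {f}"] by auto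
    then show "f \<in> ?B" using bridge_edges_ear[OF K e] f by auto
  qed
  ultimately have "ears ?B {} {s} (K \<union> path_edges ?Q) (S \<union> set xs)
     (of_bool (odd (length P + length xs - 1)) + m)" by (rule ears_trans)
  moreover have "of_bool (odd (length P + length xs - 1)) + m \<le> c + of_bool (odd (length xs))"
    using P(1,6) r'(1) by (cases "length P") (auto simp: of_bool_def split: if_splits)
  ultimately show ?case by blast
next
  case (pend K S c u v)
  have K: "K \<subseteq> Pow S" using ears_Pow[OF pend.hyps(1)] by simp
  obtain r' c' where r': "c' \<le> c" "ears (bridge_edges K) {} {r'} K S c'" using pend.IH by auto
  note b = bridge_edges_pend[OF K pend.hyps(2,3)]
  have "ears (bridge_edges (insert {u, v} K)) {} {r'} K S c'"
    using ears_shift[OF r'(2), of "{}" "{}" "bridge_edges (insert {u, v} K)"] b by auto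
  from ears.pend[OF this pend.hyps(2,3) b(2)] r'(1) show ?case by (meson Suc_le_mono)
qed

section \<open>Ear sequences and generalized ear decompositions\<close>

lemma walk_graph_eq: "walk_graph p = Graph (set p) (path_edges p)"
proof -
  have "{{p ! i, p ! Suc i} | i. Suc i < length p} = path_edges p"
  proof (induction p rule: path_edges.induct)
    case (1 x y zs)
    have "{{(x # y # zs) ! i, (x # y # zs) ! Suc i} | i. Suc i < length (x # y # zs)}
      = insert {x, y} {{(y # zs) ! i, (y # zs) ! Suc i} | i. Suc i < length (y # zs)}" (is "?A = ?B")
    proof
      show "?A \<subseteq> ?B"
      proof
        fix e assume "e \<in> ?A"
        then obtain i where "e = {(x # y # zs) ! i, (x # y # zs) ! Suc i}"
          "Suc i < length (x # y # zs)" by blast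
        then show "e \<in> ?B" by (cases i) auto
      qed
      have "{x, y} \<in> ?A" by (rule CollectI, rule exI[of _ 0]) auto
      moreover have "{(y # zs) ! i, (y # zs) ! Suc i} \<in> ?A" if "Suc i < length (y # zs)" for i
        by (rule CollectI, rule exI[of _ "Suc i"]) (use that in auto)
      ultimately show "?B \<subseteq> ?A" by blast
    qed
    then show ?case using 1 by simp
  qed auto
  then show ?thesis by (simp add: walk_graph_def)
qed

lemma is_ear_closed_or_open:
  "is_ear K S s xs t \<Longrightarrow> open_path (s # xs @ [t]) \<or> closed_path (s # xs @ [t])"
  by (cases "s = t") (auto simp: is_ear_def open_path_def closed_path_def butlast_append)

lemma is_ear_imp_ear:
  assumes "is_ear K S s xs t" "K \<subseteq> Pow S"
  shows "ear (Graph S K) (walk_graph (s # xs @ [t]))"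
  unfolding ear_def
  by (rule exI[of _ "s # xs @ [t]"])
    (use assms is_ear_disjoint[OF assms] is_ear_closed_or_open[OF assms(1)] in
      \<open>auto simp: walk_graph_eq is_ear_def\<close>)

lemma ear_imp_is_ear:
  assumes "ear (Graph S K) F"
  shows "\<exists>s xs t. is_ear K S s xs t \<and> F = walk_graph (s # xs @ [t])"
proof -
  obtain p where p: "open_path p \<or> closed_path p" "F = walk_graph p" "hd p \<in> S" "last p \<in> S"
    "(set p - {hd p, last p}) \<inter> S = {}" "edges F \<inter> K = {}"
    using assms by (auto simp: ear_def)
  then have dis: "path_edges p \<inter> K = {}" by (simp add: walk_graph_eq)
  have l: "length p \<ge> 2" using p(1) by (auto simp: open_path_def closed_path_def)
  define xs where "xs = butlast (tl p)"
  have pe: "p = hd p # xs @ [last p]" using l unfolding xs_def by (cases p; cases "tl p") auto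
  obtain s t where st: "p = s # xs @ [t]" using pe by blast
  have "is_ear K S s xs t"
  proof (cases "s = t")
    case True
    then show ?thesis using p dis st by (auto simp: is_ear_def open_path_def closed_path_def butlast_append)
  next
    case False
    then show ?thesis using p dis st by (auto simp: is_ear_def open_path_def closed_path_def)
  qed
  then show ?thesis using p(2) st by blast
qed

definition ear_step :: "'v graph \<Rightarrow> 'v graph list \<Rightarrow> nat \<Rightarrow> bool" where
  "ear_step H Fs i \<longleftrightarrow> (let H' = graph_Union (set (take i Fs)) in
     ear H' (Fs ! i) \<or> (bridge_of H (Fs ! i) \<and> card (verts (Fs ! i) \<inter> verts H') = 1))"

lemma gen_ear_decomposition_alt:
  "gen_ear_decomposition H Fs \<longleftrightarrow> Fs \<noteq> [] \<and> graph_Union (set Fs) = H \<and>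
     (cycle_graph (hd Fs) \<or> bridge_of H (hd Fs)) \<and> (\<forall>i. 1 \<le> i \<and> i < length Fs \<longrightarrow> ear_step H Fs i)"
  by (auto simp: gen_ear_decomposition_def ear_step_def Let_def hd_conv_nth)

lemma ear_step_snoc:
  assumes "\<forall>i. 1 \<le> i \<and> i < length Fs \<longrightarrow> ear_step H Fs i" "graph_Union (set Fs) = Graph S K"
    "ear (Graph S K) F \<or> (bridge_of H F \<and> card (verts F \<inter> S) = 1)"
  shows "\<forall>i. 1 \<le> i \<and> i < length (Fs @ [F]) \<longrightarrow> ear_step H (Fs @ [F]) i"
proof (intro allI impI)
  fix i assume i: "1 \<le> i \<and> i < length (Fs @ [F])"
  show "ear_step H (Fs @ [F]) i"
  proof (cases "i < length Fs")
    case True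
    then show ?thesis using assms(1) i by (auto simp: ear_step_def nth_append)
  next
    case False
    then have "i = length Fs" using i by simp
    then show ?thesis using assms by (auto simp: ear_step_def)
  qed
qed

lemma graph_Union_snoc:
  "graph_Union (set Fs) = Graph S K \<Longrightarrow>
    graph_Union (set (Fs @ [Graph S' K'])) = Graph (S \<union> S') (K \<union> K')"
  by (auto simp: graph_Union_def)

abbreviation even_edges :: "'v graph \<Rightarrow> bool" where
  "even_edges F \<equiv> even (card (edges F))"

text \<open>In the count below the set \<open>J\<close> collects the pendant edges; as no ear contains a bridge,
  it contains all bridges.\<close>

lemma ears_imp_list:
  assumes "ears B {} {r} K S c" "B \<subseteq> bridges H"
  shows "\<exists>Fs J. finite J \<and> bridge_edges K \<subseteq> J \<and> length (filter even_edges Fs) + card J \<le> c \<and>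
     (if Fs = [] then K = {} \<and> S = {r}
      else graph_Union (set Fs) = Graph S K \<and> (cycle_graph (hd Fs) \<or> bridge_of H (hd Fs)) \<and>
        (\<forall>i. 1 \<le> i \<and> i < length Fs \<longrightarrow> ear_step H Fs i))"
  using assms(1)
proof (induction rule: ears.induct)
  case base
  then show ?case by (intro exI[of _ "[]"] exI[of _ "{}"]) (auto simp: bridge_edges_def)
next
  case (ear K S c s xs t)
  let ?Q = "s # xs @ [t]"
  note e = ear.hyps(2)
  have K: "K \<subseteq> Pow S" using ears_Pow[OF ear.hyps(1)] by simp
  have st: "(s, t) \<in> conn K" using ears_conn2[OF ear.hyps(1)] e by (auto simp: is_ear_def)
  obtain Fs J where F: "finite J" "bridge_edges K \<subseteq> J" "length (filter even_edges Fs) + card J \<le> c"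
     "if Fs = [] then K = {} \<and> S = {r}
      else graph_Union (set Fs) = Graph S K \<and> (cycle_graph (hd Fs) \<or> bridge_of H (hd Fs)) \<and>
        (\<forall>i. 1 \<le> i \<and> i < length Fs \<longrightarrow> ear_step H Fs i)"
    using ear.IH by blast
  have J: "bridge_edges (K \<union> path_edges ?Q) \<subseteq> J"
  proof
    fix f assume f: "f \<in> bridge_edges (K \<union> path_edges ?Q)"
    then have "f \<in> K" using ear_not_bridge[OF e K st, of f] by (auto simp: bridge_edges_def)
    then show "f \<in> J" using f F(2) bridge_edges_mono[OF f, of K] by auto
  qed
  let ?F = "walk_graph ?Q"
  have even: "even_edges ?F \<longleftrightarrow> odd (length xs)" using card_ear[OF e] by (simp add: walk_graph_eq)
  have S: "S \<union> set ?Q = S \<union> set xs" using e by (auto simp: is_ear_def)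
  show ?case
  proof (cases "Fs = []")
    case True
    then have "s = r" "t = r" "K = {}" "S = {r}" using e F(4) by (auto simp: is_ear_def)
    then have "cycle_graph ?F"
      using is_ear_closed_or_open[OF e] by (auto simp: cycle_graph_def open_path_def)
    moreover have "graph_Union (set [?F]) = Graph (S \<union> set xs) (K \<union> path_edges ?Q)"
      using \<open>K = {}\<close> \<open>S = {r}\<close> \<open>t = r\<close> \<open>s = r\<close> by (auto simp: graph_Union_def walk_graph_eq)
    ultimately show ?thesis
      by (intro exI[of _ "[?F]"] exI[of _ J]) (use F True J even in auto)
  next
    case False
    have "graph_Union (set (Fs @ [?F])) = Graph (S \<union> set xs) (K \<union> path_edges ?Q)"
      using graph_Union_snoc[of Fs S K "set ?Q" "path_edges ?Q"] F(4) False S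
      by (simp add: walk_graph_eq)
    moreover have "\<forall>i. 1 \<le> i \<and> i < length (Fs @ [?F]) \<longrightarrow> ear_step H (Fs @ [?F]) i"
      using ear_step_snoc[of Fs H S K ?F] F(4) False is_ear_imp_ear[OF e K] by auto
    ultimately show ?thesis
      by (intro exI[of _ "Fs @ [?F]"] exI[of _ J]) (use F False J even in auto)
  qed
next
  case (pend K S c u v)
  have K: "K \<subseteq> Pow S" using ears_Pow[OF pend.hyps(1)] by simp
  obtain Fs J where F: "finite J" "bridge_edges K \<subseteq> J" "length (filter even_edges Fs) + card J \<le> c"
     "if Fs = [] then K = {} \<and> S = {r}
      else graph_Union (set Fs) = Graph S K \<and> (cycle_graph (hd Fs) \<or> bridge_of H (hd Fs)) \<and>
        (\<forall>i. 1 \<le> i \<and> i < length Fs \<longrightarrow> ear_step H Fs i)"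
    using pend.IH by blast
  let ?J = "insert {u, v} J"
  let ?F = "Graph {u, v} {{u, v}}"
  have J: "bridge_edges (insert {u, v} K) \<subseteq> ?J"
  proof
    fix f assume f: "f \<in> bridge_edges (insert {u, v} K)"
    then show "f \<in> ?J" using F(2) bridge_edges_mono[OF f, of K] by (auto simp: bridge_edges_def)
  qed
  have cJ: "card ?J \<le> Suc (card J)" by (simp add: card_insert_le_m1 F(1) card_insert_if)
  have b: "bridge_of H ?F" using pend.hyps assms(2) by (auto simp: bridge_of_def)
  have c1: "card ({u, v} \<inter> S) = 1" using pend.hyps by auto
  show ?case
  proof (cases "Fs = []")
    case True
    then have "graph_Union (set [?F]) = Graph (insert v S) (insert {u, v} K)"
      using F(4) pend.hyps by (auto simp: graph_Union_def)
    then show ?thesis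
      by (intro exI[of _ "[?F]"] exI[of _ ?J]) (use F True J cJ b in auto)
  next
    case False
    have "graph_Union (set (Fs @ [?F])) = Graph (insert v S) (insert {u, v} K)"
      using graph_Union_snoc[of Fs S K "{u, v}" "{{u, v}}"] F(4) False pend.hyps
      by (simp add: insert_absorb)
    moreover have "\<forall>i. 1 \<le> i \<and> i < length (Fs @ [?F]) \<longrightarrow> ear_step H (Fs @ [?F]) i"
      using ear_step_snoc[of Fs H S K ?F] F(4) False b c1 by auto
    ultimately show ?thesis
      by (intro exI[of _ "Fs @ [?F]"] exI[of _ ?J]) (use F False J cJ in auto)
  qed
qed

lemma bridge_of_odd: "bridge_of H F \<Longrightarrow> \<not> even_edges F"
  by (auto simp: bridge_of_def)

lemma even_ears_eq: "even_ears H Fs = length (filter even_edges Fs)"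
  unfolding even_ears_def length_filter_conv_card
  by (rule arg_cong[of _ _ card]) (use bridge_of_odd in blast)

text \<open>Each bridge of the list brings in a new vertex, so it is a pendant edge and no bridge is
  used twice. \<open>J\<close> collects them, which turns their total cost into
  \<open>card J\<close> and thus into at most the number of bridges.\<close>

lemma list_imp_ears:
  assumes H: "gen_ear_decomposition H Fs" "simple_graph H" and n: "n < length Fs"
  shows "\<exists>r c J K S. J \<subseteq> bridges H \<and> J \<subseteq> K \<and> graph_Union (set (take (Suc n) Fs)) = Graph S K \<and>
    ears UNIV {} {r} K S c \<and> c \<le> length (filter even_edges (take (Suc n) Fs)) + card J"
  using n
proof (induction n)
  case 0
  then have t: "take (Suc 0) Fs = [hd Fs]" by (cases Fs) auto
  have U: "graph_Union {hd Fs} = hd Fs" by (cases "hd Fs") (simp add: graph_Union_def)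
  consider "cycle_graph (hd Fs)" | "bridge_of H (hd Fs)" using H(1) by (auto simp: gen_ear_decomposition_alt)
  then show ?case
  proof cases
    case 1
    then obtain p where p: "closed_path p" "hd Fs = walk_graph p" by (auto simp: cycle_graph_def)
    define xs r where "xs = butlast (tl p)" and "r = hd p"
    have pe: "p = r # xs @ [r]" using p(1) unfolding xs_def r_def closed_path_def
      by (cases p; cases "tl p") auto
    have e: "is_ear {} {r} r xs r" using p(1) pe by (auto simp: is_ear_def closed_path_def butlast_append)
    from ears.ear[OF ears.base[of UNIV] e]
    have "ears UNIV {} {r} (path_edges p) (set p) (of_bool (odd (length xs)))" using pe by simp
    moreover have "even_edges (hd Fs) = odd (length xs)"
      using card_ear[OF e] p(2) pe by (simp add: walk_graph_eq)
    ultimately show ?thesis unfolding t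
      using U p(2) by (intro exI[of _ r] exI[of _ "of_bool (odd (length xs))"] exI[of _ "{}"]
         exI[of _ "path_edges p"] exI[of _ "set p"]) (auto simp: walk_graph_eq)
  next
    case 2
    then obtain e where e: "e \<in> bridges H" "hd Fs = Graph e {e}" by (auto simp: bridge_of_def)
    then have "card e = 2" using H(2) by (auto simp: bridges_def simple_graph_def)
    then obtain u v where uv: "e = {u, v}" "u \<noteq> v" by (auto simp: card_2_iff)
    have "ears UNIV {} {u} {{u, v}} {u, v} (Suc 0)"
      using ears.pend[OF ears.base[of UNIV "{}" "{u}"], of u v] uv by (simp add: insert_commute)
    then show ?thesis unfolding t
      using U e uv by (intro exI[of _ u] exI[of _ "Suc 0"] exI[of _ "{e}"]
         exI[of _ "{e}"] exI[of _ e]) auto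
  qed
next
  case (Suc n)
  then obtain r c J K S where I: "J \<subseteq> bridges H" "J \<subseteq> K" "graph_Union (set (take (Suc n) Fs)) = Graph S K"
    "ears UNIV {} {r} K S c" "c \<le> length (filter even_edges (take (Suc n) Fs)) + card J" by auto
  let ?F = "Fs ! Suc n"
  have t: "take (Suc (Suc n)) Fs = take (Suc n) Fs @ [?F]"
    using Suc.prems by (simp add: take_Suc_conv_app_nth)
  have K: "K \<subseteq> Pow S" using ears_Pow[OF I(4)] by simp
  have "ear_step H Fs (Suc n)" using H(1) Suc.prems by (auto simp: gen_ear_decomposition_alt)
  then consider "ear (Graph S K) ?F" | "bridge_of H ?F" "card (verts ?F \<inter> S) = 1"
    using I(3) by (auto simp: ear_step_def)
  then show ?case
  proof cases
    case 1
    then obtain s xs t where e: "is_ear K S s xs t" and F: "?F = walk_graph (s # xs @ [t])"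
      using ear_imp_is_ear by blast
    have "graph_Union (set (take (Suc (Suc n)) Fs))
       = Graph (S \<union> set (s # xs @ [t])) (K \<union> path_edges (s # xs @ [t]))"
      unfolding t F walk_graph_eq by (rule graph_Union_snoc[OF I(3)])
    moreover have "S \<union> set (s # xs @ [t]) = S \<union> set xs" using e by (auto simp: is_ear_def)
    moreover have "even_edges ?F = odd (length xs)"
      using card_ear[OF e] F by (simp add: walk_graph_eq)
    ultimately show ?thesis using ears.ear[OF I(4) e] I
      by (intro exI[of _ r] exI[of _ "c + of_bool (odd (length xs))"] exI[of _ J]
         exI[of _ "K \<union> path_edges (s # xs @ [t])"] exI[of _ "S \<union> set xs"]) (auto simp: t)
  next
    case 2
    then obtain e where e: "e \<in> bridges H" "?F = Graph e {e}" by (auto simp: bridge_of_def)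
    then have "card e = 2" using H(2) by (auto simp: bridges_def simple_graph_def)
    then obtain a b where ab: "e = {a, b}" "a \<noteq> b" by (auto simp: card_2_iff)
    have "\<exists>u v. e = {u, v} \<and> u \<in> S \<and> v \<notin> S"
    proof (cases "a \<in> S")
      case True
      then have "b \<notin> S" using 2(2) e ab by (auto simp: Int_insert_left)
      then show ?thesis using True ab by blast
    next
      case False
      then have "b \<in> S" using 2(2) e ab by (auto simp: Int_insert_left split: if_splits)
      then show ?thesis using False ab by blast
    qed
    then obtain u v where uv: "e = {u, v}" "u \<in> S" "v \<notin> S" by blast
    have "graph_Union (set (take (Suc (Suc n)) Fs)) = Graph (S \<union> e) (K \<union> {e})"
      unfolding t e by (rule graph_Union_snoc[OF I(3)])
    moreover have "S \<union> e = insert v S" "K \<union> {e} = insert {u, v} K" using uv by auto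
    moreover have "ears UNIV {} {r} (insert {u, v} K) (insert v S) (Suc c)"
      using ears.pend[OF I(4) uv(2,3)] by simp
    moreover have "e \<notin> J" using I(2) K uv by auto
    moreover have "finite (bridges H)"
    proof -
      have "bridges H \<subseteq> Pow (verts H)" using H(2) by (auto simp: bridges_def simple_graph_def)
      then show ?thesis using H(2) finite_subset by (auto simp: simple_graph_def)
    qed
    then have "finite J" using I(1) finite_subset by blast
    ultimately show ?thesis using I e uv
      by (intro exI[of _ r] exI[of _ "Suc c"] exI[of _ "insert e J"]
         exI[of _ "insert {u, v} K"] exI[of _ "insert v S"]) (auto simp: t)
  qed
qed

section \<open>Connected components\<close>

lemma reachable_eq: "reachable G = {(u, v). u \<in> verts G \<and> v \<in> verts G \<and> (u, v) \<in> conn (edges G)}"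
  by (simp add: reachable_def conn_def)

lemma equiv_reachable: "equiv (verts G) (reachable G)"
  by (auto simp: equiv_def refl_on_def sym_def trans_def reachable_eq intro: conn_sym conn_trans)

lemma verts_induced [simp]: "verts (induced G W) = W"
  and edges_induced [simp]: "edges (induced G W) = {e \<in> edges G. e \<subseteq> W}"
  by (simp_all add: induced_def)

lemma inj_induced: "inj_on (induced G) A"
  by (rule inj_onI) (metis verts_induced)

lemma card_components: "card (components G) = card (verts G // reachable G)"
  unfolding components_def by (rule card_image[OF inj_induced])

lemma quotient_connected:
  assumes "V \<noteq> {}" "\<And>u v. u \<in> V \<Longrightarrow> v \<in> V \<Longrightarrow> (u, v) \<in> R" "R \<subseteq> V \<times> V"
  shows "V // R = {V}"
  using assms by (fastforce simp: quotient_def)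

lemma bridges_eq:
  assumes s: "simple_graph H" and c: "connected_graph H"
  shows "bridges H = bridge_edges (edges H)"
proof -
  let ?V = "verts H" and ?E = "edges H"
  have V: "?V \<noteq> {}" "finite ?V" using assms by (auto simp: connected_graph_def simple_graph_def)
  have one: "card (components H) = 1"
  proof -
    have "?V // reachable H = {?V}"
      by (rule quotient_connected) (use c V in \<open>auto simp: connected_graph_def reachable_eq\<close>)
    then show ?thesis by (simp add: card_components)
  qed
  have con: "(a, b) \<in> conn ?E" if "a \<in> ?V" "b \<in> ?V" for a b
    using c that by (auto simp: connected_graph_def reachable_eq)
  have "(card (components (Graph ?V (?E - {e}))) > 1) \<longleftrightarrow> e \<in> bridge_edges ?E" if e: "e \<in> ?E" for e
  proof
    let ?H = "Graph ?V (?E - {e})"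
    assume gt: "card (components ?H) > 1"
    show "e \<in> bridge_edges ?E"
    proof (rule ccontr)
      assume nb: "e \<notin> bridge_edges ?E"
      have "(a, b) \<in> conn (?E - {e})" if ab: "a \<in> ?V" "b \<in> ?V" for a b
      proof -
        \<comment> \<open>\<open>conn_map\<close> with the identity: all edges stay, except
          \<open>e\<close>, which is replaced by a detour.\<close>
        have "(id a, id b) \<in> conn (?E - {e})"
          by (rule conn_map[OF con[OF ab]])
            (use nb e in \<open>auto simp: bridge_edges_def intro: conn_edge\<close>)
        then show ?thesis by simp
      qed
      then have "?V // reachable ?H = {?V}"
        by (intro quotient_connected) (use V in \<open>auto simp: reachable_eq\<close>)
      then show False using gt by (simp add: card_components)
    qed
  next
    let ?H = "Graph ?V (?E - {e})"
    assume "e \<in> bridge_edges ?E"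
    then obtain u v where uv: "e = {u, v}" "(u, v) \<notin> conn (?E - {e})" by (auto simp: bridge_edges_def)
    have uvV: "u \<in> ?V" "v \<in> ?V" using e uv s by (auto simp: simple_graph_def)
    have fin: "finite (?V // reachable ?H)"
      using finite_quotient[OF V(2), of "reachable ?H"] by (auto simp: reachable_def)
    have "reachable ?H `` {u} \<noteq> reachable ?H `` {v}"
      using uv uvV by (auto simp: reachable_eq set_eq_iff)
    moreover have "{reachable ?H `` {u}, reachable ?H `` {v}} \<subseteq> ?V // reachable ?H"
      using uvV by (auto simp: quotient_def)
    ultimately have "2 \<le> card (?V // reachable ?H)"
      using card_mono[OF fin, of "{reachable ?H `` {u}, reachable ?H `` {v}}"] by auto
    then show "card (components ?H) > 1" by (simp add: card_components)
  qed
  then show ?thesis unfolding bridges_def one by (auto simp: bridge_edges_def)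
qed

text \<open>After \<open>ears_bridge_edges\<close> all pendant edges are true bridges, and the
  sequence is a generalized ear decomposition. No ear contains a bridge, so the pendant edges
  exhaust the bridges and the even ears alone bound \<open>phi_connected\<close>.\<close>

theorem phi_psi_le_ears:
  assumes "simple_graph H" "connected_graph H" "edges H \<noteq> {}"
    and "ears UNIV {} {r} (edges H) (verts H) c"
  shows "phi_connected H + card (bridges H) \<le> c"
proof -
  obtain r' c' where r': "c' \<le> c" "ears (bridge_edges (edges H)) {} {r'} (edges H) (verts H) c'"
    using ears_bridge_edges[OF assms(4)] by blast
  note b = bridges_eq[OF assms(1,2)]
  from ears_imp_list[OF r'(2), of H] b
  obtain Fs J where F: "finite J" "bridges H \<subseteq> J" "length (filter even_edges Fs) + card J \<le> c'"
     "if Fs = [] then edges H = {} \<and> verts H = {r'}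
      else graph_Union (set Fs) = H \<and> (cycle_graph (hd Fs) \<or> bridge_of H (hd Fs)) \<and>
        (\<forall>i. 1 \<le> i \<and> i < length Fs \<longrightarrow> ear_step H Fs i)"
    by auto
  have "gen_ear_decomposition H Fs" using F(4) assms(3)
    by (auto simp: gen_ear_decomposition_alt split: if_splits)
  then have "phi_connected H \<le> even_ears H Fs" unfolding phi_connected_def by (auto intro!: Least_le)
  moreover have "card (bridges H) \<le> card J" using F card_mono by blast
  ultimately show ?thesis using F(3) r'(1) by (simp add: even_ears_eq)
qed

text \<open>The given sequence guarantees that a generalized ear decomposition exists, so that the
  \<open>LEAST\<close> in \<open>phi_connected\<close> is attained. The sequence obtained is read
  off from a minimal decomposition.\<close>

theorem ears_le_phi_psi:
  assumes "simple_graph H" "connected_graph H" "edges H \<noteq> {}"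
    and "ears UNIV {} {r} (edges H) (verts H) c"
  shows "\<exists>r c. ears UNIV {} {r} (edges H) (verts H) c \<and> c \<le> phi_connected H + card (bridges H)"
proof -
  obtain r' c' where r': "c' \<le> c" "ears (bridge_edges (edges H)) {} {r'} (edges H) (verts H) c'"
    using ears_bridge_edges[OF assms(4)] by blast
  note b = bridges_eq[OF assms(1,2)]
  from ears_imp_list[OF r'(2), of H] b
  have "\<exists>Fs. gen_ear_decomposition H Fs" using assms(3)
    by (fastforce simp: gen_ear_decomposition_alt split: if_splits)
  then have "\<exists>n Fs. gen_ear_decomposition H Fs \<and> even_ears H Fs = n" by blast
  from LeastI_ex[OF this] obtain Fs where Fs: "gen_ear_decomposition H Fs" "even_ears H Fs = phi_connected H"
    unfolding phi_connected_def by blast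
  have ne: "Fs \<noteq> []" and U: "graph_Union (set Fs) = H" using Fs by (auto simp: gen_ear_decomposition_alt)
  obtain r c J K S where I: "J \<subseteq> bridges H" "graph_Union (set (take (Suc (length Fs - 1)) Fs)) = Graph S K"
    "ears UNIV {} {r} K S c" "c \<le> length (filter even_edges (take (Suc (length Fs - 1)) Fs)) + card J"
    using list_imp_ears[OF Fs(1) assms(1), of "length Fs - 1"] ne by auto
  have "bridges H \<subseteq> Pow (verts H)" "finite (verts H)"
    using assms(1) by (auto simp: bridges_def simple_graph_def)
  then have "finite (bridges H)" using finite_subset by auto
  then have "card J \<le> card (bridges H)" using I(1) card_mono by blast
  moreover have "take (Suc (length Fs - 1)) Fs = Fs" using ne by simp
  ultimately have "H = Graph S K" "c \<le> phi_connected H + card (bridges H)"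
    using I U Fs(2) by (auto simp: even_ears_eq)
  then show ?thesis using I(3) by auto
qed

section \<open>Critical weights\<close>

definition deg :: "'v set multiset \<Rightarrow> 'v \<Rightarrow> nat" where
  "deg M v = size (filter_mset (\<lambda>e. v \<in> e) M)"

lemma deg_empty [simp]: "deg {#} v = 0"
  and deg_add_mset [simp]: "deg (add_mset e M) v = of_bool (v \<in> e) + deg M v"
  and deg_union [simp]: "deg (M + N) v = deg M v + deg N v"
  by (simp_all add: deg_def)

lemma deg_pos: "0 < deg M v \<Longrightarrow> \<exists>e. e \<in># M \<and> v \<in> e"
  by (induction M) (auto split: if_splits)

lemma deg_posI: "e \<in># M \<Longrightarrow> v \<in> e \<Longrightarrow> 0 < deg M v"
  by (induction M) auto

lemma deg_mono: "M \<subseteq># N \<Longrightarrow> deg M v \<le> deg N v"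
  by (auto simp: deg_def multiset_filter_mono size_mset_mono)

lemma sum_deg: "finite A \<Longrightarrow> (\<Sum>v\<in>A. deg M v) = (\<Sum>e\<in>#M. card (A \<inter> e))"
  by (induction M) (simp_all add: sum.distrib of_bool_def Int_def sum.If_cases)

lemma sum_mset_const: "(\<And>e. e \<in># M \<Longrightarrow> f e = c) \<Longrightarrow> (\<Sum>e\<in>#M. f e) = size M * (c::nat)"
  by (induction M) auto

lemma handshake:
  assumes "finite S" "\<And>e. e \<in># M \<Longrightarrow> e \<subseteq> S \<and> card e = 2"
  shows "(\<Sum>v\<in>S. deg M v) = 2 * size M"
  unfolding sum_deg[OF assms(1)]
  using sum_mset_const[of M "\<lambda>e. card (S \<inter> e)" 2] assms(2) by (simp add: Int_absorb1)

abbreviation un :: "'v \<Rightarrow> 'v \<Rightarrow> nat" where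
  "un x v \<equiv> of_bool (v = x)"

lemma deg_add_edge: "x \<noteq> y \<Longrightarrow> deg (add_mset {x, y} M) v = deg M v + un x v + un y v"
  by auto

text \<open>Replacing every vertex \<open>v\<close> by \<open>b v\<close> independent copies yields a factor-critical graph.\<close>

definition critical :: "'v set set \<Rightarrow> 'v set \<Rightarrow> ('v \<Rightarrow> nat) \<Rightarrow> bool" where
  "critical E S b \<longleftrightarrow> (\<forall>v. 0 < b v \<longleftrightarrow> v \<in> S) \<and>
     (\<forall>x\<in>S. \<exists>M. set_mset M \<subseteq> E \<and> (\<forall>v. deg M v + un x v = b v))"

lemma criticalE:
  assumes "critical E S b" "x \<in> S"
  obtains M where "set_mset M \<subseteq> E" "\<And>v. deg M v + un x v = b v" "\<And>e. e \<in># M \<Longrightarrow> e \<subseteq> S"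
proof -
  obtain M where M: "set_mset M \<subseteq> E" "\<forall>v. deg M v + un x v = b v"
    using assms unfolding critical_def by blast
  have "e \<subseteq> S" if "e \<in># M" for e
  proof
    fix v assume "v \<in> e"
    then have "0 < deg M v" using that deg_posI by metis
    then show "v \<in> S" using M(2) assms(1) unfolding critical_def by (metis add_gr_0)
  qed
  then show ?thesis using that M by blast
qed

lemma critical_size:
  assumes "critical E S b" "finite S" "x \<in> S" "\<And>e. e \<in> E \<Longrightarrow> card e = 2"
    and M: "set_mset M \<subseteq> E" "\<And>v. deg M v + un x v = b v" "\<And>e. e \<in># M \<Longrightarrow> e \<subseteq> S"
  shows "sum b S = 2 * size M + 1"
proof -
  have "sum b S = (\<Sum>v\<in>S. deg M v) + (\<Sum>v\<in>S. un x v)" by (simp add: M(2)[symmetric] sum.distrib)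
  then show ?thesis using handshake[of S M] assms by (auto simp: of_bool_def)
qed

lemma critical_neighbour:
  assumes b: "critical E S b" and v: "v \<in> S" "x \<in> S" "v \<noteq> x" and E: "\<And>e. e \<in> E \<Longrightarrow> card e = 2"
  obtains u where "u \<in> S" "{u, v} \<in> E"
proof -
  obtain M where M: "set_mset M \<subseteq> E" "\<And>v. deg M v + un x v = b v" "\<And>e. e \<in># M \<Longrightarrow> e \<subseteq> S"
    by (rule criticalE[OF b v(2)], rule that)
  have "0 < b v" using b v by (auto simp: critical_def)
  then have "0 < deg M v" using M(2)[of v] v(3) by auto
  then obtain e where e: "e \<in># M" "v \<in> e" by (auto dest: deg_pos)
  then obtain u where "e = {u, v}" using E[of e] M(1) by (auto simp: card_2_iff)
  then have "u \<in> S" "{u, v} \<in> E" using e M(1,3) by auto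
  then show ?thesis by (rule that)
qed

text \<open>Count the weight of one colour class. Every edge of a packing missing \<open>z\<close>
  meets the class once, so the class weighs \<open>size M + of_bool (f z)\<close>, while the total
  is \<open>2 * size M + 1\<close>. Neither weight depends on \<open>z\<close>, so \<open>f\<close>
  is constant on \<open>S\<close>, against the edge \<open>{x, y}\<close>.\<close>

lemma critical_not_two_colourable:
  assumes b: "critical E S b" and S: "finite S" and xy: "{x, y} \<in> E" "x \<in> S" "y \<in> S"
    and E: "\<And>e. e \<in> E \<Longrightarrow> card e = 2"
    and f: "\<And>u v. {u, v} \<in> E \<Longrightarrow> f u \<noteq> (f v :: bool)"
  shows False
proof -
  have *: "2 * (\<Sum>v\<in>{v\<in>S. f v}. b v) + 1 = sum b S + 2 * of_bool (f z)" if z: "z \<in> S" for z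
  proof -
    obtain M where M: "set_mset M \<subseteq> E" "\<And>v. deg M v + un z v = b v" "\<And>e. e \<in># M \<Longrightarrow> e \<subseteq> S"
      by (rule criticalE[OF b z], rule that)
    let ?A = "{v\<in>S. f v}"
    have fin: "finite ?A" using S by simp
    have "card (?A \<inter> e) = 1" if "e \<in># M" for e
    proof -
      have "card e = 2" using E M(1) that by blast
      then obtain u v where uv: "e = {u, v}" "u \<noteq> v" by (auto simp: card_2_iff)
      then show ?thesis using f[of u v] M(1,3) that
        by (cases "f u"; cases "f v") (auto simp: Int_insert_right)
    qed
    then have "(\<Sum>v\<in>?A. deg M v) = size M"
      unfolding sum_deg[OF fin] using sum_mset_const[of M "\<lambda>e. card (?A \<inter> e)" 1] by simp
    moreover have "(\<Sum>v\<in>?A. b v) = (\<Sum>v\<in>?A. deg M v) + (\<Sum>v\<in>?A. un z v)"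
      by (simp add: M(2)[symmetric] sum.distrib)
    moreover have "(\<Sum>v\<in>?A. un z v) = of_bool (f z)" using fin z by (auto simp: of_bool_def)
    ultimately show ?thesis using critical_size[OF b S z E M] by simp
  qed
  show False using *[OF xy(2)] *[OF xy(3)] f[OF xy(1)] by (cases "f x"; cases "f y") auto
qed

section \<open>From critical weights to ear sequences\<close>

lemma double_half_superadditive: "2 * (a div 2) + 2 * (b div 2) \<le> 2 * ((a + b) div (2::nat))"
  by presburger

text \<open>The allowance is the number of edges of the walk rounded down to an even number; for a
  single ear this is exactly the number of new vertices plus the cost. A walk that meets
  \<open>S\<close> or itself is cut in two, and the parts stay within the allowance since rounding
  down is superadditive.\<close>

lemma ears_walk:
  assumes "ears UNIV K0 S0 K S c" "finite S0" "K \<subseteq> E" "path_edges p \<subseteq> E"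
    and "p \<noteq> []" "hd p \<in> S" "last p \<in> S"
  shows "\<exists>K' c'. ears UNIV K0 S0 K' (S \<union> set p) c' \<and> K' \<subseteq> E \<and>
    card (S \<union> set p) + c' \<le> card S + c + 2 * ((length p - 1) div 2)"
  using assms
proof (induction "length p" arbitrary: p K S c rule: less_induct)
  case less
  have finS: "finite S" using ears_finite[OF less.prems(1,2)] .
  define xs where "xs = butlast (tl p)"
  define s where "s = hd p"
  define t where "t = last p"
  show ?case
  proof (cases "xs = []")
    case True
    then have "set p \<subseteq> S" using less.prems(5-7) unfolding xs_def
      by (cases p; cases "tl p") (auto split: if_splits)
    then show ?thesis using less.prems by (intro exI[of _ K] exI[of _ c]) (auto simp: sup_absorb1)
  next
    case ne: False
    have p: "p = s # xs @ [t]" using less.prems(5) ne unfolding s_def xs_def t_def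
      by (cases p; cases "tl p") (auto split: if_splits)
    have sS: "s \<in> S" "t \<in> S" using less.prems(6,7) s_def t_def by auto
    have two: ?thesis if
      q: "path_edges q1 \<union> path_edges q2 \<subseteq> E" "length q1 < length p" "length q2 < length p"
      "q1 \<noteq> []" "q2 \<noteq> []" "hd q1 \<in> S" "last q1 \<in> S" "hd q2 \<in> S \<union> set q1" "last q2 \<in> S \<union> set q1"
      "S \<union> set q1 \<union> set q2 = S \<union> set p" "(length q1 - 1) + (length q2 - 1) = length p - 1" for q1 q2
    proof -
      obtain K1 c1 where 1: "ears UNIV K0 S0 K1 (S \<union> set q1) c1" "K1 \<subseteq> E"
        "card (S \<union> set q1) + c1 \<le> card S + c + 2 * ((length q1 - 1) div 2)"
        using less.hyps[OF q(2) less.prems(1-3) _ q(4,6,7)] q(1) by auto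
      obtain K2 c2 where 2: "ears UNIV K0 S0 K2 (S \<union> set q1 \<union> set q2) c2" "K2 \<subseteq> E"
        "card (S \<union> set q1 \<union> set q2) + c2 \<le> card (S \<union> set q1) + c1 + 2 * ((length q2 - 1) div 2)"
        using less.hyps[OF q(3) 1(1) less.prems(2) 1(2) _ q(5,8,9)] q(1) by auto
      have "card (S \<union> set p) + c2 \<le> card S + c + 2 * ((length p - 1) div 2)"
        using 1(3) 2(3) q(10,11) double_half_superadditive[of "length q1 - 1" "length q2 - 1"] by simp
      then show ?thesis using 2 q(10) by auto
    qed
    consider (hit) "set xs \<inter> S \<noteq> {}" | (rep) "\<not> distinct xs" | (free) "distinct xs" "set xs \<inter> S = {}"
      by blast
    then show ?thesis
    proof cases
      case hit
      then obtain x ys zs where x: "x \<in> S" "xs = ys @ x # zs" by (meson disjoint_iff split_list)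
      show ?thesis
        by (rule two[of "s # ys @ [x]" "x # zs @ [t]"])
          (use x p sS less.prems(4) path_edges_split3[of s ys x zs t] in auto)
    next
      case rep
      then obtain as x bs cs where xs: "xs = as @ [x] @ bs @ [x] @ cs" using not_distinct_decomp by blast
      have "path_edges p = path_edges (s # as @ [x]) \<union> path_edges (x # bs @ [x]) \<union> path_edges (x # cs @ [t])"
        using path_edges_split3[of s as x "bs @ [x] @ cs" t] path_edges_split3[of x bs x cs t] xs p by auto
      then show ?thesis
        by (intro two[of "s # as @ x # cs @ [t]" "x # bs @ [x]"])
          (use xs p sS less.prems(4) path_edges_split3[of s as x cs t] in auto)
    next
      case free
      have card: "card (S \<union> set xs) = card S + length xs"
        using free finS by (simp add: card_Un_disjoint distinct_card Int_commute)
      show ?thesis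
      \<comment> \<open>A walk to a new vertex and back traverses one edge twice. It is no closed
        ear but a pendant edge, at the price of an even ear with one inner vertex.\<close>
      proof (cases "s = t \<and> length xs = 1")
        case True
        then obtain v where v: "xs = [v]" by (cases xs) auto
        then have v': "v \<notin> S" using free by auto
        from ears.pend[OF less.prems(1) sS(1) this] have
          "ears UNIV K0 S0 (insert {s, v} K) (insert v S) (Suc c)" by simp
        moreover have "S \<union> set p = insert v S" using p v sS by auto
        moreover have "insert {s, v} K \<subseteq> E" using less.prems(3,4) p v by auto
        ultimately show ?thesis using card v p finS v'
          by (intro exI[of _ "insert {s, v} K"] exI[of _ "Suc c"]) auto
      next
        case False
        then have "is_ear K S s xs t" using free sS ne by (cases xs; cases "tl xs") (auto simp: is_ear_def)
        from ears.ear[OF less.prems(1) this]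
        have "ears UNIV K0 S0 (K \<union> path_edges p) (S \<union> set xs) (c + of_bool (odd (length xs)))"
          by (simp add: p)
        moreover have "S \<union> set p = S \<union> set xs" using p sS by auto
        moreover have "length xs + of_bool (odd (length xs)) \<le> 2 * ((length p - 1) div 2)"
          unfolding p by (cases "even (length xs)") auto
        ultimately show ?thesis using card less.prems(3,4)
          by (intro exI[of _ "K \<union> path_edges p"] exI[of _ "c + of_bool (odd (length xs))"]) auto
      qed
    qed
  qed
qed

text \<open>A chord is an ear without inner vertices, hence odd and free.\<close>

lemma ears_add_chords:
  assumes "ears B K0 S0 K S c" "K \<subseteq> E" "E \<subseteq> Pow S" "finite E" "\<And>e. e \<in> E \<Longrightarrow> card e = 2"
  shows "ears B K0 S0 E S c"
  using assms
proof (induction "card (E - K)" arbitrary: K)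
  case 0
  then have "K = E" by auto
  then show ?case using 0 by simp
next
  case (Suc n)
  then obtain e where e: "e \<in> E" "e \<notin> K" by (metis Diff_iff card.empty equals0I nat.distinct(1))
  then obtain s t where st: "e = {s, t}" "s \<noteq> t" using Suc.prems(5) by (metis card_2_iff)
  then have "is_ear K S s [] t" using e Suc.prems(3) by (auto simp: is_ear_def)
  from ears.ear[OF Suc.prems(1) this] have "ears B K0 S0 (insert e K) S c"
    using st by (simp add: insert_commute)
  moreover have "E - insert e K = (E - K) - {e}" by auto
  then have "card (E - insert e K) = n" using Suc e by simp
  ultimately show ?case using Suc.hyps(1)[of "insert e K"] Suc.prems e by auto
qed

lemma conn_leave:
  "(a, b) \<in> conn E \<Longrightarrow> a \<in> T \<Longrightarrow> b \<notin> T \<Longrightarrow> \<exists>u w. u \<in> T \<and> w \<notin> T \<and> {u, w} \<in> E"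
  by (induction rule: conn_induct) blast+

text \<open>A spanning tree is grown from pendant edges and the other edges follow as chords. Only
  existence matters here; the cost is not controlled.\<close>

lemma connected_ears:
  assumes "E \<subseteq> Pow S" "finite S" "\<And>e. e \<in> E \<Longrightarrow> card e = 2" "r \<in> S"
    and con: "\<And>u v. u \<in> S \<Longrightarrow> v \<in> S \<Longrightarrow> (u, v) \<in> conn E"
  shows "\<exists>c. ears UNIV {} {r} E S c"
proof -
  have "\<exists>K' c'. ears UNIV {} {r} K' S c' \<and> K' \<subseteq> E"
    if "ears UNIV {} {r} K T c" "K \<subseteq> E" "T \<subseteq> S" "r \<in> T" for K T c
    using that
  proof (induction "card (S - T)" arbitrary: K T c rule: less_induct)
    case less
    show ?case
    proof (cases "T = S")
      case True
      then show ?thesis using less.prems by blast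
    next
      case False
      then obtain b where "b \<in> S" "b \<notin> T" using less.prems by auto
      then obtain u w where uw: "u \<in> T" "w \<notin> T" "{u, w} \<in> E"
        using conn_leave[OF con[OF assms(4) \<open>b \<in> S\<close>] \<open>r \<in> T\<close> \<open>b \<notin> T\<close>] by blast
      then have w: "w \<in> S" using assms(1) by auto
      then have "card (S - insert w T) < card (S - T)"
        using uw assms(2) by (intro psubset_card_mono) auto
      from less.hyps[OF this ears.pend[OF less.prems(1) uw(1,2)]] less.prems uw w
      show ?thesis by auto
    qed
  qed
  from this[OF ears.base] obtain K' c' where "ears UNIV {} {r} K' S c'" "K' \<subseteq> E" using assms(4) by blast
  then show ?thesis using ears_add_chords assms finite_subset by (metis finite_Pow_iff)
qed

text \<open>An alternating trail starting at \<open>w\<close>, followed until an edge of the second multiset enters \<open>S\<close>.\<close>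

lemma alternating_trail:
  assumes "\<And>v. deg D1 v + un r v = deg D2 v + un w v" "w \<notin> S" "r \<in> S"
    and "\<And>e. e \<in># D1 + D2 \<Longrightarrow> card e = 2"
  shows "\<exists>p N. p \<noteq> [] \<and> hd p = w \<and> last p \<in> S \<and> path_edges p \<subseteq> set_mset (D1 + D2) \<and>
    length p = 2 * size N + 1 \<and> N \<subseteq># D1 \<and> (\<forall>e\<in>#N. \<not> e \<subseteq> S \<and> e \<subseteq> set p)"
  using assms
proof (induction "size D1" arbitrary: D1 D2 w rule: less_induct)
  case less
  have wr: "w \<noteq> r" using less.prems by auto
  have "0 < deg D1 w" using less.prems(1)[of w] wr by simp
  then obtain e where "e \<in># D1" "w \<in> e" by (auto dest: deg_pos)
  moreover from this obtain v where "e = {w, v}" "v \<noteq> w"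
    using less.prems(4)[of e] by (auto simp: card_2_iff; metis insert_commute)
  ultimately have v: "{w, v} \<in># D1" "v \<noteq> w" by auto
  obtain D1' where D1: "D1 = add_mset {w, v} D1'" using v(1) by (metis multi_member_split)
  have "0 < deg D2 v" using less.prems(1)[of v] v D1 by simp
  then obtain f where "f \<in># D2" "v \<in> f" by (auto dest: deg_pos)
  moreover from this obtain x where "f = {v, x}" "x \<noteq> v"
    using less.prems(4)[of f] by (auto simp: card_2_iff; metis insert_commute)
  ultimately have x: "{v, x} \<in># D2" "x \<noteq> v" by auto
  obtain D2' where D2: "D2 = add_mset {v, x} D2'" using x(1) by (metis multi_member_split)
  show ?case
  proof (cases "x \<in> S")
    case True
    then show ?thesis using v x less.prems(2)
      by (intro exI[of _ "[w, v, x]"] exI[of _ "{#{w, v}#}"]) (auto simp: single_subset_iff)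
  next
    case False
    \<comment> \<open>Removing one edge of each kind moves the surplus from \<open>w\<close> to
      \<open>x\<close>, so the hypothesis is restored for the rest of the trail.\<close>
    have eq: "deg D1' u + un r u = deg D2' u + un x u" for u
      using less.prems(1)[of u] v(2) x(2) unfolding D1 D2
      by (auto simp: deg_add_edge of_bool_def split: if_splits)
    obtain p N where p: "p \<noteq> []" "hd p = x" "last p \<in> S" "path_edges p \<subseteq> set_mset (D1' + D2')"
      "length p = 2 * size N + 1" "N \<subseteq># D1'" "\<forall>e\<in>#N. \<not> e \<subseteq> S \<and> e \<subseteq> set p"
      using less.hyps[of D1', OF _ eq False less.prems(3)] less.prems(4) unfolding D1 D2 by auto
    have "path_edges (w # v # p) = {{w, v}, {v, x}} \<union> path_edges p" using p(1,2) by (cases p) auto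
    then show ?thesis using p less.prems(2) v x
      by (intro exI[of _ "w # v # p"] exI[of _ "add_mset {w, v} N"]) (auto simp: D1 D2)
  qed
qed

lemma union_subset_mset_disjoint:
  assumes "M \<subseteq># L" "N \<subseteq># L" "set_mset M \<inter> set_mset N = {}"
  shows "M + N \<subseteq># L"
proof (rule mset_subset_eqI)
  fix a
  show "count (M + N) a \<le> count L a"
  proof (cases "a \<in># M")
    case True
    then have "count N a = 0" using assms(3) by (auto simp: count_eq_zero_iff)
    then show ?thesis using mset_subset_eq_count[OF assms(1), of a] by simp
  next
    case False
    then show ?thesis using mset_subset_eq_count[OF assms(2), of a] by (simp add: not_in_iff)
  qed
qed

text \<open>A vertex \<open>w\<close> next to the part \<open>T\<close> built so far is missed by
  some packing \<open>M2\<close>. The trail alternating between \<open>M\<close> and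
  \<open>M2\<close> leads from \<open>w\<close> back to \<open>T\<close>; with the edge from
  \<open>T\<close> to \<open>w\<close> it is a walk of \<open>2 * size N + 1\<close> edges, which
  \<open>ears_walk\<close> absorbs for \<open>2 * size N\<close>. The edges \<open>N\<close> of
  \<open>M\<close> on the trail account for this amount.\<close>

theorem critical_imp_ears:
  assumes E: "E \<subseteq> Pow S" "finite S" "\<And>e. e \<in> E \<Longrightarrow> card e = 2"
    and con: "\<And>u v. u \<in> S \<Longrightarrow> v \<in> S \<Longrightarrow> (u, v) \<in> conn E"
    and b: "critical E S b" and r: "r \<in> S"
  shows "\<exists>c. ears UNIV {} {r} E S c \<and> card S + c \<le> sum b S"
proof -
  obtain M where M: "set_mset M \<subseteq> E" "\<And>v. deg M v + un r v = b v" "\<And>e. e \<in># M \<Longrightarrow> e \<subseteq> S"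
    by (rule criticalE[OF b r], rule that)
  \<comment> \<open>\<open>L\<close> holds the edges of \<open>M\<close> already accounted for. They
    lie inside \<open>T\<close>, the edges \<open>N\<close> of a new trail do not, so no edge of
    \<open>M\<close> counts twice. The 1 stands for \<open>r\<close>.\<close>
  have "\<exists>K' c'. ears UNIV {} {r} K' S c' \<and> K' \<subseteq> E \<and> card S + c' \<le> 1 + 2 * size M"
    if "ears UNIV {} {r} K T c" "K \<subseteq> E" "T \<subseteq> S" "r \<in> T" "L \<subseteq># M" "\<forall>e\<in>#L. e \<subseteq> T"
      "card T + c \<le> 1 + 2 * size L" for K T c L
    using that
  proof (induction "card (S - T)" arbitrary: K T c L rule: less_induct)
    case less
    show ?case
    proof (cases "T = S")
      case True
      then show ?thesis using less.prems size_mset_mono[OF less.prems(5)]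
        by (intro exI[of _ K] exI[of _ c]) auto
    next
      case False
      then obtain a where "a \<in> S" "a \<notin> T" using less.prems by auto
      then obtain u w where uw: "u \<in> T" "w \<notin> T" "{u, w} \<in> E"
        using conn_leave[OF con[OF r \<open>a \<in> S\<close>] \<open>r \<in> T\<close> \<open>a \<notin> T\<close>] by blast
      then have w: "w \<in> S" using E(1) by auto
      obtain M2 where M2: "set_mset M2 \<subseteq> E" "\<And>v. deg M2 v + un w v = b v"
        by (rule criticalE[OF b w], rule that)
      have "deg M v + un r v = deg M2 v + un w v" for v using M(2) M2(2) by metis
      moreover have "card e = 2" if "e \<in># M + M2" for e using that E(3) M(1) M2(1) by auto
      ultimately obtain p N where p: "p \<noteq> []" "hd p = w" "last p \<in> T" "path_edges p \<subseteq> set_mset (M + M2)"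
        "length p = 2 * size N + 1" "N \<subseteq># M" "\<forall>e\<in>#N. \<not> e \<subseteq> T \<and> e \<subseteq> set p"
        using alternating_trail[of M r M2 w T, OF _ uw(2) less.prems(4)] by blast
      have pE: "path_edges (u # p) \<subseteq> E" using p M(1) M2(1) uw by (cases p) auto
      from ears_walk[OF less.prems(1) _ less.prems(2) pE] p uw
      obtain K' c' where K': "ears UNIV {} {r} K' (T \<union> set (u # p)) c'" "K' \<subseteq> E"
        "card (T \<union> set (u # p)) + c' \<le> card T + c + 2 * ((length (u # p) - 1) div 2)" by auto
      have "set p \<subseteq> S"
      proof
        fix x assume "x \<in> set p"
        then obtain ys zs where xs: "u # p = (u # ys) @ x # zs" using split_list by fastforce
        have "{last (u # ys), x} \<in> path_edges (u # p)"
          unfolding xs by (induction ys arbitrary: u) auto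
        then show "x \<in> S" using pE E(1) by auto
      qed
      then have TS: "T \<union> set (u # p) \<subseteq> S" using less.prems uw by auto
      have wT: "w \<in> set p" using p by (cases p) auto
      have "card (S - (T \<union> set (u # p))) < card (S - T)"
        using uw w wT E(2) by (intro psubset_card_mono) auto
      moreover have "L + N \<subseteq># M"
        using union_subset_mset_disjoint[OF less.prems(5) p(6)] less.prems(6) p(7) by blast
      moreover have "card (T \<union> set (u # p)) + c' \<le> 1 + 2 * size (L + N)"
        using K'(3) less.prems(7) p(5) by simp
      moreover have "\<forall>e\<in>#L + N. e \<subseteq> T \<union> set (u # p)" using less.prems(6) p(7) by auto
      ultimately show ?thesis using less.hyps[of "T \<union> set (u # p)" K' c' "L + N"] K'(1,2) TS less.prems(4)
        by blast
    qed
  qed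
  from this[OF ears.base, of "{#}"] obtain K' c' where
    K': "ears UNIV {} {r} K' S c'" "K' \<subseteq> E" "card S + c' \<le> 1 + 2 * size M" using r by auto
  have "finite E" using finite_subset[OF E(1)] E(2) by simp
  then show ?thesis using ears_add_chords[OF K'(1,2) E(1) _ E(3)] K'(3)
      critical_size[OF b E(2) r E(3) M] by auto
qed

section \<open>From ear sequences to critical weights\<close>

text \<open>Every second edge, beginning with the first: a perfect matching if the number of
  vertices is even. On a walk with repetitions, vertices count with multiplicity.\<close>

fun alternate :: "'v list \<Rightarrow> 'v set multiset" where
  "alternate (x # y # zs) = add_mset {x, y} (alternate zs)"
| "alternate _ = {#}"

lemma set_alternate: "set_mset (alternate xs) \<subseteq> path_edges xs"
proof (induction xs rule: alternate.induct)
  case (1 x y zs)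
  then show ?case by (cases zs) auto
qed auto

lemma deg_alternate:
  "even (length xs) \<Longrightarrow> path_edges xs \<subseteq> E \<Longrightarrow> (\<And>e. e \<in> E \<Longrightarrow> card e = 2) \<Longrightarrow>
    deg (alternate xs) v = count_list xs v"
proof (induction xs rule: alternate.induct)
  case (1 x y zs)
  have "path_edges zs \<subseteq> E" using 1(3) by (cases zs) auto
  moreover have "x \<noteq> y" using 1(3) 1(4)[of "{x, y}"] by auto
  ultimately show ?case using 1 by auto
qed auto

lemma path_edges_infix: "path_edges ys \<subseteq> path_edges (xs @ ys @ zs)"
proof (cases ys)
  case (Cons y ys')
  obtain l ls where l: "ys = ls @ [l]" using Cons by (metis list.distinct(1) rev_exhaust)
  have "path_edges (ys @ zs) = path_edges ys \<union> path_edges (l # zs)"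
    using path_edges_append[of ls l zs] l by simp
  moreover have "path_edges (xs @ ys @ zs) = path_edges (xs @ [y]) \<union> path_edges (ys @ zs)"
    using path_edges_append[of xs y "ys' @ zs"] Cons by simp
  ultimately show ?thesis by auto
qed simp

text \<open>To free a new vertex \<open>x\<close> on the walk, split the walk there. One side has an
  even number of inner vertices and is matched within itself; the other has an odd number and is
  matched together with its end \<open>s\<close> or \<open>t\<close>, a copy of which is left over
  by a suitable packing of \<open>b\<close>. The walk may revisit vertices, and this produces
  weights above one.\<close>

lemma critical_walk:
  assumes b: "critical E S b" and st: "s \<in> S" "t \<in> S" and xs: "even (length xs)"
    and pe: "path_edges (s # xs @ [t]) \<subseteq> E" and E: "\<And>e. e \<in> E \<Longrightarrow> card e = 2"
  shows "critical E (S \<union> set xs) (\<lambda>v. b v + count_list xs v)"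
proof -
  have sub: "path_edges ys \<subseteq> E" if "s # xs @ [t] = as @ ys @ zs" for as ys zs
    using pe path_edges_infix[of ys as zs] that by simp
  have "\<exists>M. set_mset M \<subseteq> E \<and> (\<forall>v. deg M v + un x v = b v + count_list xs v)"
    if x: "x \<in> S \<union> set xs" for x
  proof (cases "x \<in> S")
    case True
    obtain M where M: "set_mset M \<subseteq> E" "\<And>v. deg M v + un x v = b v"
      by (rule criticalE[OF b True], rule that)
    have s: "path_edges xs \<subseteq> E" using sub[of "[s]" xs "[t]"] by simp
    then show ?thesis using deg_alternate[OF xs s E] M set_alternate[of xs]
      by (intro exI[of _ "M + alternate xs"]) (auto simp: M(2)[symmetric])
  next
    case False
    then obtain ys zs where xs': "xs = ys @ x # zs" using x split_list by fastforce
    show ?thesis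
    proof (cases "even (length ys)")
      case True
      obtain M where M: "set_mset M \<subseteq> E" "\<And>v. deg M v + un t v = b v"
        by (rule criticalE[OF b st(2)], rule that)
      have s: "path_edges ys \<subseteq> E" "path_edges (zs @ [t]) \<subseteq> E"
        using sub[of "[s]" ys "x # zs @ [t]"] sub[of "s # ys @ [x]" "zs @ [t]" "[]"] xs' by auto
      have "even (length (zs @ [t]))" using xs True xs' by auto
      from deg_alternate[OF True s(1) E] deg_alternate[OF this s(2) E]
      have "deg (M + alternate ys + alternate (zs @ [t])) v + un x v = b v + count_list xs v" for v
        using M(2)[of v] xs' by auto
      then show ?thesis using M(1) s set_alternate[of ys] set_alternate[of "zs @ [t]"]
        by (intro exI[of _ "M + alternate ys + alternate (zs @ [t])"]) auto
    next
      case False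
      obtain M where M: "set_mset M \<subseteq> E" "\<And>v. deg M v + un s v = b v"
        by (rule criticalE[OF b st(1)], rule that)
      have s: "path_edges (s # ys) \<subseteq> E" "path_edges zs \<subseteq> E"
        using sub[of "[]" "s # ys" "x # zs @ [t]"] sub[of "s # ys @ [x]" "zs" "[t]"] xs' by auto
      have "even (length (s # ys))" "even (length zs)" using xs False xs' by auto
      from deg_alternate[OF this(1) s(1) E] deg_alternate[OF this(2) s(2) E]
      have "deg (M + alternate (s # ys) + alternate zs) v + un x v = b v + count_list xs v" for v
        using M(2)[of v] xs' by auto
      then show ?thesis using M(1) s set_alternate[of "s # ys"] set_alternate[of "zs"]
        by (intro exI[of _ "M + alternate (s # ys) + alternate zs"]) auto
    qed
  qed
  moreover have "0 < b v + count_list xs v \<longleftrightarrow> v \<in> S \<union> set xs" for v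
    using b by (auto simp: critical_def count_list_0_iff)
  ultimately show ?thesis unfolding critical_def by blast
qed

lemma sum_count_list:
  "finite A \<Longrightarrow> set xs \<subseteq> A \<Longrightarrow> (\<Sum>v\<in>A. count_list xs v) = length xs"
proof (induction xs)
  case (Cons x xs)
  have "(\<Sum>v\<in>A. count_list (x # xs) v) = (\<Sum>v\<in>A. count_list xs v) + (\<Sum>v\<in>A. if v = x then 1 else 0)"
    by (subst sum.distrib[symmetric]) (auto intro!: sum.cong)
  then show ?case using Cons by simp
qed simp

lemma critical_walk_sum:
  assumes b: "critical E S b" and st: "s \<in> S" "t \<in> S" and xs: "even (length xs)"
    and pe: "path_edges (s # xs @ [t]) \<subseteq> E" and E: "\<And>e. e \<in> E \<Longrightarrow> card e = 2" and S: "finite S"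
  shows "\<exists>b'. critical E (S \<union> set xs) b' \<and> sum b' (S \<union> set xs) = sum b S + length xs"
proof (intro exI conjI)
  show "critical E (S \<union> set xs) (\<lambda>v. b v + count_list xs v)" by (rule critical_walk[OF b st xs pe E])
  have "sum b (S \<union> set xs) = sum b S"
    by (rule sum.mono_neutral_right) (use b S in \<open>auto simp: critical_def\<close>)
  then show "(\<Sum>v\<in>S \<union> set xs. b v + count_list xs v) = sum b S + length xs"
    using S by (simp add: sum.distrib sum_count_list)
qed

lemma ears_nonempty: "ears B K0 S0 K S c \<Longrightarrow> S0 = {} \<Longrightarrow> S = {}"
  by (induction rule: ears.induct) (auto simp: is_ear_def)

text \<open>An even ear has an odd number of inner vertices; prolonged at \<open>s\<close> to a
  neighbour \<open>u\<close> it becomes a walk as in \<open>critical_walk\<close>, which passes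
  \<open>s\<close> and so costs one copy of \<open>s\<close>. A pendant edge \<open>{u, v}\<close>
  becomes the walk \<open>w\<close>, \<open>u\<close>, \<open>v\<close>, \<open>u\<close> with an
  extra copy of \<open>u\<close>. The condition on \<open>S0\<close> provides the neighbours, which
  a one-vertex start lacks.\<close>

lemma ears_critical:
  assumes "ears B K0 S0 K S c" "K \<subseteq> E" "\<And>e. e \<in> E \<Longrightarrow> card e = 2"
    and "critical E S0 b0" "finite S0" "\<And>v. v \<in> S0 \<Longrightarrow> \<exists>x\<in>S0. x \<noteq> v"
  shows "\<exists>b. critical E S b \<and> sum b S + card S0 = sum b0 S0 + card S + c"
  using assms
proof (induction rule: ears.induct)
  case base
  then show ?case by auto
next
  case (ear K S c s xs t)
  note e = ear.hyps(2)
  have fin: "finite S" using ears_finite[OF ear.hyps(1)] ear.prems by blast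
  obtain b where b: "critical E S b" "sum b S + card S0 = sum b0 S0 + card S + c"
    using ear.IH ear.prems by auto
  have card: "card (S \<union> set xs) = card S + length xs"
    using e fin by (simp add: is_ear_def card_Un_disjoint distinct_card Int_commute)
  have st: "s \<in> S" "t \<in> S" using e by (auto simp: is_ear_def)
  show ?case
  proof (cases "even (length xs)")
    case True
    from critical_walk_sum[OF b(1) st True _ ear.prems(2) fin] ear.prems
    show ?thesis using b(2) card True by auto
  next
    case False
    have "\<exists>x\<in>S. x \<noteq> s"
    proof -
      obtain z where "z \<in> S0" using ears_nonempty[OF ear.hyps(1)] st by blast
      then show ?thesis using ear.prems(5)[of z] ears_mono[OF ear.hyps(1)] by (cases "z = s") auto
    qed
    then obtain u where u: "u \<in> S" "{u, s} \<in> E"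
      using critical_neighbour[OF b(1) st(1) _ _ ear.prems(2)] by metis
    have "path_edges (u # (s # xs) @ [t]) \<subseteq> E" using ear.prems(1) u by auto
    from critical_walk_sum[OF b(1) u(1) st(2) _ this ear.prems(2) fin] False
    obtain b' where "critical E (S \<union> set (s # xs)) b'" "sum b' (S \<union> set (s # xs)) = sum b S + length (s # xs)"
      by auto
    moreover have "S \<union> set (s # xs) = S \<union> set xs" using st by auto
    ultimately show ?thesis using b(2) card False by auto
  qed
next
  case (pend K S c u v)
  have fin: "finite S" using ears_finite[OF pend.hyps(1)] pend.prems by blast
  obtain b where b: "critical E S b" "sum b S + card S0 = sum b0 S0 + card S + c"
    using pend.IH pend.prems by auto
  have "\<exists>x\<in>S. x \<noteq> u"
  proof -
    obtain z where "z \<in> S0" using ears_nonempty[OF pend.hyps(1)] pend.hyps by blast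
    then show ?thesis using pend.prems(5)[of z] ears_mono[OF pend.hyps(1)] by (cases "z = u") auto
  qed
  then obtain w where w: "w \<in> S" "{w, u} \<in> E"
    using critical_neighbour[OF b(1) pend.hyps(2) _ _ pend.prems(2)] by metis
  have "path_edges (w # [u, v] @ [u]) \<subseteq> E" using pend.prems(1) w by (auto simp: insert_commute)
  from critical_walk_sum[OF b(1) w(1) pend.hyps(2) _ this pend.prems(2) fin]
  obtain b' where "critical E (S \<union> set [u, v]) b'" "sum b' (S \<union> set [u, v]) = sum b S + 2"
    by auto
  moreover have "S \<union> set [u, v] = insert v S" using pend.hyps by auto
  ultimately show ?case using b(2) fin pend.hyps by auto
qed

section \<open>Two-colourings and odd cycles\<close>

lemma colour_path:
  assumes "\<And>u v. {u, v} \<in> K \<Longrightarrow> f u \<noteq> (f v :: bool)" "path_edges P \<subseteq> K" "P \<noteq> []"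
  shows "f (last P) = f (hd P) \<longleftrightarrow> odd (length P)"
  using assms(2,3)
proof (induction P rule: path_edges.induct)
  case (1 x y zs)
  then show ?case using assms(1)[of x y] by auto
qed auto

lemma colour_extend:
  assumes "distinct xs" "s \<notin> set xs" "t \<notin> set xs" "f t = f s \<longleftrightarrow> odd (length xs)"
  shows "\<exists>g. (\<forall>x. x \<notin> set xs \<longrightarrow> g x = (f x :: bool)) \<and>
    (\<forall>u v. {u, v} \<in> path_edges (s # xs @ [t]) \<longrightarrow> g u \<noteq> g v)"
  using assms
proof (induction xs arbitrary: s f)
  case Nil
  then show ?case by (intro exI[of _ f]) (auto simp: doubleton_eq_iff)
next
  case (Cons x ys)
  let ?f = "f(x := \<not> f s)"
  have "?f t = ?f x \<longleftrightarrow> odd (length ys)" using Cons.prems by auto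
  then obtain g where g: "\<forall>y. y \<notin> set ys \<longrightarrow> g y = ?f y"
    "\<forall>u v. {u, v} \<in> path_edges (x # ys @ [t]) \<longrightarrow> g u \<noteq> g v"
    using Cons.IH[of x ?f] Cons.prems by auto
  have "g x = (\<not> f s)" "g s = f s" using g(1) Cons.prems by auto
  then have "\<forall>u v. {u, v} \<in> path_edges (s # (x # ys) @ [t]) \<longrightarrow> g u \<noteq> g v"
    using g(2) by (auto simp: doubleton_eq_iff)
  moreover have "\<forall>y. y \<notin> set (x # ys) \<longrightarrow> g y = f y" using g(1) by auto
  ultimately show ?case by blast
qed

text \<open>As long as the ears respect parity, the two-colouring extends. The first ear that does
  not forms an odd cycle with a path \<open>P\<close> between its ends; rerooting the older sequence
  at \<open>P\<close> makes this cycle the start, and later pieces are kept. The start itself is not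
  charged, so the cost does not grow.\<close>

theorem ears_odd_start:
  assumes "ears UNIV {} {r} K S c"
  shows "(\<exists>f :: 'v \<Rightarrow> bool. \<forall>u v. {u, v} \<in> K \<longrightarrow> f u \<noteq> f v) \<or>
    (\<exists>s xs m. m \<le> c \<and> is_ear {} {s} s xs s \<and> even (length xs) \<and>
       ears UNIV (path_edges (s # xs @ [s])) (insert s (set xs)) K (S :: 'v set) m)"
    (is "?col K \<or> ?odd K S c")
  using assms
proof (induction rule: ears.induct)
  case base
  then show ?case by auto
next
  case (ear K S c s xs t)
  note e = ear.hyps(2)
  have K: "K \<subseteq> Pow S" using ears_Pow[OF ear.hyps(1)] by simp
  consider "?col K" | "?odd K S c" using ear.IH by blast
  then show ?case
  proof cases
    case 1
    then obtain f where f: "\<And>u v. {u, v} \<in> K \<Longrightarrow> f u \<noteq> (f v :: bool)" by blast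
    obtain P m where P: "P \<noteq> []" "hd P = s" "last P = t" "distinct P"
        "ears UNIV (path_edges P) (set P) K S m" "m + of_bool (even (length P)) \<le> c"
      using ears_reroot[OF ear.hyps(1), of s t] e unfolding is_ear_def rooted_def by auto
    have PS: "set P \<subseteq> S" "path_edges P \<subseteq> K" using ears_mono[OF P(5)] by auto
    have par: "f t = f s \<longleftrightarrow> odd (length P)" using colour_path[of K f P, OF f PS(2) P(1)] P by simp
    show ?thesis
    proof (cases "even (length P + length xs - 1)")
      case True
      note cl = close_ear[OF e PS P(1-4)]
      have "ears UNIV (path_edges P \<union> path_edges (s # xs @ [t])) (set P \<union> set xs)
          (K \<union> path_edges (s # xs @ [t])) (S \<union> set xs) m"
        using ears_shift[OF P(5), of "set xs" "path_edges (s # xs @ [t])" UNIV] is_ear_disjoint[OF e K] e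
        by (auto simp: is_ear_def)
      then have "ears UNIV (path_edges (s # (tl P @ rev xs) @ [s])) (insert s (set (tl P @ rev xs)))
          (K \<union> path_edges (s # xs @ [t])) (S \<union> set xs) m"
        unfolding cl(2,3) .
      moreover have "m \<le> c + of_bool (odd (length xs))" using P(6) by simp
      moreover have "even (length (tl P @ rev xs))" unfolding cl(4) by (rule True)
      ultimately show ?thesis using cl(1) by blast
    next
      case False
      then have "f t = f s \<longleftrightarrow> odd (length xs)" using par P(1) by (cases P) auto
      then obtain g where g: "\<forall>x. x \<notin> set xs \<longrightarrow> g x = f x"
        "\<forall>u v. {u, v} \<in> path_edges (s # xs @ [t]) \<longrightarrow> g u \<noteq> g v"
        using colour_extend[of xs s t f] e by (auto simp: is_ear_def)
      have "g u \<noteq> g v" if "{u, v} \<in> K" for u v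
      proof -
        have "u \<notin> set xs" "v \<notin> set xs" using that K e by (auto simp: is_ear_def)
        then show ?thesis using g(1) f[OF that] by simp
      qed
      then have "\<forall>u v. {u, v} \<in> K \<union> path_edges (s # xs @ [t]) \<longrightarrow> g u \<noteq> g v" using g(2) by blast
      then show ?thesis by blast
    qed
  next
    case 2
    then obtain s' xs' m where o: "m \<le> c" "is_ear {} {s'} s' xs' s'" "even (length xs')"
       "ears UNIV (path_edges (s' # xs' @ [s'])) (insert s' (set xs')) K S m" by blast
    have "m + of_bool (odd (length xs)) \<le> c + of_bool (odd (length xs))" using o(1) by simp
    then show ?thesis using ears.ear[OF o(4) e] o(2,3)
      by (intro disjI2 exI[of _ s'] exI[of _ xs'] exI[of _ "m + of_bool (odd (length xs))"] conjI)
  qed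
next
  case (pend K S c u v)
  have K: "K \<subseteq> Pow S" using ears_Pow[OF pend.hyps(1)] by simp
  consider "?col K" | "?odd K S c" using pend.IH by blast
  then show ?case
  proof cases
    case 1
    then obtain f where f: "\<And>u v. {u, v} \<in> K \<Longrightarrow> f u \<noteq> (f v :: bool)" by blast
    let ?g = "f(v := \<not> f u)"
    have "?g a \<noteq> ?g b" if ab: "{a, b} \<in> insert {u, v} K" for a b
    proof (cases "{a, b} \<in> K")
      case True
      then have "a \<noteq> v" "b \<noteq> v" using K pend.hyps by auto
      then show ?thesis using f[OF True] by simp
    next
      case False
      then have "{a, b} = {u, v}" "u \<noteq> v" using ab pend.hyps by auto
      then show ?thesis by (auto simp: doubleton_eq_iff)
    qed
    then show ?thesis by blast
  next
    case 2
    then obtain s' xs' m where o: "m \<le> c" "is_ear {} {s'} s' xs' s'" "even (length xs')"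
       "ears UNIV (path_edges (s' # xs' @ [s'])) (insert s' (set xs')) K S m" by blast
    have "Suc m \<le> Suc c" using o(1) by simp
    then show ?thesis using ears.pend[OF o(4) pend.hyps(2-)] o(2,3)
      by (intro disjI2 exI[of _ s'] exI[of _ xs'] exI[of _ "Suc m"] conjI)
  qed
qed

lemma odd_cycle_iff:
  "has_odd_cycle H \<longleftrightarrow> (\<exists>s xs. is_ear {} {s} s xs s \<and> even (length xs) \<and>
     path_edges (s # xs @ [s]) \<subseteq> edges H \<and> insert s (set xs) \<subseteq> verts H)"
proof
  assume "has_odd_cycle H"
  then obtain p where p: "closed_path p" "subgraph (walk_graph p) H" "odd (card (path_edges p))"
    by (auto simp: has_odd_cycle_def cycle_graph_def walk_graph_eq)
  define xs where "xs = butlast (tl p)"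
  define s where "s = hd p"
  have pe: "p = s # xs @ [s]" using p(1) unfolding xs_def s_def closed_path_def
    by (cases p; cases "tl p") auto
  have e: "is_ear {} {s} s xs s" using p(1) pe by (auto simp: is_ear_def closed_path_def butlast_append)
  then show "\<exists>s xs. is_ear {} {s} s xs s \<and> even (length xs) \<and>
     path_edges (s # xs @ [s]) \<subseteq> edges H \<and> insert s (set xs) \<subseteq> verts H"
    using p(2,3) card_ear[OF e] pe
    by (intro exI[of _ s] exI[of _ xs]) (auto simp: subgraph_def walk_graph_eq)
next
  assume "\<exists>s xs. is_ear {} {s} s xs s \<and> even (length xs) \<and>
     path_edges (s # xs @ [s]) \<subseteq> edges H \<and> insert s (set xs) \<subseteq> verts H"
  then obtain s xs where e: "is_ear {} {s} s xs s" "even (length xs)"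
     "path_edges (s # xs @ [s]) \<subseteq> edges H" "insert s (set xs) \<subseteq> verts H" by blast
  then show "has_odd_cycle H" unfolding has_odd_cycle_def cycle_graph_def
    using is_ear_closed_or_open[OF e(1)] card_ear[OF e(1)]
    by (intro exI[of _ "walk_graph (s # xs @ [s])"])
      (auto simp: subgraph_def walk_graph_eq open_path_def)
qed

lemma connected_graph_conn:
  "connected_graph H \<Longrightarrow> u \<in> verts H \<Longrightarrow> v \<in> verts H \<Longrightarrow> (u, v) \<in> conn (edges H)"
  by (auto simp: connected_graph_def reachable_eq)

lemma simple_graph_edges:
  assumes "simple_graph H"
  shows "edges H \<subseteq> Pow (verts H)" "finite (verts H)" "\<And>e. e \<in> edges H \<Longrightarrow> card e = 2"
  using assms by (auto simp: simple_graph_def)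

lemma not_colourable_odd_cycle:
  assumes s: "simple_graph H" and c: "connected_graph H"
    and f: "\<And>f :: 'v \<Rightarrow> bool. \<exists>u v. {u, v} \<in> edges H \<and> f u = f v"
  shows "has_odd_cycle (H :: 'v graph)"
proof -
  obtain x where x: "x \<in> verts H" using c by (auto simp: connected_graph_def)
  obtain c where "ears UNIV {} {x} (edges H) (verts H) c"
    using connected_ears[OF simple_graph_edges[OF s] x connected_graph_conn[OF c]] by blast
  from ears_odd_start[OF this] obtain s xs m where
    o: "is_ear {} {s} s xs s" "even (length xs)"
      "ears UNIV (path_edges (s # xs @ [s])) (insert s (set xs)) (edges H) (verts H) m"
    using f by blast
  show ?thesis unfolding odd_cycle_iff using o ears_mono[OF o(3)] by blast
qed

theorem critical_odd_cycle:
  assumes s: "simple_graph H" and c: "connected_graph H" and E: "edges H \<noteq> {}"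
    and b: "critical (edges H) (verts H) b"
  shows "has_odd_cycle H"
proof (rule not_colourable_odd_cycle[OF s c])
  fix f :: "'a \<Rightarrow> bool"
  note sg = simple_graph_edges[OF s]
  obtain e where e: "e \<in> edges H" using E by auto
  then obtain x y where xy: "{x, y} \<in> edges H" using sg(3)[OF e] by (auto simp: card_2_iff)
  then have xyV: "x \<in> verts H" "y \<in> verts H" using sg(1) by auto
  show "\<exists>u v. {u, v} \<in> edges H \<and> f u = f v"
    using critical_not_two_colourable[OF b sg(2) xy xyV sg(3)] by blast
qed

theorem phi_psi_le_critical:
  assumes s: "simple_graph H" and c: "connected_graph H" and E: "edges H \<noteq> {}"
    and b: "critical (edges H) (verts H) b"
  shows "card (verts H) + phi_connected H + card (bridges H) \<le> sum b (verts H)"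
proof -
  obtain r where r: "r \<in> verts H" using c by (auto simp: connected_graph_def)
  show ?thesis
    using critical_imp_ears[OF simple_graph_edges[OF s] connected_graph_conn[OF c] b r]
      phi_psi_le_ears[OF s c E] by fastforce
qed

text \<open>An odd cycle is critical with weight one at each vertex, and
  \<open>ears_critical\<close> extends this along a sequence of minimal cost. The resulting total is
  at most the claimed one, and \<open>phi_psi_le_critical\<close> excludes a smaller one.\<close>

theorem critical_attains_phi_psi:
  assumes s: "simple_graph H" and c: "connected_graph H" and odd: "has_odd_cycle H"
  shows "\<exists>b. critical (edges H) (verts H) b \<and>
    sum b (verts H) = card (verts H) + phi_connected H + card (bridges H)"
proof -
  note sg = simple_graph_edges[OF s]
  obtain r where r: "r \<in> verts H" using c by (auto simp: connected_graph_def)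
  obtain s0 xs0 where o: "is_ear {} {s0} s0 xs0 s0" "even (length xs0)"
     "path_edges (s0 # xs0 @ [s0]) \<subseteq> edges H" using odd unfolding odd_cycle_iff by blast
  have E: "edges H \<noteq> {}" using o(3) by (cases xs0) auto
  obtain c0 where "ears UNIV {} {r} (edges H) (verts H) c0"
    using connected_ears[OF sg r connected_graph_conn[OF c]] by blast
  from ears_le_phi_psi[OF s c E this] obtain r c1 where
    c1: "ears UNIV {} {r} (edges H) (verts H) c1" "c1 \<le> phi_connected H + card (bridges H)" by blast
  have "\<not> (\<exists>f :: 'a \<Rightarrow> bool. \<forall>u v. {u, v} \<in> edges H \<longrightarrow> f u \<noteq> f v)"
  proof
    assume "\<exists>f :: 'a \<Rightarrow> bool. \<forall>u v. {u, v} \<in> edges H \<longrightarrow> f u \<noteq> f v"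
    then obtain f :: "'a \<Rightarrow> bool" where f: "\<And>u v. {u, v} \<in> edges H \<Longrightarrow> f u \<noteq> f v" by blast
    show False using colour_path[of "edges H" f, OF f o(3)] o(2) by simp
  qed
  with ears_odd_start[OF c1(1)] obtain s xs m where x: "m \<le> c1" "is_ear {} {s} s xs s" "even (length xs)"
    "ears UNIV (path_edges (s # xs @ [s])) (insert s (set xs)) (edges H) (verts H) m" by blast
  have sub: "path_edges (s # xs @ [s]) \<subseteq> edges H" using ears_mono[OF x(4)] by auto
  \<comment> \<open>The odd cycle is a closed walk at the single vertex \<open>s\<close>, whose
    weight is critical by the empty packing.\<close>
  have "critical (edges H) {s} (un s)"
    by (auto simp: critical_def intro!: exI[of _ "{#}"])
  from critical_walk_sum[OF this _ _ x(3) sub sg(3)] obtain b0 where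
    b0: "critical (edges H) (insert s (set xs)) b0" "sum b0 (insert s (set xs)) = 1 + length xs"
    by auto
  have card: "card (insert s (set xs)) = 1 + length xs" and l: "2 \<le> length xs"
    using x(2) by (auto simp: is_ear_def distinct_card)
  have "\<exists>y\<in>insert s (set xs). y \<noteq> v" if "v \<in> insert s (set xs)" for v
    using x(2) l by (cases xs) (auto simp: is_ear_def)
  from ears_critical[OF x(4) subset_refl sg(3) b0(1) _ this]
  obtain b where b: "critical (edges H) (verts H) b" "sum b (verts H) = card (verts H) + m"
    using b0(2) card by auto
  then show ?thesis using x(1) c1(2) phi_psi_le_critical[OF s c E b(1)] by (intro exI[of _ b]) auto
qed

section \<open>Packings of edges\<close>

definition packs :: "'v set set \<Rightarrow> ('v \<Rightarrow> nat) \<Rightarrow> nat \<Rightarrow> bool" where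
  "packs E a k \<longleftrightarrow> (\<exists>M. set_mset M \<subseteq> E \<and> size M = k \<and> (\<forall>v. deg M v \<le> a v))"

lemma packsI: "set_mset M \<subseteq> E \<Longrightarrow> size M = k \<Longrightarrow> (\<And>v. deg M v \<le> a v) \<Longrightarrow> packs E a k"
  unfolding packs_def by blast

text \<open>Following an alternating trail from \<open>y\<close> to its other end \<open>w\<close> and swapping its edges.\<close>

lemma exchange:
  assumes "\<And>e. e \<in># M1 + M2 \<Longrightarrow> card e = 2" "deg M2 y < deg M1 y"
  shows "\<exists>M1' M2' w. M1' + M2' = M1 + M2 \<and>
    ((size M2' = Suc (size M2) \<and> (\<forall>v. deg M2' v = deg M2 v + un y v + un w v) \<and>
        deg M2 w + un y w < deg M1 w) \<or>
     (size M1' = size M1 \<and> (\<forall>v. deg M1' v + un y v = deg M1 v + un w v) \<and>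
        deg M1 w < deg M2 w + un y w))"
  using assms
proof (induction "size M1" arbitrary: M1 M2 y rule: less_induct)
  case less
  have "0 < deg M1 y" using less.prems by simp
  then obtain e where "e \<in># M1" "y \<in> e" by (auto dest: deg_pos)
  moreover from this obtain v where "e = {y, v}" "v \<noteq> y"
    using less.prems(1)[of e] by (auto simp: card_2_iff; metis insert_commute)
  ultimately have v: "{y, v} \<in># M1" "v \<noteq> y" by auto
  obtain N1 where N1: "M1 = add_mset {y, v} N1" using v(1) by (metis multi_member_split)
  have d1: "deg M1 u = deg N1 u + un y u + un v u" for u
    using deg_add_edge[of y v N1 u] v(2) unfolding N1 by auto
  show ?case
  proof (cases "deg M2 v < deg M1 v")
    case True
    show ?thesis
      by (rule exI[of _ N1], rule exI[of _ "add_mset {y, v} M2"], rule exI[of _ v])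
        (use True v N1 deg_add_edge[of y v M2] in auto)
  next
    case False
    then have "0 < deg M2 v" using d1[of v] by simp
    then obtain f where "f \<in># M2" "v \<in> f" by (auto dest: deg_pos)
    moreover from this obtain x where "f = {v, x}" "x \<noteq> v"
      using less.prems(1)[of f] by (auto simp: card_2_iff; metis insert_commute)
    ultimately have x: "{v, x} \<in># M2" "x \<noteq> v" by auto
    obtain N2 where N2: "M2 = add_mset {v, x} N2" using x(1) by (metis multi_member_split)
    have d2: "deg M2 u = deg N2 u + un v u + un x u" for u
      using deg_add_edge[of v x N2 u] x(2) unfolding N2 by auto
    have a1: "deg (add_mset {v, x} A) u = deg A u + un v u + un x u" for A u
      using deg_add_edge[of v x A u] x(2) by auto
    have a2: "deg (add_mset {y, v} A) u = deg A u + un y u + un v u" for A u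
      using deg_add_edge[of y v A u] v(2) by auto
    show ?thesis
    \<comment> \<open>The negation says exactly that \<open>N1\<close> exceeds \<open>N2\<close> at
      \<open>x\<close> once both edges are removed, so the trail goes on. The summand
      \<open>un y x\<close> accounts for the first edge if the trail returns to
      \<open>y\<close>.\<close>
    proof (cases "deg M1 x < deg M2 x + un y x")
      case True
      have "deg (add_mset {v, x} N1) u + un y u = deg M1 u + un x u" for u
        unfolding a1 d1 by simp
      moreover have "size (add_mset {v, x} N1) = size M1" using N1 by simp
      moreover have "add_mset {v, x} N1 + add_mset {y, v} N2 = M1 + M2" using N1 N2 by simp
      ultimately show ?thesis using True by blast
    next
      case False
      have "deg N2 x < deg N1 x" using False d1[of x] d2[of x] x(2) by (simp split: if_splits)
      moreover have "\<And>e. e \<in># N1 + N2 \<Longrightarrow> card e = 2" using less.prems(1) N1 N2 by auto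
      ultimately obtain A1 A2 w where A: "A1 + A2 = N1 + N2" and
        c: "(size A2 = Suc (size N2) \<and> (\<forall>v. deg A2 v = deg N2 v + un x v + un w v) \<and>
            deg N2 w + un x w < deg N1 w) \<or>
          (size A1 = size N1 \<and> (\<forall>v. deg A1 v + un x v = deg N1 v + un w v) \<and>
            deg N1 w < deg N2 w + un x w)"
        using less.hyps[of N1 N2 x] N1 by (auto simp del: of_bool_eq_iff)
      let ?M1 = "add_mset {v, x} A1" and ?M2 = "add_mset {y, v} A2"
      have "?M1 + ?M2 = M1 + M2" using A N1 N2 by simp
      moreover from c have "(size ?M2 = Suc (size M2) \<and> (\<forall>u. deg ?M2 u = deg M2 u + un y u + un w u) \<and>
          deg M2 w + un y w < deg M1 w) \<or>
        (size ?M1 = size M1 \<and> (\<forall>u. deg ?M1 u + un y u = deg M1 u + un w u) \<and>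
          deg M1 w < deg M2 w + un y w)"
      proof (elim disjE conjE)
        assume "size A2 = Suc (size N2)" "\<forall>v. deg A2 v = deg N2 v + un x v + un w v"
          "deg N2 w + un x w < deg N1 w"
        then show ?thesis unfolding a1 a2 d1 d2 by (intro disjI1) (simp add: N2)
      next
        assume h: "size A1 = size N1" "\<forall>v. deg A1 v + un x v = deg N1 v + un w v"
          "deg N1 w < deg N2 w + un x w"
        have "deg A1 u + un v u + un x u + un y u = deg N1 u + un y u + un v u + un w u" for u
          using h(2) by (metis add.assoc add.commute)
        then show ?thesis using h(1,3) unfolding a1 a2 d1 d2 by (intro disjI2) (simp add: N1)
      qed
      ultimately show ?thesis by blast
    qed
  qed
qed

section \<open>Gallai's lemma for packings\<close>

definition misses :: "'v set set \<Rightarrow> ('v \<Rightarrow> nat) \<Rightarrow> nat \<Rightarrow> 'v \<Rightarrow> bool" where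
  "misses E a k v \<longleftrightarrow> (\<exists>M. set_mset M \<subseteq> E \<and> size M = k \<and> (\<forall>w. deg M w + un v w \<le> a w))"

text \<open>For \<open>u = v\<close> two copies of the same vertex have to be left over.\<close>

definition misses2 :: "'v set set \<Rightarrow> ('v \<Rightarrow> nat) \<Rightarrow> nat \<Rightarrow> 'v \<Rightarrow> 'v \<Rightarrow> bool" where
  "misses2 E a k u v \<longleftrightarrow>
    (\<exists>M. set_mset M \<subseteq> E \<and> size M = k \<and> (\<forall>w. deg M w + un u w + un v w \<le> a w))"

text \<open>Gallai's lemma, in contrapositive form: ``no maximum packing misses both'' is transitive.\<close>

lemma misses2_trans:
  assumes E: "\<And>e. e \<in> E \<Longrightarrow> card e = 2" and max: "\<not> packs E a (Suc k)"
    and y: "misses E a k y" and xz: "misses2 E a k x z"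
  shows "misses2 E a k x y \<or> misses2 E a k y z"
proof (rule ccontr)
  assume neg: "\<not> ?thesis"
  obtain M1 where M1: "set_mset M1 \<subseteq> E" "size M1 = k" "\<And>w. deg M1 w + un x w + un z w \<le> a w"
    using xz unfolding misses2_def by blast
  obtain M2 where M2: "set_mset M2 \<subseteq> E" "size M2 = k" "\<And>w. deg M2 w + un y w \<le> a w"
    using y unfolding misses_def by blast
  have yxz: "y \<noteq> x" "y \<noteq> z" using neg xz by auto
  have "deg M1 y = a y"
  proof (rule ccontr)
    assume ne: "deg M1 y \<noteq> a y"
    have "deg M1 w + un x w + un y w \<le> a w" for w
      using M1(3)[of w] M1(3)[of y] ne yxz by (cases "w = y") auto
    then show False using neg M1(1,2) unfolding misses2_def by blast
  qed
  then have "deg M2 y < deg M1 y" using M2(3)[of y] by simp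
  moreover have "card e = 2" if "e \<in># M1 + M2" for e using that E M1(1) M2(1) by auto
  ultimately obtain A1 A2 w where A: "A1 + A2 = M1 + M2" and
    c: "(size A2 = Suc (size M2) \<and> (\<forall>v. deg A2 v = deg M2 v + un y v + un w v) \<and>
        deg M2 w + un y w < deg M1 w) \<or>
     (size A1 = size M1 \<and> (\<forall>v. deg A1 v + un y v = deg M1 v + un w v) \<and>
        deg M1 w < deg M2 w + un y w)" using exchange[of M1 M2 y] by blast
  have "set_mset (A1 + A2) \<subseteq> E" unfolding A using M1 M2 by simp
  then have AE: "set_mset A1 \<subseteq> E" "set_mset A2 \<subseteq> E" by auto
  from c show False
  proof (elim disjE conjE)
    assume h: "size A2 = Suc (size M2)" "\<forall>v. deg A2 v = deg M2 v + un y v + un w v"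
      "deg M2 w + un y w < deg M1 w"
    have "deg A2 v \<le> a v" for v
      using h(2,3) M1(3)[of v] M2(3)[of v] by (cases "v = w") auto
    then show False using max AE(2) h(1) M2(2) by (auto intro: packsI)
  next
    assume h: "size A1 = size M1" "\<forall>v. deg A1 v + un y v = deg M1 v + un w v"
      "deg M1 w < deg M2 w + un y w"
    \<comment> \<open>The swapped packing frees a copy of \<open>y\<close> and uses one more copy of
      \<open>w\<close>. At most one of the spare copies of \<open>x\<close> and \<open>z\<close> is
      consumed, so \<open>y\<close> is missed together with the other.\<close>
    consider "w = x" | "w \<noteq> x" by blast
    then show False
    proof cases
      case 1
      have "deg A1 v + un y v + un z v \<le> a v" for v
        using h(2)[rule_format, of v] M1(3)[of v] 1 by simp
      then show False using neg AE(1) h(1) M1(2) unfolding misses2_def by blast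
    next
      case 2
      have "deg A1 v + un x v + un y v \<le> a v" for v
        using h(2)[rule_format, of v] h(3) M1(3)[of v] M2(3)[of v] 2 by (cases "v = w") auto
      then show False using neg AE(1) h(1) M1(2) unfolding misses2_def by blast
    qed
  qed
qed

lemma not_misses2_edge:
  assumes E: "\<And>e. e \<in> E \<Longrightarrow> card e = 2" and max: "\<not> packs E a (Suc k)" and e: "{u, v} \<in> E"
  shows "\<not> misses2 E a k u v"
proof
  assume "misses2 E a k u v"
  then obtain M where M: "set_mset M \<subseteq> E" "size M = k" "\<And>w. deg M w + un u w + un v w \<le> a w"
    unfolding misses2_def by blast
  have "u \<noteq> v" using E[OF e] by auto
  then have "deg (add_mset {u, v} M) w \<le> a w" for w using M(3)[of w] deg_add_edge[of u v M w] by simp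
  then show False using max M e packsI[of "add_mset {u, v} M" E "Suc k" a] by simp
qed

text \<open>Transitivity is applied along a path. The base case, that two copies of \<open>u\<close>
  itself are never left over together, is not automatic: it follows by passing through a
  neighbour.\<close>

lemma not_misses2_conn:
  assumes E: "\<And>e. e \<in> E \<Longrightarrow> card e = 2" and max: "\<not> packs E a (Suc k)"
    and W: "\<And>v. v \<in> W \<Longrightarrow> misses E a k v" "\<And>v. v \<in> W \<Longrightarrow> \<exists>w\<in>W. {v, w} \<in> E"
    and uv: "(u, v) \<in> conn {e\<in>E. e \<subseteq> W}" "u \<in> W"
  shows "\<not> misses2 E a k u v"
  using uv
proof (induction rule: conn_induct)
  case refl
  obtain y where y: "y \<in> W" "{u, y} \<in> E" using W(2) uv by blast
  then show ?case
    using misses2_trans[OF E max W(1)[OF y(1)], of u u] not_misses2_edge[OF E max, of u y]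
      not_misses2_edge[OF E max, of y u] by (auto simp: insert_commute)
next
  case (step y z)
  then have "y \<in> W" by auto
  then show ?case
    using misses2_trans[OF E max W(1), of y u z] not_misses2_edge[OF E max, of y z] step uv by auto
qed

text \<open>If every packing of \<open>k\<close> edges uses up all copies of \<open>v\<close>,
  deleting one copy of \<open>v\<close> lowers the bound to \<open>k - 1\<close>. The domination
  property survives because an edge at \<open>v\<close> can be removed from each larger packing. The
  total weight drops, so the process ends.\<close>

lemma reduce_to_missed:
  assumes E: "\<And>e. e \<in> E \<Longrightarrow> card e = 2" "E \<subseteq> Pow Y" "finite Y"
    and a: "\<And>v. v \<notin> Y \<Longrightarrow> a v = 0" "\<not> packs E a (Suc k)"
      "\<And>i. i \<in> Y \<Longrightarrow> packs E (\<lambda>v. a v + un i v) (Suc k)"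
  shows "\<exists>a' k'. k' \<le> k \<and> (\<forall>v. v \<notin> Y \<longrightarrow> a' v = 0) \<and> \<not> packs E a' (Suc k') \<and>
    (\<forall>i\<in>Y. packs E (\<lambda>v. a' v + un i v) (Suc k')) \<and> (\<forall>v. 0 < a' v \<longrightarrow> misses E a' k' v)"
  using a
proof (induction "sum a Y" arbitrary: a k rule: less_induct)
  case less
  show ?case
  proof (cases "\<forall>v. 0 < a v \<longrightarrow> misses E a k v")
    case True
    then show ?thesis using less.prems by blast
  next
    case False
    then obtain v where v: "0 < a v" "\<not> misses E a k v" by blast
    have vY: "v \<in> Y" using less.prems(1)[of v] v(1) by auto
    let ?a = "\<lambda>u. a u - un v u"
    have k: "0 < k"
    proof (rule ccontr)
      assume "\<not> 0 < k"
      then have "misses E a k v" unfolding misses_def using v(1) by (intro exI[of _ "{#}"]) auto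
      then show False using v by blast
    qed
    have "sum ?a Y < sum a Y" using vY E(3) v(1) by (intro sum_strict_mono_ex1) auto
    moreover have "\<not> packs E ?a (Suc (k - 1))"
    proof
      assume "packs E ?a (Suc (k - 1))"
      then obtain M where M: "set_mset M \<subseteq> E" "size M = k" "\<And>u. deg M u \<le> a u - un v u"
        using k by (auto simp: packs_def)
      have "deg M u + un v u \<le> a u" for u using M(3)[of u] v(1) by (cases "u = v") auto
      then show False using v(2) M(1,2) unfolding misses_def by blast
    qed
    moreover have "packs E (\<lambda>u. ?a u + un i u) (Suc (k - 1))" if i: "i \<in> Y" for i
    proof -
      obtain M where M: "set_mset M \<subseteq> E" "size M = Suc k" "\<And>u. deg M u \<le> a u + un i u"
        using less.prems(3)[OF i] by (auto simp: packs_def)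
      obtain e where e: "e \<in># M" "0 < deg M v \<longrightarrow> v \<in> e"
      proof (cases "0 < deg M v")
        case True
        then show ?thesis using deg_pos[of M v] that by blast
      next
        case False
        then show ?thesis using M(2) that by (cases M) auto
      qed
      obtain N where N: "M = add_mset e N" using e(1) by (metis multi_member_split)
      have "deg N u \<le> ?a u + un i u" for u
        using M(3)[of u] e(2) v(1) unfolding N by (cases "u = v") auto
      then show ?thesis using M N k by (intro packsI[of N]) auto
    qed
    ultimately obtain a' k' where "k' \<le> k - 1" "\<forall>v. v \<notin> Y \<longrightarrow> a' v = 0" "\<not> packs E a' (Suc k')"
      "\<forall>i\<in>Y. packs E (\<lambda>v. a' v + un i v) (Suc k')" "\<forall>v. 0 < a' v \<longrightarrow> misses E a' k' v"
      using less.hyps[of ?a "k - 1"] less.prems(1) by auto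
    then show ?thesis by (intro exI[of _ a'] exI[of _ k']) auto
  qed
qed

lemma two_deficits:
  assumes "finite C" "\<And>v. v \<in> C \<Longrightarrow> f v \<le> g v" "sum f C + 2 \<le> (sum g C :: nat)"
  shows "\<exists>u\<in>C. \<exists>v\<in>C. \<forall>w\<in>C. f w + un u w + un v w \<le> g w"
proof -
  have ex: "\<exists>u\<in>C. h u < g u" if "sum h C < sum g C" for h
    using that sum_mono[of C g h] by (meson not_le)
  obtain u where u: "u \<in> C" "f u < g u" using ex[of f] assms by auto
  have "sum (\<lambda>w. f w + un u w) C = sum f C + 1"
    using u assms(1) by (simp add: sum.distrib of_bool_def)
  then obtain v where v: "v \<in> C" "f v + un u v < g v" using ex[of "\<lambda>w. f w + un u w"] assms by auto
  have "f w + un u w + un v w \<le> g w" if "w \<in> C" for w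
    using assms(2)[OF that] u v by (cases "w = u"; cases "w = v") auto
  then show ?thesis using u v by blast
qed

section \<open>Weights on the components of a vertex set\<close>

definition comp_classes :: "'v set set \<Rightarrow> 'v set \<Rightarrow> 'v set set" where
  "comp_classes E W = W // reachable (Graph W {e \<in> E. e \<subseteq> W})"

lemma classes_partition:
  shows "\<Union>(comp_classes E W) = W"
    and "C \<in> comp_classes E W \<Longrightarrow> D \<in> comp_classes E W \<Longrightarrow> C \<noteq> D \<Longrightarrow> C \<inter> D = {}"
    and "C \<in> comp_classes E W \<Longrightarrow> C \<subseteq> W" and "C \<in> comp_classes E W \<Longrightarrow> C \<noteq> {}"
    and "finite W \<Longrightarrow> finite (comp_classes E W)"
    and "C \<in> comp_classes E W \<Longrightarrow> u \<in> C \<Longrightarrow> v \<in> C \<Longrightarrow> (u, v) \<in> conn {e \<in> E. e \<subseteq> W}"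
    and "C \<in> comp_classes E W \<Longrightarrow> u \<in> C \<Longrightarrow> v \<in> W \<Longrightarrow> (u, v) \<in> conn {e \<in> E. e \<subseteq> W} \<Longrightarrow> v \<in> C"
proof -
  let ?R = "reachable (Graph W {e \<in> E. e \<subseteq> W})"
  have eq: "equiv W ?R" using equiv_reachable[of "Graph W {e \<in> E. e \<subseteq> W}"] by simp
  show U: "\<Union>(comp_classes E W) = W" unfolding comp_classes_def by (rule Union_quotient[OF eq])
  show "C \<in> comp_classes E W \<Longrightarrow> D \<in> comp_classes E W \<Longrightarrow> C \<noteq> D \<Longrightarrow> C \<inter> D = {}"
    unfolding comp_classes_def using quotient_disj[OF eq] by blast
  show "C \<in> comp_classes E W \<Longrightarrow> C \<subseteq> W" using U by blast
  show "C \<in> comp_classes E W \<Longrightarrow> C \<noteq> {}" unfolding comp_classes_def using in_quotient_imp_non_empty[OF eq] by blast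
  show "finite W \<Longrightarrow> finite (comp_classes E W)"
    unfolding comp_classes_def by (rule finite_quotient) (auto simp: reachable_eq)
  show "C \<in> comp_classes E W \<Longrightarrow> u \<in> C \<Longrightarrow> v \<in> C \<Longrightarrow> (u, v) \<in> conn {e \<in> E. e \<subseteq> W}"
    unfolding comp_classes_def using in_quotient_imp_in_rel[OF eq, of C u v] by (auto simp: reachable_eq)
  show "v \<in> C" if "C \<in> comp_classes E W" "u \<in> C" "v \<in> W" "(u, v) \<in> conn {e \<in> E. e \<subseteq> W}"
  proof -
    have "u \<in> W" using that U by blast
    then have "(u, v) \<in> ?R" using that by (auto simp: reachable_eq)
    then show ?thesis
      using in_quotient_imp_closed[OF eq that(1)[unfolded comp_classes_def] that(2)] by blast
  qed
qed

lemma sum_classes: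
  assumes "finite W"
  shows "sum f W = (\<Sum>C\<in>comp_classes E W. sum f C)"
proof -
  have "sum f (\<Union>(comp_classes E W)) = (\<Sum>C\<in>comp_classes E W. sum f C)"
    using sum.Union_disjoint[of "comp_classes E W" f] classes_partition(2,3) assms
    by (metis (no_types, lifting) comp_apply finite_subset sum.cong)
  then show ?thesis by (simp add: classes_partition(1))
qed

definition restrict_to :: "'v set \<Rightarrow> ('v \<Rightarrow> nat) \<Rightarrow> 'v \<Rightarrow> nat" where
  "restrict_to C b v = (if v \<in> C then b v else 0)"

text \<open>\<open>W\<close> is the support of a reduced weight. An extra copy of \<open>i\<close>
  helps only through an edge \<open>{i, j}\<close> with \<open>j\<close> in \<open>W\<close>, so
  \<open>W\<close> dominates \<open>Y\<close>. Two vertices of one component are never missed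
  together; hence a packing missing \<open>x\<close> uses up everything else in the component of
  \<open>x\<close>, which is criticality. For the same reason a packing of \<open>n\<close> edges
  leaves at most one copy over in each component, which bounds the total.\<close>

theorem dominating_imp_critical:
  assumes E: "\<And>e. e \<in> E \<Longrightarrow> card e = 2" "E \<subseteq> Pow Y" "finite Y"
    and max: "\<not> packs E a (Suc k)" and dom: "\<And>i. i \<in> Y \<Longrightarrow> packs E (\<lambda>v. a v + un i v) (Suc k)"
  shows "\<exists>W b. W \<subseteq> Y \<and> (\<forall>i\<in>Y. \<exists>j\<in>W. {i, j} \<in> E) \<and>
    (\<forall>C\<in>comp_classes E W. critical E C (restrict_to C b)) \<and> sum b W \<le> 2 * k + card (comp_classes E W)"
proof -
  have deg0: "deg M v = 0" if "set_mset M \<subseteq> E" "v \<notin> Y" for M v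
    using that E(2) deg_pos[of M v] by blast
  have "\<not> packs E (restrict_to Y a) (Suc k)"
  proof
    assume "packs E (restrict_to Y a) (Suc k)"
    then obtain M where M: "set_mset M \<subseteq> E" "size M = Suc k" "\<And>v. deg M v \<le> restrict_to Y a v"
      by (auto simp: packs_def)
    have "deg M v \<le> a v" for v using M(3)[of v] by (auto simp: restrict_to_def split: if_splits)
    then show False using max M(1,2) by (auto intro: packsI)
  qed
  moreover have "packs E (\<lambda>v. restrict_to Y a v + un i v) (Suc k)" if i: "i \<in> Y" for i
  proof -
    obtain M where M: "set_mset M \<subseteq> E" "size M = Suc k" "\<And>v. deg M v \<le> a v + un i v"
      using dom[OF i] by (auto simp: packs_def)
    have "deg M v \<le> restrict_to Y a v + un i v" for v
      using M(3)[of v] deg0[OF M(1), of v] by (auto simp: restrict_to_def)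
    then show ?thesis using M(1,2) by (auto intro: packsI)
  qed
  moreover have "restrict_to Y a v = 0" if "v \<notin> Y" for v using that by (simp add: restrict_to_def)
  ultimately obtain b n where b': "n \<le> k" "\<forall>v. v \<notin> Y \<longrightarrow> b v = 0" "\<not> packs E b (Suc n)"
    "\<forall>i\<in>Y. packs E (\<lambda>v. b v + un i v) (Suc n)" "\<forall>v. 0 < b v \<longrightarrow> misses E b n v"
    using reduce_to_missed[OF E, of "restrict_to Y a" k] by blast
  have b: "n \<le> k" "\<And>v. v \<notin> Y \<Longrightarrow> b v = 0" "\<not> packs E b (Suc n)"
    "\<And>i. i \<in> Y \<Longrightarrow> packs E (\<lambda>v. b v + un i v) (Suc n)" "\<And>v. 0 < b v \<Longrightarrow> misses E b n v"
    using b' by blast+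
  define W where "W = {v. 0 < b v}"
  have WY: "W \<subseteq> Y" using b(2) by (auto simp: W_def) (metis less_numeral_extra(3))
  then have finW: "finite W" using E(3) finite_subset by blast
  have nb: "\<exists>j\<in>W. {i, j} \<in> E" if i: "i \<in> Y" for i
  proof -
    obtain M where M: "set_mset M \<subseteq> E" "size M = Suc n" "\<And>v. deg M v \<le> b v + un i v"
      using b(4)[OF i] by (auto simp: packs_def)
    have "0 < deg M i"
    proof (rule ccontr)
      assume "\<not> 0 < deg M i"
      then have "deg M v \<le> b v" for v using M(3)[of v] by (cases "v = i") auto
      then show False using b(3) M(1,2) by (auto intro: packsI)
    qed
    then obtain e where "e \<in># M" "i \<in> e" by (auto dest: deg_pos)
    moreover from this obtain j where "e = {i, j}" "j \<noteq> i"
      using E(1)[of e] M(1) by (auto simp: card_2_iff; metis insert_commute subsetD)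
    ultimately have j: "{i, j} \<in># M" "j \<noteq> i" by auto
    have "0 < deg M j" by (rule deg_posI[OF j(1)]) simp
    then have "0 < b j" using M(3)[of j] j(2) by simp
    then show ?thesis using j M(1) by (auto simp: W_def)
  qed
  have nm2: "\<not> misses2 E b n u v" if "C \<in> comp_classes E W" "u \<in> C" "v \<in> C" for C u v
  proof (rule not_misses2_conn[OF E(1) b(3)])
    show "misses E b n v" if "v \<in> W" for v using that b(5) by (simp add: W_def)
    show "\<exists>w\<in>W. {v, w} \<in> E" if "v \<in> W" for v using that nb WY by blast
    show "(u, v) \<in> conn {e \<in> E. e \<subseteq> W}" by (rule classes_partition(6)[OF that])
    show "u \<in> W" using classes_partition(3)[OF that(1)] that(2) by blast
  qed
  have crit: "critical E C (restrict_to C b)" if C: "C \<in> comp_classes E W" for C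
    unfolding critical_def
  proof (intro conjI allI ballI)
    show "(0 < restrict_to C b v) = (v \<in> C)" for v
      using classes_partition(3)[OF C] by (auto simp: restrict_to_def W_def)
    fix x assume x: "x \<in> C"
    then have xW: "x \<in> W" using classes_partition(3)[OF C] by blast
    then obtain M where M: "set_mset M \<subseteq> E" "size M = n" "\<And>w. deg M w + un x w \<le> b w"
      using b(5) unfolding misses_def W_def by blast
    have sat: "deg M u + un x u = b u" if u: "u \<in> C" for u
    proof (rule ccontr)
      assume ne: "deg M u + un x u \<noteq> b u"
      have "deg M w + un x w + un u w \<le> b w" for w using M(3)[of w] ne by (cases "w = u") auto
      then show False using nm2[OF C x u] M(1,2) unfolding misses2_def by blast
    qed
    \<comment> \<open>Edges of \<open>M\<close> have both ends in the support \<open>W\<close>, so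
      an edge meeting the component \<open>C\<close> lies inside it, and the filter loses nothing at
      vertices of \<open>C\<close>.\<close>
    let ?N = "filter_mset (\<lambda>e. e \<subseteq> C) M"
    have "deg ?N u + un x u = restrict_to C b u" for u
    proof (cases "u \<in> C")
      case True
      have "e \<subseteq> C" if e: "e \<in># M" "u \<in> e" for e
      proof
        fix v assume v: "v \<in> e"
        have eW: "e \<subseteq> W"
        proof
          fix w assume "w \<in> e"
          then have "0 < deg M w" using deg_posI[OF e(1)] by blast
          then show "w \<in> W" using M(3)[of w] by (simp add: W_def)
        qed
        obtain p q where pq: "e = {p, q}" using E(1)[of e] M(1) e(1) by (auto simp: card_2_iff)
        have "(u, v) \<in> conn {e \<in> E. e \<subseteq> W}"
          using pq e v M(1) eW by (cases "u = v") (auto intro!: conn_edge simp: insert_commute)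
        then show "v \<in> C" using classes_partition(7)[OF C True] eW v by blast
      qed
      then have "deg ?N u = deg M u" unfolding deg_def filter_filter_mset
        by (intro arg_cong[of _ _ size] filter_mset_cong) auto
      then show ?thesis using sat[OF True] True by (simp add: restrict_to_def)
    next
      case False
      then have "deg ?N u = 0" using deg_pos[of ?N u] by auto
      then show ?thesis using False x by (auto simp: restrict_to_def)
    qed
    then show "\<exists>M. set_mset M \<subseteq> E \<and> (\<forall>v. deg M v + un x v = restrict_to C b v)"
      using M(1) by (intro exI[of _ ?N]) auto
  qed
  have "sum b W \<le> 2 * k + card (comp_classes E W)"
  proof (cases "W = {}")
    case False
    then obtain x where "x \<in> W" by blast
    then obtain M where M: "set_mset M \<subseteq> E" "size M = n" "\<And>w. deg M w + un x w \<le> b w"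
      using b(5) unfolding misses_def W_def by blast
    have le: "deg M w \<le> b w" for w using M(3)[of w] by simp
    have "sum b C \<le> sum (deg M) C + 1" if C: "C \<in> comp_classes E W" for C
    proof (rule ccontr)
      assume "\<not> sum b C \<le> sum (deg M) C + 1"
      moreover have "finite C" using classes_partition(3)[OF C] finW finite_subset by blast
      ultimately obtain u v where uv: "u \<in> C" "v \<in> C" "\<And>w. w \<in> C \<Longrightarrow> deg M w + un u w + un v w \<le> b w"
        using two_deficits[of C "deg M" b] le by auto
      have "deg M w + un u w + un v w \<le> b w" for w
        using uv le[of w] by (cases "w \<in> C") auto
      then show False using nm2[OF C uv(1,2)] M(1,2) unfolding misses2_def by blast
    qed
    then have "sum b W \<le> (\<Sum>C\<in>comp_classes E W. sum (deg M) C + 1)"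
      unfolding sum_classes[OF finW, of b E] by (rule sum_mono)
    also have "\<dots> = sum (deg M) W + card (comp_classes E W)"
      by (simp add: sum.distrib sum_Suc sum_classes[OF finW, of "deg M" E])
    also have "sum (deg M) W = 2 * size M"
    proof (rule handshake[OF finW])
      fix e assume e: "e \<in># M"
      have "e \<subseteq> W"
      proof
        fix w assume "w \<in> e"
        then have "0 < deg M w" using deg_posI[OF e] by blast
        then show "w \<in> W" using le[of w] by (simp add: W_def)
      qed
      then show "e \<subseteq> W \<and> card e = 2" using E(1) M(1) e by auto
    qed
    finally show ?thesis using M(2) b(1) by simp
  qed simp
  then show ?thesis using WY nb crit by blast
qed

lemma deg_sum: "deg (\<Sum>C\<in>Q. F C) v = (\<Sum>C\<in>Q. deg (F C) v)"
  by (induction Q rule: infinite_finite_induct) auto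

lemma size_sum: "size (\<Sum>C\<in>Q. F C :: 'b multiset) = (\<Sum>C\<in>Q. size (F C))"
  by (induction Q rule: infinite_finite_induct) auto

lemma set_sum_subset: "(\<And>C. C \<in> Q \<Longrightarrow> set_mset (F C) \<subseteq> E) \<Longrightarrow> set_mset (\<Sum>C\<in>Q. F C) \<subseteq> E"
  by (induction Q rule: infinite_finite_induct) auto

lemma packs_critical_upper:
  assumes E: "\<And>e. e \<in> E \<Longrightarrow> card e = 2" and W: "finite W"
    and b: "\<And>C. C \<in> comp_classes E W \<Longrightarrow> critical E C (restrict_to C b)"
    and n: "sum b W = 2 * n + card (comp_classes E W)"
  shows "\<not> packs {e \<in> E. e \<subseteq> W} b (Suc n)"
proof
  assume "packs {e \<in> E. e \<subseteq> W} b (Suc n)"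
  then obtain M where M: "set_mset M \<subseteq> {e \<in> E. e \<subseteq> W}" "size M = Suc n" "\<And>v. deg M v \<le> b v"
    by (auto simp: packs_def)
  have "sum (deg M) C + 1 \<le> sum b C" if C: "C \<in> comp_classes E W" for C
  proof -
    have fin: "finite C" using classes_partition(3)[OF C] W finite_subset by blast
    have card02: "even (card (C \<inter> e))" if "e \<in># M" for e
    proof (cases "C \<inter> e = {}")
      case False
      then obtain u where u: "u \<in> C" "u \<in> e" by blast
      have e: "e \<in> E" "e \<subseteq> W" using that M(1) by auto
      obtain p q where pq: "e = {p, q}" using E[OF e(1)] by (auto simp: card_2_iff)
      have "v \<in> C" if "v \<in> e" for v
      proof -
        have "(u, v) \<in> conn {e \<in> E. e \<subseteq> W}"
          using pq e u that by (cases "u = v") (auto intro!: conn_edge simp: insert_commute)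
        then show ?thesis using classes_partition(7)[OF C u(1)] e that by blast
      qed
      then have "C \<inter> e = e" by blast
      then show ?thesis using E[OF e(1)] by simp
    qed simp
    have "even (\<Sum>e\<in>#M. card (C \<inter> e))" using card02 by (induction M) auto
    then have ev: "even (sum (deg M) C)" using sum_deg[OF fin, of M] by simp
    obtain x where x: "x \<in> C" using classes_partition(4)[OF C] by blast
    obtain N where N: "set_mset N \<subseteq> E" "\<And>v. deg N v + un x v = restrict_to C b v"
      "\<And>e. e \<in># N \<Longrightarrow> e \<subseteq> C" by (rule criticalE[OF b[OF C] x], rule that)
    have "sum b C = sum (restrict_to C b) C" by (simp add: restrict_to_def)
    then have "odd (sum b C)" using critical_size[OF b[OF C] fin x E N] by simp
    moreover have "sum (deg M) C \<le> sum b C" using M(3) by (rule sum_mono)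
    ultimately show ?thesis using ev by (metis Suc_eq_plus1 Suc_leI le_neq_implies_less)
  qed
  then have "(\<Sum>C\<in>comp_classes E W. sum (deg M) C + 1) \<le> sum b W"
    unfolding sum_classes[OF W, of b E] by (rule sum_mono)
  then have "sum (deg M) W + card (comp_classes E W) \<le> sum b W"
    by (simp add: sum.distrib sum_Suc sum_classes[OF W, of "deg M" E])
  moreover have "sum (deg M) W = 2 * size M"
    using handshake[OF W, of M] M(1) E by auto
  ultimately show False using n M(2) by simp
qed

text \<open>One packing is taken from each component: the one missing \<open>w\<close> in the
  component of \<open>w\<close>, elsewhere one missing an arbitrary vertex.\<close>

lemma misses_critical:
  assumes E: "\<And>e. e \<in> E \<Longrightarrow> card e = 2" and W: "finite W" "w \<in> W"
    and b: "\<And>C. C \<in> comp_classes E W \<Longrightarrow> critical E C (restrict_to C b)"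
    and n: "sum b W = 2 * n + card (comp_classes E W)"
  shows "misses {e \<in> E. e \<subseteq> W} b n w"
proof -
  let ?Q = "comp_classes E W"
  have "\<exists>x N. x \<in> C \<and> (w \<in> C \<longrightarrow> x = w) \<and> set_mset N \<subseteq> E \<and>
      (\<forall>v. deg N v + un x v = restrict_to C b v) \<and> (\<forall>e. e \<in># N \<longrightarrow> e \<subseteq> C)"
    if C: "C \<in> ?Q" for C
  proof -
    obtain x where x: "x \<in> C" "w \<in> C \<longrightarrow> x = w"
      using classes_partition(4)[OF C] by (cases "w \<in> C") auto
    obtain N where "set_mset N \<subseteq> E" "\<And>v. deg N v + un x v = restrict_to C b v"
      "\<And>e. e \<in># N \<Longrightarrow> e \<subseteq> C" by (rule criticalE[OF b[OF C] x(1)], rule that)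
    then show ?thesis using x by blast
  qed
  then obtain X F where XF: "\<And>C. C \<in> ?Q \<Longrightarrow> X C \<in> C \<and> (w \<in> C \<longrightarrow> X C = w) \<and> set_mset (F C) \<subseteq> E \<and>
      (\<forall>v. deg (F C) v + un (X C) v = restrict_to C b v) \<and> (\<forall>e. e \<in># F C \<longrightarrow> e \<subseteq> C)"
    by metis
  let ?M = "\<Sum>C\<in>?Q. F C"
  have finQ: "finite ?Q" by (rule classes_partition(5)[OF W(1)])
  have "set_mset ?M \<subseteq> {e \<in> E. e \<subseteq> W}"
  proof (rule set_sum_subset)
    fix C assume C: "C \<in> ?Q"
    then show "set_mset (F C) \<subseteq> {e \<in> E. e \<subseteq> W}"
      using XF[OF C] classes_partition(3)[OF C] by blast
  qed
  moreover have "size ?M = n"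
  proof -
    have "sum b C = 2 * size (F C) + 1" if C: "C \<in> ?Q" for C
    proof -
      have fin: "finite C" using classes_partition(3)[OF C] W finite_subset by blast
      have "sum b C = sum (restrict_to C b) C" by (simp add: restrict_to_def)
      then show ?thesis using critical_size[OF b[OF C] fin _ E, of "X C" "F C"] XF[OF C] by auto
    qed
    then have "sum b W = (\<Sum>C\<in>?Q. 2 * size (F C) + 1)"
      unfolding sum_classes[OF W(1), of b E] by (rule sum.cong[OF refl])
    also have "\<dots> = 2 * size ?M + card ?Q" by (simp add: sum.distrib sum_Suc size_sum sum_distrib_left)
    finally show ?thesis using n by simp
  qed
  moreover have "deg ?M v + un w v \<le> b v" for v
  proof (cases "v \<in> W")
    case True
    then obtain C where C: "C \<in> ?Q" "v \<in> C" using classes_partition(1)[of E W] by blast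
    have "deg (F D) v = 0" if D: "D \<in> ?Q" "D \<noteq> C" for D
    proof (rule ccontr)
      assume "deg (F D) v \<noteq> 0"
      then obtain e where "e \<in># F D" "v \<in> e" using deg_pos[of "F D" v] by auto
      then have "v \<in> D" using XF[OF D(1)] by blast
      then show False using classes_partition(2)[OF D(1) C(1) D(2)] C(2) by blast
    qed
    then have "deg ?M v = deg (F C) v"
      unfolding deg_sum using sum.remove[OF finQ C(1), of "\<lambda>D. deg (F D) v"] by simp
    moreover have "deg (F C) v + un (X C) v = b v" using XF[OF C(1)] C(2) by (simp add: restrict_to_def)
    moreover have "un w v \<le> un (X C) v" using XF[OF C(1)] C(2) by auto
    ultimately show ?thesis by linarith
  next
    case False
    then have "deg ?M v = 0" using \<open>set_mset ?M \<subseteq> _\<close> deg_pos[of ?M v] by blast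
    then show ?thesis using False W by auto
  qed
  ultimately show ?thesis unfolding misses_def by blast
qed

section \<open>Monomial ideals\<close>

abbreviation keys :: "('a \<Rightarrow>\<^sub>0 'b::zero) \<Rightarrow> 'a set" where
  "keys \<equiv> Poly_Mapping.keys"

abbreviation lookup :: "('a \<Rightarrow>\<^sub>0 'b::zero) \<Rightarrow> 'a \<Rightarrow> 'b" where
  "lookup \<equiv> Poly_Mapping.lookup"

abbreviation single :: "'a \<Rightarrow> 'b::zero \<Rightarrow> 'a \<Rightarrow>\<^sub>0 'b" where
  "single \<equiv> Poly_Mapping.single"

lemma sum_single: "(\<Sum>m\<in>keys p. single m (lookup p m)) = p"
  by (rule poly_mapping_eqI) (auto simp: lookup_sum lookup_single when_def in_keys_iff)

definition part :: "('a \<Rightarrow> bool) \<Rightarrow> ('a \<Rightarrow>\<^sub>0 'b::comm_monoid_add) \<Rightarrow> 'a \<Rightarrow>\<^sub>0 'b" where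
  "part A p = (\<Sum>m\<in>{m\<in>keys p. A m}. single m (lookup p m))"

lemma lookup_part: "lookup (part A p) m = (if A m then lookup p m else 0)"
  by (auto simp: part_def lookup_sum lookup_single when_def in_keys_iff)

lemma keys_part: "keys (part A p) = {m \<in> keys p. A m}"
  by (auto simp: in_keys_iff lookup_part split: if_splits)

lemma part_add_part: "part A p + part (\<lambda>m. \<not> A m) p = p"
  by (rule poly_mapping_eqI) (simp add: lookup_add lookup_part)

lemma lookup_mult_unique:
  fixes f g :: "'a::comm_monoid_add \<Rightarrow>\<^sub>0 'b::comm_semiring_0"
  assumes "\<And>m n. m \<in> keys f \<Longrightarrow> n \<in> keys g \<Longrightarrow> m + n = m0 + n0 \<Longrightarrow> m = m0 \<and> n = n0"
    and "m0 \<in> keys f"  "n0 \<in> keys g"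
  shows "lookup (f * g) (m0 + n0) = lookup f m0 * lookup g n0"
proof -
  have "lookup f l * (\<Sum>q. lookup g q when m0 + n0 = l + q) = (lookup f m0 * lookup g n0 when l = m0)" for l
  proof (cases "l \<in> keys f")
    case True
    have "(lookup g q when m0 + n0 = l + q) = ((lookup g n0 when l = m0) when q = n0)" for q
    proof (cases "q \<in> keys g \<and> m0 + n0 = l + q")
      case True
      then have "l = m0" "q = n0" using assms(1)[OF \<open>l \<in> keys f\<close>, of q] by auto
      then show ?thesis by simp
    next
      case False
      then have "\<not> (l = m0 \<and> q = n0)" using assms(3) by auto
      moreover have "(lookup g q when m0 + n0 = l + q) = 0"
        using False by (metis in_keys_iff when_simps(2) zero_when)
      ultimately show ?thesis by (cases "l = m0") simp_all
    qed
    then have "(\<Sum>q. lookup g q when m0 + n0 = l + q) = (lookup g n0 when l = m0)" by simp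
    then show ?thesis by (auto simp: when_def)
  next
    case False
    then show ?thesis using assms(2) by (auto simp: when_def in_keys_iff)
  qed
  then show ?thesis by (simp add: lookup_mult)
qed

lemma lookup_single_mult:
  fixes g :: "'a::cancel_comm_monoid_add \<Rightarrow>\<^sub>0 'b::comm_semiring_1"
  shows "lookup (single h 1 * g) (h + m) = lookup g m"
proof (cases "m \<in> keys g")
  case True
  then show ?thesis
  proof (cases "(1::'b) = 0")
    case True
    then have "x = y" for x y :: 'b by (metis mult_1 mult_zero_left)
    then show ?thesis by blast
  next
    case False
    then show ?thesis using True by (subst lookup_mult_unique) auto
  qed
next
  case False
  then have "h + m \<notin> keys (single h (1::'b) * g)" using keys_mult[of "single h (1::'b)" g]
    by (auto split: if_splits)
  then show ?thesis using False by (simp add: in_keys_iff)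
qed

lemma keys_single_mult:
  fixes g :: "'a::cancel_comm_monoid_add \<Rightarrow>\<^sub>0 'b::comm_semiring_1"
  shows "keys (single h 1 * g) = (+) h ` keys g"
proof
  show "keys (single h 1 * g) \<subseteq> (+) h ` keys g"
    using keys_mult[of "single h (1::'b)" g] by (auto split: if_splits)
  show "(+) h ` keys g \<subseteq> keys (single h 1 * g)"
    using lookup_single_mult[of h g] by (auto simp: in_keys_iff)
qed

text \<open>An additive weight separating finitely many monomials; it replaces a monomial order.\<close>

lemma separating_weight:
  fixes F :: "('v \<Rightarrow>\<^sub>0 nat) set"
  assumes "finite V" "finite F"
  shows "\<exists>w :: 'v \<Rightarrow> nat. \<forall>m\<in>F. \<forall>n\<in>F.
    (\<Sum>v\<in>V. w v * lookup m v) = (\<Sum>v\<in>V. w v * lookup n v) \<longrightarrow> (\<forall>v\<in>V. lookup m v = lookup n v)"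
  using assms(1)
proof (induction V rule: finite_induct)
  case (insert x V)
  then obtain w :: "'v \<Rightarrow> nat" where w: "\<And>m n. m \<in> F \<Longrightarrow> n \<in> F \<Longrightarrow>
    (\<Sum>v\<in>V. w v * lookup m v) = (\<Sum>v\<in>V. w v * lookup n v) \<Longrightarrow> \<forall>v\<in>V. lookup m v = lookup n v" by blast
  \<comment> \<open>\<open>B\<close> exceeds every exponent of \<open>x\<close>, so the new weight
    is a number in base \<open>B\<close> with the exponent of \<open>x\<close> as last
    digit.\<close>
  define B where "B = Suc (\<Sum>m\<in>F. lookup m x)"
  have B: "lookup m x < B" if "m \<in> F" for m
    using member_le_sum[of m F "\<lambda>m. lookup m x"] that assms(2) by (simp add: B_def less_Suc_eq_le)
  let ?w = "\<lambda>v. if v = x then 1 else B * w v"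
  have eq: "(\<Sum>v\<in>insert x V. ?w v * lookup m v) = lookup m x + B * (\<Sum>v\<in>V. w v * lookup m v)" for m
  proof -
    have "(\<Sum>v\<in>V. ?w v * lookup m v) = (\<Sum>v\<in>V. B * (w v * lookup m v))"
      by (rule sum.cong) (use insert in auto)
    then show ?thesis using insert by (simp add: sum_distrib_left)
  qed
  have "\<forall>v\<in>insert x V. lookup m v = lookup n v"
    if mn: "m \<in> F" "n \<in> F" "(\<Sum>v\<in>insert x V. ?w v * lookup m v) = (\<Sum>v\<in>insert x V. ?w v * lookup n v)" for m n
  proof -
    let ?s = "\<lambda>m. \<Sum>v\<in>V. w v * lookup m v"
    have e: "lookup m x + B * ?s m = lookup n x + B * ?s n" using mn(3) unfolding eq .
    have "(lookup m x + B * ?s m) mod B = lookup m x" "(lookup n x + B * ?s n) mod B = lookup n x"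
      using B mn by simp_all
    then have x: "lookup m x = lookup n x" using e by simp
    then have "B * ?s m = B * ?s n" using e by linarith
    moreover have "0 < B" by (simp add: B_def)
    ultimately have "?s m = ?s n" by simp
    then show ?thesis using w[OF mn(1,2)] x by simp
  qed
  then show ?case by (intro exI[of _ ?w]) blast
qed simp

text \<open>A separating weight singles out a heaviest monomial in each of \<open>f\<close> and
  \<open>g\<close>. Their product arises from no other pair, so its coefficient in
  \<open>f * g\<close> is a product of two non-zero ones.\<close>

lemma mpoly_mult_eq_0:
  fixes f g :: "('v, 'k::field) mpoly"
  assumes "f * g = 0"
  shows "f = 0 \<or> g = 0"
proof (rule ccontr)
  assume "\<not> (f = 0 \<or> g = 0)"
  then have ne: "keys f \<noteq> {}" "keys g \<noteq> {}" by (auto simp: poly_mapping_eq_iff in_keys_iff fun_eq_iff)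
  define V where "V = (\<Union>m\<in>keys f \<union> keys g. keys m)"
  have fin: "finite V" unfolding V_def by auto
  have "finite (keys f \<union> keys g)" by simp
  from separating_weight[OF fin this] obtain w :: "'v \<Rightarrow> nat" where
    w: "\<And>m n. m \<in> keys f \<union> keys g \<Longrightarrow> n \<in> keys f \<union> keys g \<Longrightarrow>
      (\<Sum>v\<in>V. w v * lookup m v) = (\<Sum>v\<in>V. w v * lookup n v) \<Longrightarrow> \<forall>v\<in>V. lookup m v = lookup n v" by blast
  define W where "W m = (\<Sum>v\<in>V. w v * lookup m v)" for m
  have Wadd: "W (m + n) = W m + W n" for m n
    by (simp add: W_def lookup_add sum.distrib algebra_simps)
  have inj: "m = n" if "m \<in> keys f \<union> keys g" "n \<in> keys f \<union> keys g" "W m = W n" for m n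
  proof (rule poly_mapping_eqI)
    fix v show "lookup m v = lookup n v"
    proof (cases "v \<in> V")
      case True
      then show ?thesis using w[OF that(1,2)] that(3) by (simp add: W_def)
    next
      case False
      then have "v \<notin> keys m" "v \<notin> keys n" using that unfolding V_def by blast+
      then show ?thesis by (simp add: in_keys_iff)
    qed
  qed
  have ex: "\<exists>m\<in>keys p. \<forall>n\<in>keys p. W n \<le> W m" if "keys p \<noteq> {}" for p :: "('v, 'k) mpoly"
  proof -
    have "Max (W ` keys p) \<in> W ` keys p" using that by (intro Max_in) auto
    then obtain m where "m \<in> keys p" "W m = Max (W ` keys p)" by auto
    then show ?thesis by (intro bexI[of _ m]) auto
  qed
  obtain m0 where m0: "m0 \<in> keys f" "\<And>n. n \<in> keys f \<Longrightarrow> W n \<le> W m0" using ex[OF ne(1)] by blast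
  obtain n0 where n0: "n0 \<in> keys g" "\<And>n. n \<in> keys g \<Longrightarrow> W n \<le> W n0" using ex[OF ne(2)] by blast
  have "lookup (f * g) (m0 + n0) = lookup f m0 * lookup g n0"
  proof (rule lookup_mult_unique[OF _ m0(1) n0(1)])
    fix m n assume mn: "m \<in> keys f" "n \<in> keys g" "m + n = m0 + n0"
    then have "W m + W n = W m0 + W n0" using Wadd by metis
    then have "W m = W m0" "W n = W n0" using m0(2)[OF mn(1)] n0(2)[OF mn(2)] by auto
    then show "m = m0 \<and> n = n0" using inj mn m0 n0 by blast
  qed
  moreover have "lookup f m0 * lookup g n0 \<noteq> 0" using m0 n0 by (auto simp: in_keys_iff)
  ultimately show False using assms by simp
qed

section \<open>The polynomial ring and its monomial ideals\<close>

lemma mpoly_ring_simps [simp]: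
  "carrier (mpoly_ring V) = {p. \<forall>m\<in>keys p. keys m \<subseteq> V}"
  "monoid.mult (mpoly_ring V) = (*)" "one (mpoly_ring V) = 1" "zero (mpoly_ring V) = 0"
  "add (mpoly_ring V) = (+)"
  by (simp_all add: mpoly_ring_def)

lemma keys_add_nat: "keys (m + n :: 'v \<Rightarrow>\<^sub>0 nat) = keys m \<union> keys n"
  by (auto simp: in_keys_iff lookup_add)

lemma mult_closed:
  fixes f g :: "('v, 'k::field) mpoly"
  assumes "\<forall>m\<in>keys f. keys m \<subseteq> V" "\<forall>m\<in>keys g. keys m \<subseteq> V"
  shows "\<forall>m\<in>keys (f * g). keys m \<subseteq> V"
proof
  fix m assume "m \<in> keys (f * g)"
  then obtain a b where "m = a + b" "a \<in> keys f" "b \<in> keys g" using keys_mult[of f g] by blast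
  then show "keys m \<subseteq> V" using assms by (simp add: keys_add_nat)
qed

lemma add_closed:
  fixes f g :: "('v, 'k::field) mpoly"
  assumes "\<forall>m\<in>keys f. P m" "\<forall>m\<in>keys g. P m"
  shows "\<forall>m\<in>keys (f + g). P m"
  using assms keys_add[of f g] by blast

lemma keys_uminus: "keys (- f :: ('v, 'k::field) mpoly) = keys f"
  by (auto simp: in_keys_iff)

lemma cring_mpoly_ring: "cring (mpoly_ring V :: ('v, 'k::field) mpoly ring)"
proof (rule cringI)
  show "abelian_group (mpoly_ring V :: ('v, 'k) mpoly ring)"
  proof (rule abelian_groupI)
    fix x y :: "('v, 'k) mpoly"
    assume xy: "x \<in> carrier (mpoly_ring V)" "y \<in> carrier (mpoly_ring V)"
    then show "x \<oplus>\<^bsub>mpoly_ring V\<^esub> y \<in> carrier (mpoly_ring V)"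
      using add_closed[of x "\<lambda>m. keys m \<subseteq> V" y] by simp
  next
    fix x :: "('v, 'k) mpoly"
    assume x: "x \<in> carrier (mpoly_ring V)"
    then show "\<exists>y\<in>carrier (mpoly_ring V). y \<oplus>\<^bsub>mpoly_ring V\<^esub> x = \<zero>\<^bsub>mpoly_ring V\<^esub>"
      by (intro bexI[of _ "- x"]) (auto simp: keys_uminus)
  qed (auto simp: add_ac)
  show "comm_monoid (mpoly_ring V :: ('v, 'k) mpoly ring)"
  proof (rule comm_monoidI)
    fix x y :: "('v, 'k) mpoly"
    assume xy: "x \<in> carrier (mpoly_ring V)" "y \<in> carrier (mpoly_ring V)"
    then show "x \<otimes>\<^bsub>mpoly_ring V\<^esub> y \<in> carrier (mpoly_ring V)" using mult_closed[of x V y] by simp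
  qed (auto simp: mult_ac)
qed (auto simp: algebra_simps)

definition mon_ideal :: "'v set \<Rightarrow> (('v \<Rightarrow>\<^sub>0 nat) \<Rightarrow> bool) \<Rightarrow> ('v, 'k::field) mpoly set" where
  "mon_ideal V A = {p. \<forall>m\<in>keys p. keys m \<subseteq> V \<and> A m}"

definition up_closed :: "(('v \<Rightarrow>\<^sub>0 nat) \<Rightarrow> bool) \<Rightarrow> bool" where
  "up_closed A \<longleftrightarrow> (\<forall>m n. A m \<longrightarrow> A (m + n))"

lemma ideal_add: "ideal I (mpoly_ring V) \<Longrightarrow> x \<in> I \<Longrightarrow> y \<in> I \<Longrightarrow> x + y \<in> I"
  using additive_subgroup.a_closed[OF ideal.axioms(1), of I "mpoly_ring V" x y] by simp

lemma ideal_zero: "ideal I (mpoly_ring V) \<Longrightarrow> 0 \<in> I"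
  using additive_subgroup.zero_closed[OF ideal.axioms(1), of I "mpoly_ring V"] by simp

lemma ideal_mult: "ideal I (mpoly_ring V) \<Longrightarrow> x \<in> I \<Longrightarrow> \<forall>m\<in>keys y. keys m \<subseteq> V \<Longrightarrow> y * x \<in> I"
  using ideal.I_l_closed[of I "mpoly_ring V" x y] by simp

lemma ideal_carrier: "ideal I (mpoly_ring V) \<Longrightarrow> x \<in> I \<Longrightarrow> \<forall>m\<in>keys x. keys m \<subseteq> V"
  using ideal.Icarr[of I "mpoly_ring V" x] by simp

lemma ideal_diff:
  fixes x y :: "('v, 'k::field) mpoly"
  assumes "ideal I (mpoly_ring V)" "x \<in> I" "y \<in> I"
  shows "x - y \<in> I"
proof -
  have "(- 1) * y \<in> I" by (rule ideal_mult[OF assms(1,3)]) (simp add: keys_uminus)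
  then show ?thesis using ideal_add[OF assms(1,2), of "(- 1) * y"] by simp
qed

lemma ideal_sum:
  "ideal I (mpoly_ring V) \<Longrightarrow> (\<And>i. i \<in> T \<Longrightarrow> f i \<in> I) \<Longrightarrow> sum f T \<in> I"
  by (induction T rule: infinite_finite_induct) (auto intro: ideal_zero ideal_add)

lemma mon_ideal_ideal:
  assumes "up_closed A"
  shows "ideal (mon_ideal V A) (mpoly_ring V :: ('v, 'k::field) mpoly ring)"
proof -
  let ?R = "mpoly_ring V :: ('v, 'k) mpoly ring"
  interpret cring ?R by (rule cring_mpoly_ring)
  have minus: "\<ominus>\<^bsub>?R\<^esub> x = - x" if "x \<in> carrier ?R" for x
    by (rule minus_equality) (use that in \<open>auto simp: keys_uminus\<close>)
  have mult: "x * a \<in> mon_ideal V A" if "a \<in> mon_ideal V A" "x \<in> carrier ?R" for a x :: "('v, 'k) mpoly"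
    unfolding mon_ideal_def
  proof (intro CollectI ballI)
    fix m assume "m \<in> keys (x * a)"
    then obtain p q where "m = p + q" "p \<in> keys x" "q \<in> keys a" using keys_mult[of x a] by blast
    then show "keys m \<subseteq> V \<and> A m" using that assms
      by (auto simp: mon_ideal_def up_closed_def keys_add_nat add.commute[of p])
  qed
  show ?thesis
  proof (rule idealI)
    show "ring ?R" by (rule ring_axioms)
    show "subgroup (mon_ideal V A) (add_monoid ?R)"
    proof
      show "mon_ideal V A \<subseteq> carrier (add_monoid ?R)" by (auto simp: mon_ideal_def)
      show "x \<otimes>\<^bsub>add_monoid ?R\<^esub> y \<in> mon_ideal V A" if "x \<in> mon_ideal V A" "y \<in> mon_ideal V A" for x y
      proof -
        have "\<forall>m\<in>keys (x + y). keys m \<subseteq> V \<and> A m"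
          by (rule add_closed) (use that in \<open>auto simp: mon_ideal_def\<close>)
        then show ?thesis by (simp add: mon_ideal_def)
      qed
      show "\<one>\<^bsub>add_monoid ?R\<^esub> \<in> mon_ideal V A" by (simp add: mon_ideal_def)
      show "inv\<^bsub>add_monoid ?R\<^esub> x \<in> mon_ideal V A" if "x \<in> mon_ideal V A" for x
        using minus[of x] that by (auto simp: mon_ideal_def a_inv_def keys_uminus)
    qed
    show "x \<otimes>\<^bsub>?R\<^esub> a \<in> mon_ideal V A" "a \<otimes>\<^bsub>?R\<^esub> x \<in> mon_ideal V A"
      if "a \<in> mon_ideal V A" "x \<in> carrier ?R" for a x
      using mult[OF that] by (simp_all add: mult.commute)
  qed
qed

lemma single_in_mon_ideal:
  "single m c \<in> (mon_ideal V A :: ('v, 'k::field) mpoly set) \<longleftrightarrow> c = 0 \<or> (keys m \<subseteq> V \<and> A m)"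
  by (auto simp: mon_ideal_def)

lemma genideal_monomials:
  assumes A: "up_closed A" and T: "\<And>t. t \<in> T \<Longrightarrow> keys t \<subseteq> V \<and> A t"
    and gen: "\<And>m. keys m \<subseteq> V \<Longrightarrow> A m \<Longrightarrow> \<exists>t\<in>T. \<exists>n. m = n + t"
  shows "genideal (mpoly_ring V) ((\<lambda>t. single t 1) ` T) = (mon_ideal V A :: ('v, 'k::field) mpoly set)"
proof
  show "genideal (mpoly_ring V) ((\<lambda>t. single t 1) ` T) \<subseteq> (mon_ideal V A :: ('v, 'k) mpoly set)"
    unfolding genideal_def
    by (rule Inter_lower) (use mon_ideal_ideal[OF A] T in \<open>auto simp: single_in_mon_ideal\<close>)
  show "(mon_ideal V A :: ('v, 'k) mpoly set) \<subseteq> genideal (mpoly_ring V) ((\<lambda>t. single t 1) ` T)"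
    unfolding genideal_def
  proof (intro subsetI InterI CollectI)
    fix p :: "('v, 'k) mpoly" and I :: "('v, 'k) mpoly set"
    assume p: "p \<in> mon_ideal V A"
      and "I \<in> {I. ideal I (mpoly_ring V) \<and> (\<lambda>t. single t 1) ` T \<subseteq> I}"
    then have I: "ideal I (mpoly_ring V)" "\<And>t. t \<in> T \<Longrightarrow> single t (1::'k) \<in> I" by auto
    have "single m (lookup p m) \<in> I" if m: "m \<in> keys p" for m
    proof -
      have "keys m \<subseteq> V" "A m" using p m by (auto simp: mon_ideal_def)
      then obtain t n where tn: "t \<in> T" "m = n + t" using gen by blast
      have "single n (lookup p m) * single t 1 \<in> I"
        by (rule ideal_mult[OF I(1) I(2)[OF tn(1)]])
          (use \<open>keys m \<subseteq> V\<close> tn in \<open>auto simp: keys_add_nat\<close>)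
      then show ?thesis using tn by (simp add: mult_single)
    qed
    then have "(\<Sum>m\<in>keys p. single m (lookup p m)) \<in> I" by (rule ideal_sum[OF I(1)])
    then show "p \<in> I" by (simp add: sum_single)
  qed
qed

section \<open>Associated primes of monomial ideals\<close>

text \<open>Every element of the quotient is a coset \<open>J +> b\<close>, and its annihilator is
  the colon ideal of \<open>J\<close> by \<open>b\<close>; quotient rings disappear from here
  on.\<close>

lemma Ass_iff:
  fixes R (structure)
  assumes "ideal J R" "cring R"
  shows "P \<in> Ass R J \<longleftrightarrow> primeideal P R \<and> (\<exists>b\<in>carrier R. P = {a \<in> carrier R. a \<otimes>\<^bsub>R\<^esub> b \<in> J})"
proof -
  interpret ideal J R by fact
  interpret cring R by fact
  have zero: "(J +> x = J) \<longleftrightarrow> x \<in> J" if "x \<in> carrier R" for x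
    using a_rcos_self[OF that] a_rcos_const by blast
  have "{a \<in> carrier R. (J +> a) \<otimes>\<^bsub>R Quot J\<^esub> (J +> b) = \<zero>\<^bsub>R Quot J\<^esub>}
      = {a \<in> carrier R. a \<otimes> b \<in> J}" if "b \<in> carrier R" for b
    by (rule Collect_cong, rule conj_cong[OF refl]) (simp add: FactRing_def rcoset_mult_add that zero)
  moreover have "carrier (R Quot J) = (\<lambda>b. J +> b) ` carrier R"
    by (auto simp: FactRing_def A_RCOSETS_def')
  ultimately show ?thesis unfolding Ass_def by auto
qed

definition var_prime :: "'v set \<Rightarrow> 'v set \<Rightarrow> ('v, 'k::field) mpoly set" where
  "var_prime V U = mon_ideal V (\<lambda>m. \<exists>v\<in>U. 0 < lookup m v)"

lemma up_closed_var: "up_closed (\<lambda>m. \<exists>v\<in>U. 0 < lookup m v)"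
  by (auto simp: up_closed_def lookup_add)

lemma mon_ideal_iff:
  "p \<in> mon_ideal V A \<longleftrightarrow> (\<forall>m\<in>keys p. keys m \<subseteq> V) \<and> part (\<lambda>m. \<not> A m) p = 0"
proof -
  have "part (\<lambda>m. \<not> A m) p = 0 \<longleftrightarrow> (\<forall>m\<in>keys p. A m)"
    by (auto simp: poly_mapping_eq_iff fun_eq_iff lookup_part in_keys_iff)
  then show ?thesis by (auto simp: mon_ideal_def)
qed

text \<open>Modulo the ideal only monomials without variables from \<open>U\<close> count. If
  neither \<open>f\<close> nor \<open>g\<close> lies in the ideal, their parts made of such
  monomials are non-zero; so is the product of these parts, and it involves no variable of
  \<open>U\<close>.\<close>

lemma primeideal_var_prime:
  "primeideal (var_prime V U) (mpoly_ring V :: ('v, 'k::field) mpoly ring)"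
proof (rule primeidealI)
  let ?A = "\<lambda>m :: 'v \<Rightarrow>\<^sub>0 nat. \<exists>v\<in>U. 0 < lookup m v"
  let ?R = "mpoly_ring V :: ('v, 'k) mpoly ring"
  show I: "ideal (var_prime V U) ?R" unfolding var_prime_def by (rule mon_ideal_ideal[OF up_closed_var])
  show "cring ?R" by (rule cring_mpoly_ring)
  have "1 \<notin> (var_prime V U :: ('v, 'k) mpoly set)" by (simp add: var_prime_def mon_ideal_def)
  moreover have "1 \<in> carrier ?R" by simp
  ultimately show "carrier ?R \<noteq> var_prime V U" by blast
  fix f g :: "('v, 'k) mpoly"
  assume f: "f \<in> carrier ?R" and g: "g \<in> carrier ?R" and fg: "f \<otimes>\<^bsub>?R\<^esub> g \<in> var_prime V U"
  show "f \<in> var_prime V U \<or> g \<in> var_prime V U"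
  proof (rule ccontr)
    assume neg: "\<not> ?thesis"
    let ?f0 = "part ?A f" and ?f1 = "part (\<lambda>m. \<not> ?A m) f"
    let ?g0 = "part ?A g" and ?g1 = "part (\<lambda>m. \<not> ?A m) g"
    have ne: "?f1 \<noteq> 0" "?g1 \<noteq> 0"
      using neg f g unfolding var_prime_def mon_ideal_iff by auto
    have in0: "?f0 \<in> var_prime V U" "?g0 \<in> var_prime V U"
      using f g by (auto simp: var_prime_def mon_ideal_def keys_part)
    have car: "\<forall>m\<in>keys ?f1. keys m \<subseteq> V" using f by (simp add: keys_part)
    have a: "f * g = ?f0 * g + ?f1 * g"
      by (simp only: distrib_right[symmetric] part_add_part)
    have b: "?f1 * g = ?f1 * ?g0 + ?f1 * ?g1" by (simp only: distrib_left[symmetric] part_add_part)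
    have "?f1 * ?g1 = f * g - (g * ?f0 + ?f1 * ?g0)"
      by (simp only: a b mult.commute[of g ?f0]) simp
    moreover have "f * g - (g * ?f0 + ?f1 * ?g0) \<in> var_prime V U"
    proof (rule ideal_diff[OF I], goal_cases)
      case 1
      then show ?case using fg by simp
    next
      case 2
      have "g * ?f0 \<in> var_prime V U" by (rule ideal_mult[OF I in0(1)]) (use g in simp)
      then show ?case by (rule ideal_add[OF I _ ideal_mult[OF I in0(2) car]])
    qed
    ultimately have prod: "?f1 * ?g1 \<in> var_prime V U" by simp
    have "?f1 * ?g1 \<noteq> 0" using mpoly_mult_eq_0 ne by blast
    then obtain k where k: "k \<in> keys (?f1 * ?g1)" by (auto simp: poly_mapping_eq_iff fun_eq_iff in_keys_iff)
    then obtain x y where xy: "k = x + y" "x \<in> keys ?f1" "y \<in> keys ?g1" using keys_mult[of ?f1 ?g1] by blast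
    then have "\<not> ?A k" by (auto simp: keys_part lookup_add)
    then show False using prod k by (auto simp: var_prime_def mon_ideal_def)
  qed
qed

lemma prime_contains_variable:
  assumes P: "primeideal P (mpoly_ring V :: ('v, 'k::field) mpoly ring)" and V: "finite V"
    and h: "keys h \<subseteq> V" "single h (1::'k) \<in> P"
  shows "\<exists>v\<in>V. 0 < lookup h v \<and> single (single v 1) 1 \<in> P"
  using h
proof (induction "\<Sum>v\<in>V. lookup h v" arbitrary: h rule: less_induct)
  case less
  have I: "ideal P (mpoly_ring V)" using P by (simp add: primeideal.axioms)
  have "h \<noteq> 0"
  proof
    assume "h = 0"
    then have "1 \<in> P" using less.prems by simp
    then have "carrier (mpoly_ring V) \<subseteq> P" using ideal_mult[OF I, of 1] by auto
    then show False using primeideal.I_notcarr[OF P] ideal_carrier[OF I] by auto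
  qed
  then obtain v where v: "v \<in> keys h" by (auto simp: poly_mapping_eq_iff fun_eq_iff in_keys_iff)
  then have vV: "v \<in> V" using less.prems by blast
  define h' where "h' = h - single v 1"
  have hh: "h = single v 1 + h'"
    using v by (intro poly_mapping_eqI) (auto simp: h'_def lookup_add lookup_minus lookup_single when_def in_keys_iff)
  have keys: "keys h' \<subseteq> V" using less.prems(1) unfolding hh keys_add_nat by simp
  have "single (single v 1) 1 * single h' (1::'k) \<in> P" using less.prems(2) hh by (simp add: mult_single)
  then consider "single (single v 1) (1::'k) \<in> P" | "single h' (1::'k) \<in> P"
    using primeideal.I_prime[OF P, of "single (single v 1) 1" "single h' 1"] keys vV by auto
  then show ?case
  proof cases
    case 1
    then show ?thesis using v vV by (auto simp: in_keys_iff)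
  next
    case 2
    have "(\<Sum>v\<in>V. lookup h' v) < (\<Sum>v\<in>V. lookup h v)"
      by (rule sum_strict_mono_ex1[OF V])
        (use vV in \<open>auto simp: hh lookup_add intro!: bexI[of _ v]\<close>)
    from less.hyps[OF this keys 2] show ?thesis by (auto simp: hh lookup_add)
  qed
qed

text \<open>In place of a grading argument, the witness \<open>g\<close> of an associated prime is
  chosen with as few terms as possible. Minimality forces all its monomials to have the same
  annihilating monomials, so \<open>P\<close> is monomial and any single monomial of
  \<open>g\<close> is a witness.\<close>

lemma Ass_mon_ideal:
  assumes A: "up_closed A" and V: "finite V"
  shows "Ass (mpoly_ring V) (mon_ideal V A :: ('v, 'k::field) mpoly set) =
    var_prime V ` {U. U \<subseteq> V \<and>
      (\<exists>m. keys m \<subseteq> V \<and> (\<forall>h. keys h \<subseteq> V \<longrightarrow> (A (h + m) \<longleftrightarrow> (\<exists>v\<in>U. 0 < lookup h v))))}"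
    (is "_ = _ ` ?\<U>")
proof (intro equalityI subsetI)
  let ?R = "mpoly_ring V :: ('v, 'k) mpoly ring"
  let ?J = "mon_ideal V A :: ('v, 'k) mpoly set"
  have J: "ideal ?J ?R" by (rule mon_ideal_ideal[OF A])
  note iff = Ass_iff[OF J cring_mpoly_ring]
  {
    fix P :: "('v, 'k) mpoly set"
    assume "P \<in> var_prime V ` ?\<U>"
    then obtain U m where U: "P = var_prime V U" "keys m \<subseteq> V"
      "\<And>h. keys h \<subseteq> V \<Longrightarrow> A (h + m) \<longleftrightarrow> (\<exists>v\<in>U. 0 < lookup h v)" by blast
    have "P = {a \<in> carrier ?R. a * single m 1 \<in> ?J}"
    proof (intro equalityI subsetI)
      fix a assume "a \<in> P"
      then show "a \<in> {a \<in> carrier ?R. a * single m 1 \<in> ?J}"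
        using U by (auto simp: var_prime_def mon_ideal_def keys_single_mult mult.commute[of a] keys_add_nat
          add.commute[of m])
    next
      fix a assume "a \<in> {a \<in> carrier ?R. a * single m 1 \<in> ?J}"
      then show "a \<in> P"
        using U by (auto simp: var_prime_def mon_ideal_def keys_single_mult mult.commute[of a] keys_add_nat
          add.commute[of m])
    qed
    moreover have "single m 1 \<in> carrier ?R" using U by simp
    moreover have "primeideal P ?R" unfolding U(1) by (rule primeideal_var_prime)
    ultimately show "P \<in> Ass ?R ?J" by (intro iffD2[OF iff] conjI bexI[of _ "single m 1"]) simp_all
  next
    fix P :: "('v, 'k) mpoly set"
    assume "P \<in> Ass ?R ?J"
    then have P: "primeideal P ?R" and "\<exists>g. g \<in> carrier ?R \<and> P = {a \<in> carrier ?R. a * g \<in> ?J}"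
      unfolding iff by auto
    then obtain g where g: "g \<in> carrier ?R" "P = {a \<in> carrier ?R. a * g \<in> ?J}"
      and min: "\<And>g'. g' \<in> carrier ?R \<Longrightarrow> P = {a \<in> carrier ?R. a * g' \<in> ?J} \<Longrightarrow> card (keys g) \<le> card (keys g')"
      using arg_min_nat_lemma[of "\<lambda>g. g \<in> carrier ?R \<and> P = {a \<in> carrier ?R. a * g \<in> ?J}" _ "\<lambda>g. card (keys g)"]
      by blast
    have PI: "ideal P ?R" using P by (simp add: primeideal.axioms)
    have gV: "keys m \<subseteq> V" if "m \<in> keys g" for m using g(1) that by simp
    have g0: "g \<noteq> 0"
    proof
      assume "g = 0"
      then have "P = carrier ?R" using g(2) by (auto simp: mon_ideal_def)
      then show False using primeideal.I_notcarr[OF P] by simp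
    qed
    have memP: "single h 1 \<in> P \<longleftrightarrow> (\<forall>m\<in>keys g. A (h + m))" if h: "keys h \<subseteq> V" for h
      using h gV unfolding g(2) by (auto simp: mon_ideal_def keys_single_mult keys_add_nat)
    \<comment> \<open>Suppose \<open>h\<close> sends one term of \<open>g\<close> into the ideal but
      is not in \<open>P\<close>. As \<open>P\<close> is prime, multiplying \<open>g\<close> by
      \<open>h\<close> does not change the annihilator, nor does dropping the term that lies in the
      ideal. The result is a witness with fewer terms.\<close>
    have one: "single h 1 \<in> P" if h: "keys h \<subseteq> V" and m: "m \<in> keys g" "A (h + m)" for h m
    proof (rule ccontr)
      assume hP: "single h 1 \<notin> P"
      define g0 where "g0 = part (\<lambda>n. n \<noteq> m) g"
      have kg0: "keys g0 = keys g - {m}" by (auto simp: g0_def keys_part)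
      have split: "g = g0 + single m (lookup g m)"
        by (rule poly_mapping_eqI) (simp add: g0_def lookup_add lookup_part lookup_single when_def)
      let ?g = "single h 1 * g0"
      have J1: "single (h + m) (lookup g m) \<in> ?J" using m h gV by (simp add: mon_ideal_def keys_add_nat)
      have hg: "single h 1 * g = ?g + single (h + m) (lookup g m)"
        by (subst split) (simp add: algebra_simps mult_single)
      have car: "?g \<in> carrier ?R" using gV h by (auto simp: keys_single_mult kg0 keys_add_nat)
      have eq: "a * ?g \<in> ?J \<longleftrightarrow> a * (single h 1 * g) \<in> ?J" if a: "a \<in> carrier ?R" for a
      proof -
        have aJ: "a * single (h + m) (lookup g m) \<in> ?J" using ideal_mult[OF J J1] a by simp
        have e: "a * (single h 1 * g) = a * ?g + a * single (h + m) (lookup g m)"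
          unfolding hg by (simp add: algebra_simps)
        show ?thesis
        proof
          assume "a * ?g \<in> ?J"
          then show "a * (single h 1 * g) \<in> ?J" unfolding e by (rule ideal_add[OF J _ aJ])
        next
          assume "a * (single h 1 * g) \<in> ?J"
          from ideal_diff[OF J this aJ] show "a * ?g \<in> ?J" unfolding e by simp
        qed
      qed
      have "P = {a \<in> carrier ?R. a * ?g \<in> ?J}"
      proof (intro equalityI subsetI)
        fix a assume a: "a \<in> P"
        then have ac: "a \<in> carrier ?R" using ideal_carrier[OF PI] by simp
        have "a * g \<in> ?J" using a g(2) by simp
        then have "single h 1 * (a * g) \<in> ?J" using ideal_mult[OF J] h by simp
        then show "a \<in> {a \<in> carrier ?R. a * ?g \<in> ?J}" using eq[OF ac] ac by (simp add: mult.left_commute)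
      next
        fix a assume a: "a \<in> {a \<in> carrier ?R. a * ?g \<in> ?J}"
        then have "a * (single h 1 * g) \<in> ?J" using eq[of a] by simp
        then have "(a * single h 1) * g \<in> ?J" by (simp add: mult.assoc)
        moreover have "a * single h 1 \<in> carrier ?R" using mult_closed[of a V "single h 1"] a h by simp
        ultimately have "a * single h 1 \<in> P" unfolding g(2) by blast
        then show "a \<in> P" using primeideal.I_prime[OF P, of a "single h 1"] a h hP by auto
      qed
      from min[OF car this] have "card (keys g) \<le> card (keys ?g)" .
      also have "\<dots> \<le> card (keys g0)" unfolding keys_single_mult by (rule card_image_le) simp
      also have "\<dots> < card (keys g)" unfolding kg0 using m(1) by (intro psubset_card_mono) auto
      finally show False by simp
    qed
    \<comment> \<open>The part of \<open>f\<close> without its monomials in \<open>P\<close> still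
      sends \<open>g\<close> into the ideal, but by \<open>one\<close> no monomial of that product
      can lie there. So the product is 0, and hence this part.\<close>
    have all: "single h 1 \<in> P" if f: "f \<in> P" "h \<in> keys f" for f h
    proof -
      have fV: "\<forall>m\<in>keys f. keys m \<subseteq> V" using ideal_carrier[OF PI f(1)] .
      let ?B = "\<lambda>h. single h (1::'k) \<in> P"
      let ?f0 = "part ?B f" and ?f1 = "part (\<lambda>h. \<not> ?B h) f"
      have "?f0 \<in> P"
      proof -
        have "single m c \<in> P" if "?B m" for m c
          using ideal_mult[OF PI that, of "single 0 c"] by (simp add: mult_single)
        then show ?thesis unfolding part_def by (intro ideal_sum[OF PI]) auto
      qed
      have "?f1 = f - ?f0" using part_add_part[of ?B f] by (simp add: algebra_simps)
      then have "?f1 \<in> P" using ideal_diff[OF PI f(1) \<open>?f0 \<in> P\<close>] by simp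
      then have f1: "?f1 * g \<in> ?J" using g(2) by simp
      have "keys (?f1 * g) = {}"
      proof (rule ccontr)
        assume "keys (?f1 * g) \<noteq> {}"
        then obtain k where k: "k \<in> keys (?f1 * g)" by blast
        then obtain x y where xy: "k = x + y" "x \<in> keys ?f1" "y \<in> keys g" using keys_mult[of ?f1 g] by blast
        have "A (x + y)" using f1 k xy by (auto simp: mon_ideal_def)
        then have "?B x" using one[of x y] xy fV by (auto simp: keys_part)
        then show False using xy(2) by (simp add: keys_part)
      qed
      then have "?f1 * g = 0" by (auto simp: poly_mapping_eq_iff fun_eq_iff in_keys_iff)
      then have "?f1 = 0" using mpoly_mult_eq_0 g0 by blast
      then have "keys ?f1 = {}" by simp
      then show ?thesis using f(2) by (auto simp: keys_part)
    qed
    define U where "U = {v \<in> V. single (single v 1) (1::'k) \<in> P}"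
    have B: "single h 1 \<in> P \<longleftrightarrow> (\<exists>v\<in>U. 0 < lookup h v)" if h: "keys h \<subseteq> V" for h
    proof
      assume "single h 1 \<in> P"
      then show "\<exists>v\<in>U. 0 < lookup h v" using prime_contains_variable[OF P V h] by (auto simp: U_def)
    next
      assume "\<exists>v\<in>U. 0 < lookup h v"
      then obtain v where v: "v \<in> U" "0 < lookup h v" by blast
      have hh: "h = (h - single v 1) + single v 1"
        using v by (intro poly_mapping_eqI) (auto simp: lookup_add lookup_minus lookup_single when_def)
      have "keys (h - single v 1) \<subseteq> V" using h by (auto simp: in_keys_iff lookup_minus)
      then have "single (h - single v 1) 1 * single (single v 1) 1 \<in> P"
        using ideal_mult[OF PI, of "single (single v 1) 1" "single (h - single v 1) 1"] v(1) by (simp add: U_def)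
      then show "single h 1 \<in> P" using hh by (simp add: mult_single)
    qed
    have PU: "P = var_prime V U"
    proof (intro equalityI subsetI)
      fix f assume f: "f \<in> P"
      then show "f \<in> var_prime V U" using all[OF f] B ideal_carrier[OF PI f]
        by (auto simp: var_prime_def mon_ideal_def)
    next
      fix f :: "('v, 'k) mpoly"
      assume f: "f \<in> var_prime V U"
      have "single m (lookup f m) \<in> P" if m: "m \<in> keys f" for m
      proof -
        have "single m 1 \<in> P" using f m B[of m] by (auto simp: var_prime_def mon_ideal_def)
        from ideal_mult[OF PI this, of "single 0 (lookup f m)"] show ?thesis by (simp add: mult_single)
      qed
      then have "(\<Sum>m\<in>keys f. single m (lookup f m)) \<in> P" by (rule ideal_sum[OF PI])
      then show "f \<in> P" by (simp add: sum_single)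
    qed
    obtain m where m: "m \<in> keys g" using g0 by (auto simp: poly_mapping_eq_iff fun_eq_iff in_keys_iff)
    have "A (h + m) \<longleftrightarrow> (\<exists>v\<in>U. 0 < lookup h v)" if h: "keys h \<subseteq> V" for h
      using one[OF h m] memP[OF h] B[OF h] m by blast
    then have "U \<in> ?\<U>" using gV[OF m] by (auto simp: U_def)
    then show "P \<in> var_prime V ` ?\<U>" using PU by blast
  }
qed

section \<open>Powers of edge ideals\<close>

definition edge_monomial :: "'v set \<Rightarrow> 'v \<Rightarrow>\<^sub>0 nat" where
  "edge_monomial e = (\<Sum>v\<in>e. single v 1)"

lemma lookup_edge_monomial: "finite e \<Longrightarrow> lookup (edge_monomial e) v = of_bool (v \<in> e)"
  by (auto simp: edge_monomial_def lookup_sum lookup_single when_def)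

lemma packs_mono: "packs E a k \<Longrightarrow> (\<And>v. a v \<le> b v) \<Longrightarrow> packs E b k"
proof -
  assume "packs E a k" and le: "\<And>v. a v \<le> b v"
  then obtain M where M: "set_mset M \<subseteq> E" "size M = k" "\<And>v. deg M v \<le> a v" by (auto simp: packs_def)
  show "packs E b k" by (rule packsI[OF M(1,2)]) (rule order_trans[OF M(3) le])
qed

lemma up_closed_packs: "up_closed (\<lambda>m. packs E (lookup m) k)"
  unfolding up_closed_def by (auto simp: lookup_add elim!: packs_mono)

lemma packs_Suc:
  assumes "\<And>e. e \<in> E \<Longrightarrow> finite e"
  shows "packs E (lookup m) (Suc k) \<longleftrightarrow> (\<exists>e\<in>E. \<exists>n. m = n + edge_monomial e \<and> packs E (lookup n) k)"
proof
  assume "packs E (lookup m) (Suc k)"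
  then obtain M where M: "set_mset M \<subseteq> E" "size M = Suc k" "\<And>v. deg M v \<le> lookup m v"
    by (auto simp: packs_def)
  then obtain e N where N: "M = add_mset e N" by (metis size_eq_Suc_imp_eq_union)
  have e: "e \<in> E" using M N by simp
  note le = lookup_edge_monomial[OF assms[OF e]]
  have "m = (m - edge_monomial e) + edge_monomial e"
  proof (rule poly_mapping_eqI)
    fix v show "lookup m v = lookup (m - edge_monomial e + edge_monomial e) v"
      using M(3)[of v] by (auto simp: lookup_add lookup_minus le N)
  qed
  moreover have "packs E (lookup (m - edge_monomial e)) k"
  proof (rule packsI)
    show "set_mset N \<subseteq> E" "size N = k" using M N by auto
    show "deg N v \<le> lookup (m - edge_monomial e) v" for v
      using M(3)[of v] by (auto simp: lookup_minus le N)
  qed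
  ultimately show "\<exists>e\<in>E. \<exists>n. m = n + edge_monomial e \<and> packs E (lookup n) k" using e by blast
next
  assume "\<exists>e\<in>E. \<exists>n. m = n + edge_monomial e \<and> packs E (lookup n) k"
  then obtain e n where e: "e \<in> E" "m = n + edge_monomial e" "packs E (lookup n) k" by blast
  then obtain N where N: "set_mset N \<subseteq> E" "size N = k" "\<And>v. deg N v \<le> lookup n v"
    by (auto simp: packs_def)
  show "packs E (lookup m) (Suc k)"
    by (rule packsI[of "add_mset e N"])
      (use N e in \<open>auto simp: lookup_add lookup_edge_monomial[OF assms[OF e(1)]] intro: le_SucI add_mono\<close>)
qed

lemma packs_0: "packs E a 0"
  by (rule packsI[of "{#}"]) auto

lemma edge_ideal_eq:
  assumes G: "simple_graph G"
  shows "edge_ideal G = (mon_ideal (verts G) (\<lambda>m. packs (edges G) (lookup m) 1) :: ('v, 'k::field) mpoly set)"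
proof -
  have fin: "finite e" if "e \<in> edges G" for e
    using simple_graph_edges(3)[OF G that] by (simp add: card_2_iff')  (metis card.infinite simple_graph_edges(3)[OF G that] zero_neq_numeral)
  have em: "var u * var v = (single (edge_monomial {u, v}) 1 :: ('v, 'k) mpoly)" if "{u, v} \<in> edges G" for u v
  proof -
    have "u \<noteq> v" using simple_graph_edges(3)[OF G that] by auto
    then show ?thesis by (simp add: var_def mult_single edge_monomial_def)
  qed
  have "{var u * var v | u v. {u, v} \<in> edges G} = (\<lambda>t. single t (1::'k)) ` (edge_monomial ` edges G)"
  proof (intro equalityI subsetI)
    fix x :: "('v, 'k) mpoly" assume "x \<in> {var u * var v | u v. {u, v} \<in> edges G}"
    then show "x \<in> (\<lambda>t. single t (1::'k)) ` (edge_monomial ` edges G)" using em by blast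
  next
    fix x :: "('v, 'k) mpoly" assume "x \<in> (\<lambda>t. single t (1::'k)) ` (edge_monomial ` edges G)"
    then obtain e where e: "e \<in> edges G" "x = single (edge_monomial e) 1" by blast
    then obtain u v where uv: "e = {u, v}" using simple_graph_edges(3)[OF G e(1)] by (auto simp: card_2_iff)
    then have "x = var u * var v" using em[of u v] e by simp
    then show "x \<in> {var u * var v | u v. {u, v} \<in> edges G}" using e(1) uv by blast
  qed
  moreover have "genideal (mpoly_ring (verts G)) ((\<lambda>t. single t (1::'k)) ` (edge_monomial ` edges G))
      = mon_ideal (verts G) (\<lambda>m. packs (edges G) (lookup m) 1)"
  proof (rule genideal_monomials[OF up_closed_packs])
    fix t assume "t \<in> edge_monomial ` edges G"
    then obtain e where e: "e \<in> edges G" "t = edge_monomial e" by blast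
    have "e \<subseteq> verts G" using simple_graph_edges(1)[OF G] e(1) by auto
    then have "keys t \<subseteq> verts G"
      using e lookup_edge_monomial[OF fin[OF e(1)]] by (auto simp: in_keys_iff)
    moreover have "packs (edges G) (lookup (0 + edge_monomial e)) (Suc 0)"
      using packs_Suc[OF fin, where k = 0] e(1) packs_0 by blast
    ultimately show "keys t \<subseteq> verts G \<and> packs (edges G) (lookup t) 1" using e by simp
  next
    fix m assume "packs (edges G) (lookup m) 1"
    then show "\<exists>t\<in>edge_monomial ` edges G. \<exists>n. m = n + t"
      using packs_Suc[OF fin, where k = 0] by auto
  qed
  ultimately show ?thesis unfolding edge_ideal_def by simp
qed

lemma edge_ideal_power:
  assumes G: "simple_graph G"
  shows "ideal_power (mpoly_ring (verts G)) (edge_ideal G :: ('v, 'k::field) mpoly set) k =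
    mon_ideal (verts G) (\<lambda>m. packs (edges G) (lookup m) k)"
proof (induction k)
  case 0
  show ?case by (auto simp: ideals_set_def nat_pow_def mon_ideal_def packs_0)
next
  case (Suc k)
  let ?V = "verts G" and ?E = "edges G"
  let ?R = "mpoly_ring ?V :: ('v, 'k) mpoly ring"
  let ?I = "\<lambda>k. mon_ideal ?V (\<lambda>m. packs ?E (lookup m) k) :: ('v, 'k) mpoly set"
  have fin: "finite e" if "e \<in> edges G" for e
    using simple_graph_edges(3)[OF G that] card.infinite by fastforce
  have one: "(edge_ideal G :: ('v, 'k) mpoly set) = ?I 1" by (rule edge_ideal_eq[OF G])
  have "ideal_power ?R (edge_ideal G) (Suc k)
      = ideal_prod ?R (ideal_power ?R (edge_ideal G) k) (edge_ideal G)"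
    by (simp add: ideals_set_def nat_pow_def)
  then have pow: "ideal_power ?R (edge_ideal G) (Suc k) = ideal_prod ?R (?I k) (?I 1)"
    unfolding one[symmetric] Suc .
  have "ideal_prod ?R (?I k) (?I 1) = ?I (Suc k)"
  proof (intro equalityI subsetI)
    fix p assume "p \<in> ideal_prod ?R (?I k) (?I 1)"
    then show "p \<in> ?I (Suc k)"
    proof (induction rule: ideal_prod.induct)
      case (prod i j)
      show ?case unfolding mon_ideal_def
      proof (intro CollectI ballI)
        fix m assume "m \<in> keys (i \<otimes>\<^bsub>?R\<^esub> j)"
        then obtain a b where ab: "m = a + b" "a \<in> keys i" "b \<in> keys j" using keys_mult[of i j] by auto
        then have "packs ?E (lookup b) (Suc 0)" "packs ?E (lookup a) k" "keys a \<subseteq> ?V" "keys b \<subseteq> ?V"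
          using prod by (auto simp: mon_ideal_def)
        then obtain e n where e: "e \<in> ?E" "b = n + edge_monomial e"
          using packs_Suc[OF fin, where k = 0] by blast
        have "packs ?E (lookup (a + n)) k" using \<open>packs ?E (lookup a) k\<close> up_closed_packs[of ?E k]
          by (auto simp: up_closed_def)
        moreover have "m = (a + n) + edge_monomial e" using ab e by (simp add: add.assoc)
        ultimately have "packs ?E (lookup m) (Suc k)" using packs_Suc[OF fin, where k = k] e(1) by blast
        then show "keys m \<subseteq> ?V \<and> packs ?E (lookup m) (Suc k)"
          using ab \<open>keys a \<subseteq> ?V\<close> \<open>keys b \<subseteq> ?V\<close> by (simp add: keys_add_nat)
      qed
    next
      case (sum s1 s2)
      then show ?case using ideal_add[OF mon_ideal_ideal[OF up_closed_packs]] by simp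
    qed
  next
    fix p assume p: "p \<in> ?I (Suc k)"
    have zero: "0 \<in> ideal_prod ?R (?I k) (?I 1)"
      using ideal_prod.prod[of 0 "?I k" 0 "?I 1" ?R] by (simp add: mon_ideal_def)
    have monomial: "single m c \<in> ideal_prod ?R (?I k) (?I 1)" if m: "m \<in> keys p" for m c
    proof -
      have m': "keys m \<subseteq> ?V" "packs ?E (lookup m) (Suc k)" using p m by (auto simp: mon_ideal_def)
      then obtain e n where e: "e \<in> ?E" "m = n + edge_monomial e" "packs ?E (lookup n) k"
        using packs_Suc[OF fin, where k = k] by blast
      have "packs ?E (lookup (0 + edge_monomial e)) (Suc 0)"
        using packs_Suc[OF fin, where k = 0] e(1) packs_0 by blast
      then have "single n c \<in> ?I k" "single (edge_monomial e) 1 \<in> ?I 1"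
        using m' e by (auto simp: single_in_mon_ideal keys_add_nat)
      from ideal_prod.prod[OF this, of ?R] show ?thesis using e by (simp add: mult_single)
    qed
    have "(\<Sum>m\<in>T. single m (lookup p m)) \<in> ideal_prod ?R (?I k) (?I 1)" if "finite T" "T \<subseteq> keys p" for T
      using that
    proof (induction T rule: finite_induct)
      case (insert m T)
      then show ?case
        using ideal_prod.sum[OF monomial[of m "lookup p m"], of "\<Sum>m\<in>T. single m (lookup p m)"] by simp
    qed (use zero in simp)
    from this[of "keys p"] show "p \<in> ideal_prod ?R (?I k) (?I 1)" by (simp add: sum_single)
  qed
  then show ?case using pow by simp
qed

lemma max_ideal_eq: "max_ideal V = (var_prime V V :: ('v, 'k::field) mpoly set)"
proof -
  have "var ` V = (\<lambda>t. single t (1::'k)) ` ((\<lambda>v. single v 1) ` V)"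
    by (auto simp: var_def image_image)
  moreover have "genideal (mpoly_ring V) ((\<lambda>t. single t (1::'k)) ` ((\<lambda>v. single v 1) ` V)) = var_prime V V"
    unfolding var_prime_def
  proof (rule genideal_monomials[OF up_closed_var])
    fix t :: "'v \<Rightarrow>\<^sub>0 nat" assume "t \<in> (\<lambda>v. single v 1) ` V"
    then show "keys t \<subseteq> V \<and> (\<exists>v\<in>V. 0 < lookup t v)" by (auto simp: lookup_single when_def)
  next
    fix m :: "'v \<Rightarrow>\<^sub>0 nat" assume "\<exists>v\<in>V. 0 < lookup m v"
    then obtain v where v: "v \<in> V" "0 < lookup m v" by blast
    then have "m = (m - single v 1) + single v 1"
      by (intro poly_mapping_eqI) (auto simp: lookup_add lookup_minus lookup_single when_def)
    then show "\<exists>t\<in>(\<lambda>v. single v 1) ` V. \<exists>n. m = n + t" using v by blast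
  qed
  ultimately show ?thesis unfolding max_ideal_def by simp
qed

lemma var_prime_inj:
  assumes "U \<subseteq> V" "U' \<subseteq> V" "var_prime V U = (var_prime V U' :: ('v, 'k::field) mpoly set)"
  shows "U = U'"
proof -
  have mem: "single (single v 1) (1::'k) \<in> var_prime V W \<longleftrightarrow> v \<in> W" if "W \<subseteq> V" for W v
    using that by (auto simp: var_prime_def single_in_mon_ideal lookup_single when_def)
  show ?thesis by (rule Set.set_eqI) (use mem[OF assms(1)] mem[OF assms(2)] assms(3) in simp)
qed

section \<open>Associated primes and dominant* sets\<close>

lemma critical_mono: "critical E S b \<Longrightarrow> E \<subseteq> E' \<Longrightarrow> critical E' S b"
  unfolding critical_def by blast

lemma critical_within:
  assumes "critical E S b" shows "critical {e \<in> E. e \<subseteq> S} S b"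
  unfolding critical_def
proof (intro conjI ballI)
  show "\<forall>v. (0 < b v) = (v \<in> S)" using assms by (simp add: critical_def)
  fix x assume "x \<in> S"
  then obtain M where M: "set_mset M \<subseteq> E" "\<And>v. deg M v + un x v = b v" "\<And>e. e \<in># M \<Longrightarrow> e \<subseteq> S"
    using criticalE[OF assms] by blast
  then show "\<exists>M. set_mset M \<subseteq> {e \<in> E. e \<subseteq> S} \<and> (\<forall>v. deg M v + un x v = b v)"
    by (intro exI[of _ M]) auto
qed

lemma deg_replicate: "deg (replicate_mset n e) v = n * of_bool (v \<in> e)"
  by (induction n) auto

text \<open>The packings involved simply receive \<open>j\<close> further copies of the edge. This
  carries a prime from its first power to all later ones.\<close>

lemma critical_add_edge:
  assumes "critical E S b" "{x, y} \<in> E" "x \<noteq> y" "x \<in> S" "y \<in> S"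
  shows "critical E S (\<lambda>v. b v + j * (un x v + un y v))"
  unfolding critical_def
proof (intro conjI ballI allI)
  fix v show "(0 < b v + j * (un x v + un y v)) = (v \<in> S)"
    using assms by (auto simp: critical_def)
next
  fix z assume z: "z \<in> S"
  obtain M where M: "set_mset M \<subseteq> E" "\<And>v. deg M v + un z v = b v"
    by (rule criticalE[OF assms(1) z], rule that)
  show "\<exists>M. set_mset M \<subseteq> E \<and> (\<forall>v. deg M v + un z v = b v + j * (un x v + un y v))"
    using M assms(2,3)
    by (intro exI[of _ "M + replicate_mset j {x, y}"]) (auto simp: deg_replicate simp flip: M(2))
qed

section \<open>Components of induced subgraphs and \<open>nu_star\<close>\<close>

lemma comp_classes_eq: "comp_classes (edges G) W = W // reachable (induced G W)"
  by (simp add: comp_classes_def induced_def)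

lemma component_simple: "simple_graph G \<Longrightarrow> C \<subseteq> W \<Longrightarrow> W \<subseteq> verts G \<Longrightarrow> simple_graph (induced (induced G W) C)"
  by (auto simp: simple_graph_def intro: finite_subset)

lemma component_connected:
  assumes C: "C \<in> comp_classes (edges G) W"
  shows "connected_graph (induced (induced G W) C)"
proof -
  let ?E = "{e \<in> edges G. e \<subseteq> W}"
  have "(u, v) \<in> conn {e \<in> ?E. e \<subseteq> C}" if uv: "u \<in> C" "v \<in> C" for u v
  proof -
    have "(u, v) \<in> conn ?E" by (rule classes_partition(6)[OF C uv])
    then have "(u, v) \<in> conn {e \<in> ?E. e \<subseteq> C} \<and> v \<in> C"
    proof (induction rule: conn_induct)
      case (step y z)
      have "z \<in> C" using classes_partition(7)[OF C, of y z] step conn_edge[of y z] by auto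
      then have yz: "(y, z) \<in> conn {e \<in> ?E. e \<subseteq> C}" using step by (intro conn_edge) auto
      have "(u, y) \<in> conn {e \<in> ?E. e \<subseteq> C}" using step.IH by simp
      from conn_trans[OF this yz] show ?case using \<open>z \<in> C\<close> by simp
    qed (use uv in simp)
    then show ?thesis by blast
  qed
  then show ?thesis
    using classes_partition(4)[OF C] by (auto simp: connected_graph_def reachable_eq)
qed

lemma components_eq: "components (induced G W) = induced (induced G W) ` comp_classes (edges G) W"
  by (simp add: components_def comp_classes_eq)

text \<open>The number of extra copies: for a connected simple graph with an odd cycle, the least
  total of a critical weight is \<open>card (verts H) + defect H\<close>.\<close>

definition defect :: "'v graph \<Rightarrow> nat" where
  "defect H = phi_connected H + card (bridges H)"

lemma nu_star_eq:
  assumes "finite W"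
  shows "nu_star (induced G W) =
    (real (\<Sum>C\<in>comp_classes (edges G) W. card C + defect (induced (induced G W) C))
      - real (card (comp_classes (edges G) W))) / 2"
proof -
  let ?Q = "comp_classes (edges G) W"
  have "card W = (\<Sum>C\<in>?Q. card C)"
    using sum_classes[OF assms, of "\<lambda>_. 1::nat" "edges G"] by simp
  then have "(\<Sum>C\<in>?Q. card C + defect (induced (induced G W) C))
      = card W + phi (induced G W) + psi (induced G W)"
    by (simp add: defect_def phi_def psi_def components_eq sum.reindex[OF inj_induced] sum.distrib)
  moreover have "card (components (induced G W)) = card ?Q"
    unfolding components_eq by (rule card_image[OF inj_induced])
  moreover have "?Q = {}" if "W = {}" using that by (simp add: comp_classes_def)
  ultimately show ?thesis by (auto simp: nu_star_def)
qed

text \<open>A critical weight has an odd total \<open>2 * k + 1\<close> on each component, so the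
  half in \<open>nu_star\<close> is exact. \<open>n\<close> is the sum of the \<open>k\<close>, the
  size of a packing that leaves one copy over per component.\<close>

lemma nu_star_attained:
  assumes G: "simple_graph G" and W: "W \<subseteq> verts G"
    and odd: "\<And>C. C \<in> components (induced G W) \<Longrightarrow> has_odd_cycle C"
  shows "\<exists>b n. nu_star (induced G W) = real n \<and>
    (\<forall>C\<in>comp_classes (edges G) W. critical (edges G) C (restrict_to C b)) \<and>
    sum b W = 2 * n + card (comp_classes (edges G) W)"
proof -
  let ?Q = "comp_classes (edges G) W" and ?H = "\<lambda>C. induced (induced G W) C"
  note sg = simple_graph_edges[OF G]
  have fin: "finite W" using W sg(2) finite_subset by blast
  have finQ: "finite ?Q" by (rule classes_partition(5)[OF fin])
  have "\<exists>b k. critical (edges G) C b \<and> sum b C = card C + defect (?H C) \<and> sum b C = 2 * k + 1"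
    if C: "C \<in> ?Q" for C
  proof -
    have CW: "C \<subseteq> W" by (rule classes_partition(3)[OF C])
    have "has_odd_cycle (?H C)" using odd C by (auto simp: components_eq)
    from critical_attains_phi_psi[OF component_simple[OF G CW W] component_connected[OF C] this]
    obtain b where b: "critical (edges (?H C)) C b" "sum b C = card C + defect (?H C)"
      by (auto simp: defect_def)
    have bE: "critical (edges G) C b" by (rule critical_mono[OF b(1)]) auto
    obtain x where x: "x \<in> C" using classes_partition(4)[OF C] by blast
    obtain M where M: "set_mset M \<subseteq> edges G" "\<And>v. deg M v + un x v = b v" "\<And>e. e \<in># M \<Longrightarrow> e \<subseteq> C"
      by (rule criticalE[OF bE x], rule that)
    have "finite C" using CW fin finite_subset by blast
    from critical_size[OF bE this x sg(3) M] show ?thesis using bE b(2) by blast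
  qed
  then obtain bf k where bf: "\<And>C. C \<in> ?Q \<Longrightarrow> critical (edges G) C (bf C)"
    "\<And>C. C \<in> ?Q \<Longrightarrow> sum (bf C) C = card C + defect (?H C)"
    "\<And>C. C \<in> ?Q \<Longrightarrow> sum (bf C) C = 2 * k C + 1" by metis
  define b where "b v = (\<Sum>C\<in>?Q. bf C v)" for v
  have supp: "bf C v = 0 \<longleftrightarrow> v \<notin> C" if "C \<in> ?Q" for C v
  proof -
    have "0 < bf C v \<longleftrightarrow> v \<in> C" using bf(1)[OF that] unfolding critical_def by blast
    then show ?thesis by auto
  qed
  have b: "b v = bf C v" if C: "C \<in> ?Q" "v \<in> C" for C v
  proof -
    have "bf D v = 0" if "D \<in> ?Q - {C}" for D
      using classes_partition(2)[of D "edges G" W C] that C supp[of D v] by blast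
    then show ?thesis unfolding b_def using sum.remove[OF finQ C(1), of "\<lambda>D. bf D v"] by simp
  qed
  have restr: "restrict_to C b = bf C" if C: "C \<in> ?Q" for C
    using b[OF C] supp[OF C] by (auto simp: restrict_to_def fun_eq_iff)
  define n where "n = (\<Sum>C\<in>?Q. k C)"
  have "sum b C = sum (bf C) C" if "C \<in> ?Q" for C using b[OF that] by (intro sum.cong) auto
  then have sumW: "sum b W = (\<Sum>C\<in>?Q. sum (bf C) C)"
    unfolding sum_classes[OF fin, of b "edges G"] by (rule sum.cong[OF refl])
  also have "\<dots> = (\<Sum>C\<in>?Q. 2 * k C + 1)" by (rule sum.cong[OF refl]) (rule bf(3))
  also have "\<dots> = 2 * n + card ?Q" by (simp add: n_def sum_distrib_left sum.distrib sum_Suc)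
  finally have n: "sum b W = 2 * n + card ?Q" .
  have "(\<Sum>C\<in>?Q. card C + defect (?H C)) = sum b W"
    unfolding sumW by (rule sum.cong[OF refl]) (rule bf(2)[symmetric])
  then have "nu_star (induced G W) = real n" unfolding nu_star_eq[OF fin] n by simp
  then show ?thesis using n bf(1) restr by (intro exI[of _ b] exI[of _ n]) auto
qed

text \<open>By \<open>Ass_mon_ideal\<close>, for a set \<open>U\<close> of vertices this says that
  the prime generated by the variables in \<open>U\<close> is associated to the \<open>k\<close>-th
  power of the edge ideal. The field no longer appears.\<close>

definition occurs :: "'v graph \<Rightarrow> 'v set \<Rightarrow> nat \<Rightarrow> bool" where
  "occurs G U k \<longleftrightarrow> (\<exists>m. keys m \<subseteq> verts G \<and>
     (\<forall>h. keys h \<subseteq> verts G \<longrightarrow>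
       (packs (edges G) (lookup (h + m)) k \<longleftrightarrow> (\<exists>v\<in>U. 0 < lookup h v))))"

lemma monomial_of:
  assumes "finite V" "\<And>v. v \<notin> V \<Longrightarrow> a v = (0::nat)"
  obtains m where "keys m \<subseteq> V" "lookup m = a"
proof
  let ?m = "Abs_poly_mapping a"
  have "{v. a v \<noteq> 0} \<subseteq> V" by (rule subsetI, rule ccontr) (simp add: assms(2))
  then have "finite {v. a v \<noteq> 0}" using assms(1) by (rule finite_subset)
  then show l: "lookup ?m = a" by simp
  show "keys ?m \<subseteq> V" by (rule subsetI, rule ccontr) (simp add: in_keys_iff l assms(2))
qed

lemma packs_less: "packs E a k \<Longrightarrow> j \<le> k \<Longrightarrow> packs E a j"
proof (induction k)
  case (Suc k)
  show ?case
  proof (cases "j = Suc k")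
    case False
    obtain M where M: "set_mset M \<subseteq> E" "size M = Suc k" "\<And>v. deg M v \<le> a v"
      using Suc.prems(1) by (auto simp: packs_def)
    obtain e N where N: "M = add_mset e N" using M(2) by (metis size_eq_Suc_imp_eq_union)
    have "packs E a k"
    proof (rule packsI[of N])
      show "deg N v \<le> a v" for v using M(3)[of v] N by simp
    qed (use M N in auto)
    then show ?thesis using Suc False by simp
  qed (use Suc in simp)
qed simp

lemma Dstar_iff:
  "W \<in> Dstar G U \<longleftrightarrow> independent_set G (verts G - U) \<and> W \<subseteq> U \<and>
     W \<subseteq> verts G - ((verts G - U) \<union> nbhd G (verts G - U)) \<and>
     verts G = nbhd G W \<union> nbhd G (verts G - U) \<union> (verts G - U) \<and>
     (\<forall>C\<in>components (induced G W). has_odd_cycle C)"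
  by (auto simp: Dstar_def dominant_star_def dominant_def Let_def)

lemma occursI:
  assumes "finite (verts G)" "\<And>v. v \<notin> verts G \<Longrightarrow> a v = 0"
    and neg: "\<And>h. (\<And>v. v \<in> U \<Longrightarrow> h v = 0) \<Longrightarrow> \<not> packs (edges G) (\<lambda>v. h v + a v) k"
    and pos: "\<And>i. i \<in> U \<Longrightarrow> packs (edges G) (\<lambda>v. a v + un i v) k"
  shows "occurs G U k"
proof -
  obtain m where m: "keys m \<subseteq> verts G" "lookup m = a" using monomial_of[of "verts G" a] assms(1,2) by blast
  have "packs (edges G) (lookup (h + m)) k \<longleftrightarrow> (\<exists>v\<in>U. 0 < lookup h v)" for h
  proof
    assume p: "packs (edges G) (lookup (h + m)) k"
    show "\<exists>v\<in>U. 0 < lookup h v"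
    proof (rule ccontr)
      assume "\<not> (\<exists>v\<in>U. 0 < lookup h v)"
      then have "\<not> packs (edges G) (\<lambda>v. lookup h v + a v) k" by (intro neg) auto
      moreover have "lookup (h + m) = (\<lambda>v. lookup h v + a v)" using m(2) by (simp add: lookup_add fun_eq_iff)
      ultimately show False using p by simp
    qed
  next
    assume "\<exists>v\<in>U. 0 < lookup h v"
    then obtain i where i: "i \<in> U" "0 < lookup h i" by blast
    show "packs (edges G) (lookup (h + m)) k"
      by (rule packs_mono[OF pos[OF i(1)]]) (use i(2) m(2) in \<open>auto simp: lookup_add\<close>)
  qed
  then show ?thesis using m(1) unfolding occurs_def by blast
qed

lemma nbhd_iff: "simple_graph G \<Longrightarrow> v \<in> nbhd G S \<longleftrightarrow> (\<exists>u\<in>S. {u, v} \<in> edges G)"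
  using simple_graph_edges(1)[of G] by (auto simp: nbhd_def)

lemma deg_all: "(\<And>e. e \<in># M \<Longrightarrow> v \<in> e) \<Longrightarrow> deg M v = size M"
  by (induction M) auto

text \<open>\<open>Z\<close> is independent and not adjacent to \<open>W\<close>, so without help
  from \<open>U\<close> only edges inside \<open>W\<close> fit, at most \<open>k - 1\<close> of
  them. One more copy of \<open>i\<close> in \<open>U\<close> gives a further edge, to a vertex left
  over in \<open>W\<close> or to a vertex of \<open>Z\<close>. If \<open>W\<close> is empty, an edge
  leaving \<open>Z\<close> has to supply the \<open>k - 1\<close> edges instead.\<close>

lemma Dstar_imp_occurs:
  assumes G: "simple_graph G" and E: "edges G \<noteq> {}" and U: "U \<subseteq> verts G"
    and W: "W \<in> Dstar G U" and k: "1 + nu_star (induced G W) \<le> real k"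
  shows "occurs G U k"
proof -
  let ?V = "verts G" and ?E = "edges G"
  define Z where "Z = ?V - U"
  note sg = simple_graph_edges[OF G]
  have D: "independent_set G Z" "W \<subseteq> U" "W \<inter> nbhd G Z = {}" "?V = nbhd G W \<union> nbhd G Z \<union> Z"
    "\<And>C. C \<in> components (induced G W) \<Longrightarrow> has_odd_cycle C"
    using W unfolding Dstar_iff Z_def by auto
  have WV: "W \<subseteq> ?V" using D(2) U by blast
  have finW: "finite W" using WV sg(2) finite_subset by blast
  have ind: "{u, v} \<notin> ?E" if "u \<in> Z" "v \<in> Z" for u v using D(1) that by (auto simp: independent_set_def)
  have ZW: "{u, v} \<notin> ?E" if "u \<in> Z" "v \<in> W" for u v using D(3) that by (auto simp: nbhd_iff[OF G] disjoint_iff)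
  obtain b n where b: "nu_star (induced G W) = real n"
    "\<And>C. C \<in> comp_classes ?E W \<Longrightarrow> critical ?E C (restrict_to C b)"
    "sum b W = 2 * n + card (comp_classes ?E W)"
    using nu_star_attained[OF G WV D(5)] by blast
  have nk: "n + 1 \<le> k" using k b(1) by simp
  show ?thesis
  proof (cases "W = {}")
    case True
    obtain e where e: "e \<in> ?E" using E by blast
    then obtain p q where pq: "{p, q} \<in> ?E" using sg(3)[OF e] by (auto simp: card_2_iff)
    then have "p \<in> ?V" "q \<in> ?V" using sg(1) by auto
    moreover have VNZ: "?V = nbhd G Z \<union> Z" using D(4) True by (simp add: nbhd_def)
    ultimately have "p \<in> nbhd G Z \<or> q \<in> nbhd G Z" using ind[of p q] pq by blast
    then obtain y z0 where y: "z0 \<in> Z" "{z0, y} \<in> ?E" by (auto simp: nbhd_iff[OF G])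
    have yZ: "y \<notin> Z" using ind y by blast
    have yV: "y \<in> ?V" using sg(1) y by auto
    \<comment> \<open>All edges that fit contain \<open>y\<close>, because \<open>Z\<close> is
      independent, so the \<open>k - 1\<close> copies of \<open>y\<close> bound their number. With
      \<open>k\<close> copies on \<open>Z\<close> there is room even if \<open>z\<close> and
      \<open>z0\<close> coincide below.\<close>
    let ?a = "\<lambda>v. if v \<in> Z then k else if v = y then k - 1 else 0"
    show ?thesis
    proof (rule occursI[OF sg(2), of ?a])
      show "?a v = 0" if "v \<notin> ?V" for v using that yV by (auto simp: Z_def)
      show "\<not> packs ?E (\<lambda>v. h v + ?a v) k" if h: "\<And>v. v \<in> U \<Longrightarrow> h v = 0" for h
      proof
        assume "packs ?E (\<lambda>v. h v + ?a v) k"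
        then obtain M where M: "set_mset M \<subseteq> ?E" "size M = k" "\<And>v. deg M v \<le> h v + ?a v"
          by (auto simp: packs_def)
        have "y \<in> e" if e: "e \<in># M" for e
        proof (rule ccontr)
          assume ye: "y \<notin> e"
          have "e \<subseteq> Z"
          proof
            fix v assume v: "v \<in> e"
            then have "0 < deg M v" using deg_posI[OF e] by blast
            then have "0 < h v + ?a v" using M(3)[of v] by linarith
            moreover have "v \<in> ?V" using sg(1) M(1) e v by auto
            ultimately show "v \<in> Z" using h[of v] ye v by (auto simp: Z_def split: if_splits)
          qed
          moreover obtain u v where "e = {u, v}" using sg(3)[of e] M(1) e by (auto simp: card_2_iff)
          ultimately show False using ind M(1) e by auto
        qed
        then have "deg M y = k" using deg_all[of M y] M(2) by simp
        moreover have "h y = 0" using h yV yZ by (auto simp: Z_def)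
        ultimately show False using M(3)[of y] yZ nk by simp
      qed
      show "packs ?E (\<lambda>v. ?a v + un i v) k" if i: "i \<in> U" for i
      proof -
        have "i \<in> ?V" "i \<notin> Z" using i U by (auto simp: Z_def)
        then have "i \<in> nbhd G Z" using VNZ by blast
        then obtain z where z: "z \<in> Z" "{z, i} \<in> ?E" by (auto simp: nbhd_iff[OF G])
        have iZ: "i \<notin> Z" using ind z by blast
        let ?M = "add_mset {z, i} (replicate_mset (k - 1) {z0, y})"
        show ?thesis
        proof (rule packsI[of ?M])
          show "set_mset ?M \<subseteq> ?E" using z y by auto
          show "size ?M = k" using nk by simp
          show "deg ?M v \<le> ?a v + un i v" for v
            using z y iZ yZ nk by (auto simp: deg_replicate)
        qed
      qed
    qed
  next
    case False
    have nbW: "\<exists>u\<in>W. {u, w} \<in> ?E" if "w \<in> W" for w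
    proof -
      have "w \<in> ?V" "w \<notin> Z" using that WV D(2) by (auto simp: Z_def)
      then have "w \<in> nbhd G W" using D(3,4) that by blast
      then show ?thesis by (simp add: nbhd_iff[OF G])
    qed
    obtain y where y: "y \<in> W" using False by blast
    obtain x where x: "x \<in> W" "{x, y} \<in> ?E" using nbW[OF y] by blast
    have xy: "x \<noteq> y" using sg(3)[OF x(2)] by auto
    \<comment> \<open>So many copies of the edge \<open>{x, y}\<close> raise the packing number of
      \<open>W\<close> from \<open>n\<close> to \<open>k - 1\<close>.\<close>
    let ?j = "k - 1 - n"
    define c where "c v = b v + ?j * (un x v + un y v)" for v
    have crit: "critical ?E C (restrict_to C c)" if C: "C \<in> comp_classes ?E W" for C
    proof (cases "x \<in> C")
      case True
      have "(x, y) \<in> conn {e \<in> ?E. e \<subseteq> W}" using x y by (intro conn_edge) auto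
      then have yC: "y \<in> C" using classes_partition(7)[OF C True y] by blast
      have "restrict_to C c = (\<lambda>v. restrict_to C b v + ?j * (un x v + un y v))"
        using True yC by (auto simp: restrict_to_def c_def fun_eq_iff)
      then show ?thesis using critical_add_edge[OF b(2)[OF C] x(2) xy True yC] by simp
    next
      case F: False
      have "y \<notin> C"
      proof
        assume yC: "y \<in> C"
        have "(y, x) \<in> conn {e \<in> ?E. e \<subseteq> W}" using x y by (intro conn_edge) (auto simp: insert_commute)
        then show False using classes_partition(7)[OF C yC x(1)] F by blast
      qed
      then have "restrict_to C c = restrict_to C b" using F
        by (auto simp: restrict_to_def c_def fun_eq_iff)
      then show ?thesis using b(2)[OF C] by simp
    qed
    have "sum c W = sum b W + ?j * 2"
      unfolding c_def sum.distrib sum_distrib_left[symmetric]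
      using x(1) y finW by (simp add: of_bool_def)
    then have sumc: "sum c W = 2 * (k - 1) + card (comp_classes ?E W)" using b(3) nk by simp
    let ?EW = "{e \<in> ?E. e \<subseteq> W}"
    have upper: "\<not> packs ?EW c (Suc (k - 1))" by (rule packs_critical_upper[OF sg(3) finW crit sumc])
    have miss: "misses ?EW c (k - 1) w" if "w \<in> W" for w
      by (rule misses_critical[OF sg(3) finW that crit sumc])
    let ?a = "\<lambda>v. if v \<in> W then c v else if v \<in> Z then 1 else 0"
    show ?thesis
    proof (rule occursI[OF sg(2), of ?a])
      show "?a v = 0" if "v \<notin> ?V" for v using that WV by (auto simp: Z_def)
      show "\<not> packs ?E (\<lambda>v. h v + ?a v) k" if h: "\<And>v. v \<in> U \<Longrightarrow> h v = 0" for h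
      proof
        assume "packs ?E (\<lambda>v. h v + ?a v) k"
        then obtain M where M: "set_mset M \<subseteq> ?E" "size M = k" "\<And>v. deg M v \<le> h v + ?a v"
          by (auto simp: packs_def)
        have eW: "e \<subseteq> W" if e: "e \<in># M" for e
        proof -
          have "v \<in> Z \<or> v \<in> W" if v: "v \<in> e" for v
          proof -
            have "0 < deg M v" using deg_posI[OF e] v by blast
            then have "0 < h v + ?a v" using M(3)[of v] by linarith
            moreover have "v \<in> ?V" using sg(1) M(1) e v by auto
            ultimately show ?thesis using h[of v] by (auto simp: Z_def split: if_splits)
          qed
          moreover obtain u v where "e = {u, v}" using sg(3)[of e] M(1) e by (auto simp: card_2_iff)
          moreover have "{v, u} \<in> ?E" using M(1) e \<open>e = {u, v}\<close> by (auto simp: insert_commute)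
          ultimately show ?thesis using ind[of u v] ZW[of u v] ZW[of v u] M(1) e by auto
        qed
        have "packs ?EW c (Suc (k - 1))"
        proof (rule packsI[of M])
          show "deg M v \<le> c v" for v
          proof (cases "v \<in> W")
            case True
            then have "h v = 0" using h D(2) by blast
            then show ?thesis using M(3)[of v] True by simp
          next
            case False
            then have "deg M v = 0" using deg_pos[of M v] eW by auto
            then show ?thesis by simp
          qed
        qed (use M eW nk in auto)
        then show False using upper by blast
      qed
      show "packs ?E (\<lambda>v. ?a v + un i v) k" if i: "i \<in> U" for i
      proof -
        have "i \<in> ?V" "i \<notin> Z" using i U by (auto simp: Z_def)
        then have "i \<in> nbhd G Z \<or> i \<in> nbhd G W" using D(4) by blast
        then show ?thesis
        proof
          assume iN: "i \<in> nbhd G Z"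
          then obtain z where z: "z \<in> Z" "{z, i} \<in> ?E" by (auto simp: nbhd_iff[OF G])
          obtain M where M: "set_mset M \<subseteq> ?EW" "size M = k - 1" "\<And>v. deg M v + un y v \<le> c v"
            using miss[OF y] by (auto simp: misses_def)
          have d0: "deg M v = 0" if "v \<notin> W" for v using deg_pos[of M v] M(1) that by auto
          have zW: "z \<notin> W" using z D(2) by (auto simp: Z_def)
          have iW: "i \<notin> W" using iN D(3) by blast
          have zi: "z \<noteq> i" using sg(3)[OF z(2)] by auto
          show ?thesis
          proof (rule packsI[of "add_mset {z, i} M"])
            show "deg (add_mset {z, i} M) v \<le> ?a v + un i v" for v
              using M(3)[of v] d0[of v] z zW iW zi by (cases "v \<in> W") auto
          qed (use M z nk in auto)
        next
          assume "i \<in> nbhd G W"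
          then obtain w where w: "w \<in> W" "{w, i} \<in> ?E" by (auto simp: nbhd_iff[OF G])
          obtain M where M: "set_mset M \<subseteq> ?EW" "size M = k - 1" "\<And>v. deg M v + un w v \<le> c v"
            using miss[OF w(1)] by (auto simp: misses_def)
          have d0: "deg M v = 0" if "v \<notin> W" for v using deg_pos[of M v] M(1) that by auto
          have wi: "w \<noteq> i" using sg(3)[OF w(2)] by auto
          show ?thesis
          proof (rule packsI[of "add_mset {w, i} M"])
            show "deg (add_mset {w, i} M) v \<le> ?a v + un i v" for v
              using M(3)[of v] d0[of v] w wi deg_add_edge[OF wi, of M v] by (cases "v \<in> W") auto
          qed (use M w nk in auto)
        qed
      qed
    qed
  qed
qed

text \<open>Multiplying by variables from \<open>Z\<close> never leads into the power, so all
  \<open>s\<close> copies of vertices in \<open>N\<close> may be matched into \<open>Z\<close>; the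
  part on \<open>Y\<close> therefore packs fewer than \<open>k - s\<close> edges. Conversely at most
  \<open>s\<close> edges of a packing meet \<open>N\<close>, so an extra copy of a vertex of
  \<open>Y\<close> makes \<open>k - s\<close> edges fit inside \<open>Y\<close>. This is the
  situation of \<open>dominating_imp_critical\<close>.\<close>

lemma occurs_imp_Dstar:
  assumes G: "simple_graph G" and U: "U \<subseteq> verts G" and occ: "occurs G U k"
  shows "\<exists>W\<in>Dstar G U. 1 + nu_star (induced G W) \<le> real k"
proof -
  let ?V = "verts G" and ?E = "edges G"
  define Z where "Z = ?V - U"
  define N where "N = nbhd G Z"
  define Y where "Y = ?V - (Z \<union> N)"
  note sg = simple_graph_edges[OF G]
  obtain m where m: "keys m \<subseteq> ?V" "\<And>h. keys h \<subseteq> ?V \<Longrightarrow>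
     packs ?E (lookup (h + m)) k \<longleftrightarrow> (\<exists>v\<in>U. 0 < lookup h v)" using occ unfolding occurs_def by blast
  define a where "a = lookup m"
  have packs_iff: "packs ?E (\<lambda>v. h v + a v) k \<longleftrightarrow> (\<exists>v\<in>U. 0 < h v)" if h0: "\<And>v. v \<notin> ?V \<Longrightarrow> h v = 0" for h
  proof -
    obtain h' where h': "keys h' \<subseteq> ?V" "lookup h' = h"
      by (rule monomial_of[OF sg(2), of h]) (use h0 in auto)
    have "lookup (h' + m) = (\<lambda>v. h v + a v)" using h'(2) by (simp add: lookup_add fun_eq_iff a_def)
    then show ?thesis using m(2)[OF h'(1)] h'(2) by simp
  qed
  have k: "0 < k"
  proof (rule ccontr)
    assume "\<not> 0 < k"
    then show False using packs_iff[of "\<lambda>_. 0"] packs_0[of ?E a] by simp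
  qed
  have ind: "{u, v} \<notin> ?E" if uv: "u \<in> Z" "v \<in> Z" for u v
  proof
    assume e: "{u, v} \<in> ?E"
    let ?h = "\<lambda>w. k * of_bool (w \<in> {u, v})"
    have "packs ?E (\<lambda>w. ?h w + a w) k"
      by (rule packsI[of "replicate_mset k {u, v}"]) (use e in \<open>auto simp: deg_replicate\<close>)
    moreover have "?h w = 0" if "w \<notin> ?V" for w using that uv by (auto simp: Z_def)
    ultimately obtain w where "w \<in> U" "0 < ?h w" using packs_iff[of ?h] by blast
    then have "w \<in> {u, v}" by (cases "w \<in> {u, v}") auto
    then show False using uv \<open>w \<in> U\<close> by (auto simp: Z_def)
  qed
  have NV: "N \<subseteq> ?V" "N \<subseteq> U" using ind by (auto simp: N_def nbhd_def Z_def)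
  have finN: "finite N" using NV sg(2) finite_subset by blast
  have finY: "finite Y" using sg(2) by (simp add: Y_def)
  define s where "s = sum a N"
  let ?EY = "{e \<in> ?E. e \<subseteq> Y}"
  have big: "packs ?E (\<lambda>v. (if v \<in> Z then s else 0) + a v) (q + s)" if q: "packs ?EY a q" for q
  proof -
    obtain M where M: "set_mset M \<subseteq> ?EY" "size M = q" "\<And>v. deg M v \<le> a v" using q by (auto simp: packs_def)
    have "\<forall>y\<in>N. \<exists>z\<in>Z. {z, y} \<in> ?E" by (auto simp: N_def nbhd_def)
    then obtain z where z: "\<And>y. y \<in> N \<Longrightarrow> z y \<in> Z \<and> {z y, y} \<in> ?E" by metis
    let ?L = "\<Sum>y\<in>N. replicate_mset (a y) {z y, y}"
    have dL: "deg ?L v \<le> (if v \<in> Z then s else if v \<in> N then a v else 0)" for v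
    proof -
      have d: "deg ?L v = (\<Sum>y\<in>N. a y * of_bool (v = z y \<or> v = y))" by (simp add: deg_sum deg_replicate)
      consider "v \<in> Z" | "v \<in> N" "v \<notin> Z" | "v \<notin> N" "v \<notin> Z" by blast
      then show ?thesis
      proof cases
        case 1
        have "(\<Sum>y\<in>N. a y * of_bool (v = z y \<or> v = y)) \<le> s" unfolding s_def by (rule sum_mono) auto
        then show ?thesis using 1 d by simp
      next
        case 2
        have "(\<Sum>y\<in>N. a y * of_bool (v = z y \<or> v = y)) = (\<Sum>y\<in>N. if y = v then a y else 0)"
          by (rule sum.cong) (use z 2 in auto)
        then show ?thesis using 2 d finN by simp
      next
        case 3
        have "(\<Sum>y\<in>N. a y * of_bool (v = z y \<or> v = y)) = 0" by (rule sum.neutral) (use z 3 in auto)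
        then show ?thesis using 3 d by simp
      qed
    qed
    have d0: "deg M v = 0" if "v \<notin> Y" for v using deg_pos[of M v] M(1) that by auto
    show ?thesis
    proof (rule packsI[of "M + ?L"])
      have "set_mset ?L \<subseteq> ?E" by (rule set_sum_subset) (use z in auto)
      then show "set_mset (M + ?L) \<subseteq> ?E" using M(1) by auto
      show "size (M + ?L) = q + s" using M(2) by (simp add: size_sum s_def)
      show "deg (M + ?L) v \<le> (if v \<in> Z then s else 0) + a v" for v
        using M(3)[of v] d0[of v] dL[of v] by (auto simp: Y_def split: if_splits)
    qed
  qed
  have small: "\<not> packs ?EY a q" if "k \<le> q + s" for q
  proof
    assume "packs ?EY a q"
    then have "packs ?E (\<lambda>v. (if v \<in> Z then s else 0) + a v) k" using packs_less[OF big that] by blast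
    then have "\<exists>v\<in>U. 0 < (if v \<in> Z then s else 0)"
      using packs_iff[of "\<lambda>v. if v \<in> Z then s else 0"] by (auto simp: Z_def)
    then show False by (auto simp: Z_def split: if_splits)
  qed
  have sk: "s < k" using small[of 0] packs_0 by (metis add_0 not_le)
  define k' where "k' = k - 1 - s"
  have max: "\<not> packs ?EY a (Suc k')" by (rule small) (use sk k'_def in simp)
  have dom: "packs ?EY (\<lambda>v. a v + un i v) (Suc k')" if i: "i \<in> Y" for i
  proof -
    have "i \<in> U" "i \<in> ?V" using i by (auto simp: Y_def Z_def)
    then have "packs ?E (\<lambda>v. un i v + a v) k" using packs_iff[of "un i"] by auto
    then obtain M where M: "set_mset M \<subseteq> ?E" "size M = k" "\<And>v. deg M v \<le> un i v + a v"
      by (auto simp: packs_def)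
    \<comment> \<open>Each edge of \<open>?A\<close> uses one of the \<open>s\<close> copies in
      \<open>N\<close>, to which \<open>i\<close> adds none. The edges of \<open>?B\<close> avoid
      \<open>N\<close>, hence also \<open>Z\<close>, whose neighbours all lie in
      \<open>N\<close>.\<close>
    let ?A = "filter_mset (\<lambda>e. e \<inter> N \<noteq> {}) M" and ?B = "filter_mset (\<lambda>e. \<not> e \<inter> N \<noteq> {}) M"
    have AB: "M = ?A + ?B" by (rule multiset_partition)
    have "size ?A \<le> (\<Sum>e\<in>#M. card (N \<inter> e))"
    proof (induction M)
      case (add e M)
      show ?case
      proof (cases "e \<inter> N = {}")
        case False
        then have "1 \<le> card (N \<inter> e)"
          using finN by (simp add: Suc_le_eq card_gt_0_iff Int_commute)
        then show ?thesis using add False by simp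
      qed (use add in simp)
    qed simp
    also have "\<dots> = (\<Sum>v\<in>N. deg M v)" by (rule sum_deg[OF finN, symmetric])
    also have "\<dots> \<le> s" unfolding s_def
    proof (rule sum_mono)
      fix v assume "v \<in> N"
      then have "v \<noteq> i" using i by (auto simp: Y_def)
      then show "deg M v \<le> a v" using M(3)[of v] by simp
    qed
    finally have "size ?A \<le> s" .
    moreover have "size M = size ?A + size ?B" using arg_cong[OF AB, of size] by (simp only: size_union)
    ultimately have "k - s \<le> size ?B" using M(2) by linarith
    moreover have "packs ?EY (\<lambda>v. a v + un i v) (size ?B)"
    proof (rule packsI[of ?B])
      show "set_mset ?B \<subseteq> ?EY"
      proof
        fix e assume "e \<in># ?B"
        then have e: "e \<in> ?E" "e \<inter> N = {}" using M(1) by auto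
        obtain u v where uv: "e = {u, v}" using sg(3)[OF e(1)] by (auto simp: card_2_iff)
        have "u \<notin> Z" "v \<notin> Z"
          using e uv by (auto simp: N_def nbhd_iff[OF G] insert_commute)
        then show "e \<in> ?EY" using e uv sg(1) by (auto simp: Y_def)
      qed
      show "deg ?B v \<le> a v + un i v" for v
        using M(3)[of v] deg_mono[of ?B M v] by simp
    qed simp
    ultimately show ?thesis using packs_less[of ?EY _ "size ?B" "Suc k'"] sk by (simp add: k'_def)
  qed
  have "\<exists>W b. W \<subseteq> Y \<and> (\<forall>i\<in>Y. \<exists>j\<in>W. {i, j} \<in> ?EY) \<and>
    (\<forall>C\<in>comp_classes ?EY W. critical ?EY C (restrict_to C b)) \<and>
    sum b W \<le> 2 * k' + card (comp_classes ?EY W)"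
    by (rule dominating_imp_critical[OF _ _ finY max dom]) (use sg(3) in auto)
  then obtain W b where W': "W \<subseteq> Y" "\<forall>i\<in>Y. \<exists>j\<in>W. {i, j} \<in> ?EY"
    "\<forall>C\<in>comp_classes ?EY W. critical ?EY C (restrict_to C b)"
    "sum b W \<le> 2 * k' + card (comp_classes ?EY W)" by (elim exE conjE)
  have W: "W \<subseteq> Y" "\<And>i. i \<in> Y \<Longrightarrow> \<exists>j\<in>W. {i, j} \<in> ?EY"
    "\<And>C. C \<in> comp_classes ?EY W \<Longrightarrow> critical ?EY C (restrict_to C b)"
    "sum b W \<le> 2 * k' + card (comp_classes ?EY W)"
    by (fact W'(1), erule bspec[OF W'(2)], erule bspec[OF W'(3)], fact W'(4))
  have "{e \<in> ?EY. e \<subseteq> W} = {e \<in> ?E. e \<subseteq> W}" using W(1) by auto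
  then have Q: "comp_classes ?EY W = comp_classes ?E W" by (simp add: comp_classes_def)
  have WV: "W \<subseteq> ?V" using W(1) by (auto simp: Y_def)
  have finW: "finite W" using WV sg(2) finite_subset by blast
  have comp: "has_odd_cycle (induced (induced G W) C) \<and>
      card C + defect (induced (induced G W) C) \<le> sum b C" if C: "C \<in> comp_classes ?E W" for C
  proof -
    let ?H = "induced (induced G W) C"
    have CW: "C \<subseteq> W" by (rule classes_partition(3)[OF C])
    have simp: "simple_graph ?H" by (rule component_simple[OF G CW WV])
    have conn: "connected_graph ?H" by (rule component_connected[OF C])
    obtain w where w: "w \<in> C" using classes_partition(4)[OF C] by blast
    obtain j where j: "j \<in> W" "{w, j} \<in> ?E" using W(1,2) CW w by blast
    have wW: "w \<in> W" using w CW by blast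
    have "(w, j) \<in> conn {e \<in> ?E. e \<subseteq> W}" using j wW by (intro conn_edge) auto
    then have "j \<in> C" using classes_partition(7)[OF C w j(1)] by blast
    then have "{w, j} \<in> edges ?H" using j w wW by simp
    then have ne: "edges ?H \<noteq> {}" by blast
    have "critical ?EY C (restrict_to C b)" using W(3) C Q by simp
    from critical_mono[OF critical_within[OF this], of "edges ?H"]
    have crit: "critical (edges ?H) (verts ?H) (restrict_to C b)" using CW by auto
    have "sum (restrict_to C b) C = sum b C" by (simp add: restrict_to_def)
    then show ?thesis
      using critical_odd_cycle[OF simp conn ne crit] phi_psi_le_critical[OF simp conn ne crit]
      by (simp add: defect_def)
  qed
  have "W \<in> Dstar G U" unfolding Dstar_iff Z_def[symmetric] N_def[symmetric]
  proof (intro conjI ballI)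
    show "independent_set G Z" using ind by (simp add: independent_set_def)
    show "W \<subseteq> U" using W(1) by (auto simp: Y_def Z_def)
    show "W \<subseteq> ?V - (Z \<union> N)" using W(1) by (simp add: Y_def)
    show "?V = nbhd G W \<union> N \<union> Z"
    proof
      show "?V \<subseteq> nbhd G W \<union> N \<union> Z"
      proof
        fix v assume v: "v \<in> ?V"
        show "v \<in> nbhd G W \<union> N \<union> Z"
        proof (cases "v \<in> Y")
          case True
          then show ?thesis using W(2)[OF True] v by (auto simp: nbhd_def insert_commute)
        qed (use v in \<open>auto simp: Y_def\<close>)
      qed
      show "nbhd G W \<union> N \<union> Z \<subseteq> ?V" by (auto simp: nbhd_def N_def Z_def)
    qed
    fix C assume "C \<in> components (induced G W)"
    then show "has_odd_cycle C" using comp by (auto simp: components_eq)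
  qed
  moreover have "1 + nu_star (induced G W) \<le> real k"
  proof -
    have "(\<Sum>C\<in>comp_classes ?E W. card C + defect (induced (induced G W) C)) \<le> sum b W"
      unfolding sum_classes[OF finW, of b ?E] by (rule sum_mono) (use comp in blast)
    then have "(\<Sum>C\<in>comp_classes ?E W. card C + defect (induced (induced G W) C))
        \<le> 2 * k' + card (comp_classes ?E W)" using W(4) Q by simp
    note le = of_nat_mono[OF this, where 'a = real, unfolded of_nat_add of_nat_mult of_nat_numeral]
    have half: "(x - y) / 2 \<le> z" if "x \<le> 2 * z + y" for x y z :: real using that by simp
    have "nu_star (induced G W) \<le> real k'" unfolding nu_star_eq[OF finW] by (rule half[OF le])
    moreover have "1 + real k' \<le> real k" using sk by (simp add: k'_def of_nat_diff)
    ultimately show ?thesis by linarith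
  qed
  ultimately show ?thesis by blast
qed

text \<open>The choice of all vertices for both \<open>U\<close> and \<open>W\<close> is admissible,
  so the maximum and the minima of the theorem range over non-empty sets.\<close>

lemma full_in_Dstar:
  assumes G: "simple_graph G" "connected_graph G" "\<not> bipartite G"
  shows "verts G \<in> Dstar G (verts G)" "edges G \<noteq> {}"
proof -
  let ?V = "verts G"
  note sg = simple_graph_edges[OF G(1)]
  have col: "\<exists>u v. {u, v} \<in> edges G \<and> f u = f v" for f :: "'a \<Rightarrow> bool"
  proof (rule ccontr)
    assume neg: "\<not> ?thesis"
    have "bipartite G" unfolding bipartite_def
      by (rule exI[of _ "{v \<in> ?V. f v}"], rule exI[of _ "{v \<in> ?V. \<not> f v}"])
        (use neg in \<open>auto simp: independent_set_def\<close>)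
    then show False using G by blast
  qed
  then show "edges G \<noteq> {}" by blast
  obtain x y where xy: "{x, y} \<in> edges G" using col by blast
  then have xyV: "x \<in> ?V" "y \<in> ?V" "x \<noteq> y" using sg(1) sg(3)[OF xy] by auto
  have odd: "has_odd_cycle G" by (rule not_colourable_odd_cycle[OF G(1,2) col])
  have ind: "induced G ?V = G" using sg(1) by (cases G) (auto simp: induced_def)
  have "?V // reachable G = {?V}"
    by (rule quotient_connected) (use G(2) in \<open>auto simp: connected_graph_def reachable_eq\<close>)
  then have comp: "components G = {G}" by (simp add: components_def ind)
  have "?V \<subseteq> nbhd G ?V"
  proof
    fix v assume v: "v \<in> ?V"
    obtain w where w: "w \<in> ?V" "w \<noteq> v" using xyV by metis
    have "(v, w) \<in> conn (edges G)" by (rule connected_graph_conn[OF G(2) v w(1)])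
    then obtain u where "{v, u} \<in> edges G" using conn_leave[of v w "edges G" "{v}"] w by auto
    then show "v \<in> nbhd G ?V" using v sg(1) by (auto simp: nbhd_def insert_commute)
  qed
  then show "?V \<in> Dstar G ?V" unfolding Dstar_iff ind comp using odd
    by (auto simp: nbhd_def independent_set_def)
qed

theorem theorem4p11:
  fixes G :: "'v graph"
  assumes "simple_graph G" and "connected_graph G" and "\<not> bipartite G"
  shows "real (astab (mpoly_ring (verts G)) (edge_ideal G :: ('v, 'k::field) mpoly set)) =
           (MAX U\<in>{U. U \<subseteq> verts G \<and> Dstar G U \<noteq> {}}.
              MIN W\<in>Dstar G U. 1 + nu_star (induced G W)) \<and>
         real (dstab (verts G) (edge_ideal G :: ('v, 'k::field) mpoly set)) =
           (MIN W\<in>Dstar G (verts G). 1 + nu_star (induced G W))"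
proof -
  let ?V = "verts G"
  let ?R = "mpoly_ring ?V :: ('v, 'k) mpoly ring" and ?I = "edge_ideal G :: ('v, 'k) mpoly set"
  let ?f = "\<lambda>W. 1 + nu_star (induced G W)"
  let ?\<U> = "{U. U \<subseteq> ?V \<and> Dstar G U \<noteq> {}}"
  let ?A = "\<lambda>k. Ass ?R (ideal_power ?R ?I k)"
  note full = full_in_Dstar[OF assms]
  have finV: "finite ?V" using assms(1) by (simp add: simple_graph_def)
  have finU: "finite ?\<U>" using finV by simp
  have V\<U>: "?V \<in> ?\<U>" using full by blast
  have finD: "finite (Dstar G U)" if "U \<subseteq> ?V" for U
  proof (rule finite_subset)
    show "Dstar G U \<subseteq> Pow ?V" using that by (auto simp: Dstar_iff)
  qed (use finV in simp)
  \<comment> \<open>The values of \<open>nu_star\<close> are natural numbers here, so the minimum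
    can be compared with exponents.\<close>
  have "\<exists>n. (MIN W\<in>Dstar G U. ?f W) = real n \<and> 1 \<le> n" if U: "U \<in> ?\<U>" for U
  proof -
    have "(MIN W\<in>Dstar G U. ?f W) \<in> ?f ` Dstar G U" using U finD by (intro Min_in) auto
    then obtain W where W: "W \<in> Dstar G U" "(MIN W\<in>Dstar G U. ?f W) = ?f W" by blast
    have "W \<subseteq> ?V" using W(1) U by (auto simp: Dstar_iff)
    moreover have "\<And>C. C \<in> components (induced G W) \<Longrightarrow> has_odd_cycle C"
      using W(1) by (simp add: Dstar_iff)
    ultimately obtain n where "nu_star (induced G W) = real n"
      using nu_star_attained[OF assms(1), of W] by blast
    then show ?thesis using W(2) by (intro exI[of _ "Suc n"]) simp
  qed
  then have "\<forall>U\<in>?\<U>. \<exists>n. (MIN W\<in>Dstar G U. ?f W) = real n \<and> 1 \<le> n" by blast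
  from bchoice[OF this] obtain N
    where N': "\<forall>U\<in>?\<U>. (MIN W\<in>Dstar G U. ?f W) = real (N U) \<and> 1 \<le> N U" by blast
  have N: "(MIN W\<in>Dstar G U. ?f W) = real (N U) \<and> 1 \<le> N U" if "U \<in> ?\<U>" for U
    by (rule bspec[OF N' that])
  \<comment> \<open>\<open>N U\<close> is the first power to which the prime of \<open>U\<close> is
    associated, and the prime remains from there on.\<close>
  have occ: "occurs G U k \<longleftrightarrow> U \<in> ?\<U> \<and> N U \<le> k" if U: "U \<subseteq> ?V" for U k
  proof -
    have "occurs G U k \<longleftrightarrow> (\<exists>W\<in>Dstar G U. ?f W \<le> real k)"
      using Dstar_imp_occurs[OF assms(1) full(2) U] occurs_imp_Dstar[OF assms(1) U] by blast
    also have "\<dots> \<longleftrightarrow> U \<in> ?\<U> \<and> N U \<le> k"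
    proof (cases "Dstar G U = {}")
      case False
      then have U': "U \<in> ?\<U>" using U by blast
      have "(MIN W\<in>Dstar G U. ?f W) \<le> real k \<longleftrightarrow> (\<exists>W\<in>Dstar G U. ?f W \<le> real k)"
        using finD[OF U] False by (subst Min_le_iff) auto
      then show ?thesis using N[OF U'] U' by auto
    qed simp
    finally show ?thesis .
  qed
  have Ass: "?A k = var_prime ?V ` {U \<in> ?\<U>. N U \<le> k}" for k
  proof -
    have "?A k = var_prime ?V ` {U. U \<subseteq> ?V \<and> occurs G U k}"
      unfolding edge_ideal_power[OF assms(1)] Ass_mon_ideal[OF up_closed_packs finV] occurs_def ..
    also have "{U. U \<subseteq> ?V \<and> occurs G U k} = {U \<in> ?\<U>. N U \<le> k}" using occ by blast
    finally show ?thesis .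
  qed
  have mem: "var_prime ?V U \<in> ?A k \<longleftrightarrow> N U \<le> k" if U: "U \<in> ?\<U>" for U k
  proof
    assume "var_prime ?V U \<in> ?A k"
    then obtain U' where U': "U' \<in> ?\<U>" "N U' \<le> k" "var_prime ?V U = (var_prime ?V U' :: ('v, 'k) mpoly set)"
      unfolding Ass by blast
    then have "U = U'" using var_prime_inj[of U ?V U'] U by blast
    then show "N U \<le> k" using U' by simp
  qed (use U Ass in blast)
  define T where "T = Max (N ` ?\<U>)"
  have T: "N U \<le> T" if "U \<in> ?\<U>" for U unfolding T_def using finU that by (intro Max_ge) auto
  have "T \<in> N ` ?\<U>" unfolding T_def using finU V\<U> by (intro Max_in) auto
  then obtain U0 where U0: "U0 \<in> ?\<U>" "N U0 = T" by blast
  \<comment> \<open>From \<open>T\<close> on all primes are present; below \<open>T\<close> the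
    prime of \<open>U0\<close> is missing although it is associated to the power
    \<open>T\<close>.\<close>
  have astab: "astab ?R ?I = T" unfolding astab_def
  proof (rule Least_equality)
    have "?A k = var_prime ?V ` ?\<U>" if "T \<le> k" for k
    proof -
      have "{U \<in> ?\<U>. N U \<le> k} = ?\<U>" using T that order_trans by blast
      then show ?thesis unfolding Ass by simp
    qed
    then show "1 \<le> T \<and> (\<forall>i\<ge>1. ?A T = ?A (T + i))" using N[OF U0(1)] U0(2) by simp
    fix k assume k: "1 \<le> k \<and> (\<forall>i\<ge>1. ?A k = ?A (k + i))"
    show "T \<le> k"
    proof (rule ccontr)
      assume "\<not> T \<le> k"
      then have "1 \<le> T - k" by simp
      then have "?A k = ?A (k + (T - k))" using k by blast
      then have "var_prime ?V U0 \<in> ?A k" using mem[OF U0(1), of T] U0(2) \<open>\<not> T \<le> k\<close> by simp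
      then show False using mem[OF U0(1)] U0(2) \<open>\<not> T \<le> k\<close> by simp
    qed
  qed
  have "(MAX U\<in>?\<U>. MIN W\<in>Dstar G U. ?f W) = real T"
  proof (rule Max_eqI)
    show "finite ((\<lambda>U. MIN W\<in>Dstar G U. ?f W) ` ?\<U>)" using finU by simp
    fix y assume y: "y \<in> (\<lambda>U. MIN W\<in>Dstar G U. ?f W) ` ?\<U>"
    obtain U where U: "y = (MIN W\<in>Dstar G U. ?f W)" "U \<in> ?\<U>" by (rule imageE[OF y])
    show "y \<le> real T" using N[OF U(2)] T[OF U(2)] U(1) by simp
  next
    have "real T = (MIN W\<in>Dstar G U0. ?f W)" using N[OF U0(1)] U0(2) by simp
    then show "real T \<in> (\<lambda>U. MIN W\<in>Dstar G U. ?f W) ` ?\<U>" using U0(1) by blast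
  qed
  moreover have "dstab ?V ?I = N ?V"
    unfolding dstab_def max_ideal_eq mem[OF V\<U>] by (rule Least_equality) auto
  ultimately show ?thesis using astab N[OF V\<U>] by simp
qed

end
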